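(* Let $n\ge1$ and let $f:M\to\mathbb{R}^{n+1}$ be a hyperbolic affine sphere with positive definite affine metric $h$. Then the smooth map $\mathcal{G}_{\sigma^+}:=\Phi\circ\mathcal{G}_f:(M,h)\to\mathbb{Y}_{n+1}$ is harmonic, where $\mathbb{Y}_{n+1}$ is endowed with its Riemannian metric induced by the Killing form.
   Context: Hyperbolic affine sphere. $M$ is a smooth oriented $n$-manifold. A hyperbolic affine sphere (normalized: centre the origin, affine normal $\xi=f$, shape operator $-\mathrm{Id}$) is an immersion $f:M\to\mathbb{R}^{n+1}$ with $\mathbb{R}^{n+1}=f_*(T_pM)\oplus\mathbb{R}f(p)$ for all $p$, $D_Xf_*Y=f_*(\nabla_XY)+h(X,Y)f$ ($D$ the flat connection) with $h$ positive definite, and $\det(f_*X_1,\dots,f_*X_n,f)=\omega_h(X_1,\dots,X_n)$ up to orientation, where $\omega_h$ is the volume form of the affine (Blaschke) metric $h$. Blaschke lift. $\mathbb{X}_{n+1}=\mathrm{SL}(n+1,\mathbb{R})/\mathrm{SO}(n+1)$ is the space of scalar products on $\mathbb{R}^{n+1}$ of determinant $1$, i.e. of symmetric positive definite matrices $N$ with $\det N=1$. $\mathcal{G}_f:M\to\mathbb{X}_{n+1}$ sends $p$ to the scalar product $Q_p$ with $Q_p(f_*X,f_*Y)=h_p(X,Y)$ for $X,Y\in T_pM$, $f(p)\perp_{Q_p}f_*(T_pM)$, and $Q_p(f(p),f(p))>0$ determined by $\det Q_p=1$. The map $\Phi$. On $\mathbb{R}^{n+1}\oplus\mathbb{R}^{n+1}$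 let $b((x,y),(\tilde x,\tilde y))=\tfrac12(x^T\tilde y+y^T\tilde x)$, of signature $(n+1,n+1)$. $\mathbb{Y}_{n+1}=\mathrm{SO}_0(n+1,n+1)/(\mathrm{SO}(n+1)\times\mathrm{SO}(n+1))$ is the symmetric space of $(n+1)$-dimensional subspaces on which $b$ is positive definite, with the invariant Riemannian metric induced by the Killing form. $\Phi:\mathbb{X}_{n+1}\to\mathbb{Y}_{n+1}$ is $\Phi(N)=\Gamma_N=\{(x,Nx):x\in\mathbb{R}^{n+1}\}$. A map is harmonic if its tension field vanishes. *)

theory Defs
  imports "HOL-Analysis.Analysis"
begin

section \<open>Smooth manifolds\<close>

text \<open>Smoothness is only ever used on open sets, where all iterated directional derivatives
  (hence all partial derivatives) existing and being continuous is the usual notion.\<close>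

primrec Ck_on :: "nat \<Rightarrow> 'a::euclidean_space set \<Rightarrow> ('a \<Rightarrow> 'b::euclidean_space) \<Rightarrow> bool" where
  "Ck_on 0 S f \<longleftrightarrow> continuous_on S f"
| "Ck_on (Suc k) S f \<longleftrightarrow>
     (\<forall>x\<in>S. f differentiable (at x)) \<and> (\<forall>v. Ck_on k S (\<lambda>x. frechet_derivative f (at x) v))"

definition smooth_on :: "'a::euclidean_space set \<Rightarrow> ('a \<Rightarrow> 'b::euclidean_space) \<Rightarrow> bool" where
  "smooth_on S f \<longleftrightarrow> (\<forall>k. Ck_on k S f)"

text \<open>A chart is a pair of a domain and a coordinate map; the values of the coordinate map outside
  the domain are irrelevant.\<close>

type_synonym ('m, 'e) chart = "'m set \<times> ('m \<Rightarrow> 'e)"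

definition chart_image :: "('m, 'e) chart \<Rightarrow> 'e set" where
  "chart_image c = snd c ` fst c"

definition chart_inv :: "('m, 'e) chart \<Rightarrow> 'e \<Rightarrow> 'm" where
  "chart_inv c = inv_into (fst c) (snd c)"

definition transition :: "('m, 'e) chart \<Rightarrow> ('m, 'e) chart \<Rightarrow> 'e \<Rightarrow> 'e" where
  "transition c d = snd d \<circ> chart_inv c"

definition smooth_manifold :: "'m topology \<Rightarrow> ('m, 'e::euclidean_space) chart set \<Rightarrow> bool" where
  "smooth_manifold M A \<longleftrightarrow>
     Hausdorff_space M \<and> second_countable M \<and>
     \<Union>(fst ` A) = topspace M \<and>
     (\<forall>c\<in>A. openin M (fst c) \<and> open (chart_image c) \<and>
        homeomorphic_map (subtopology M (fst c)) (top_of_set (chart_image c)) (snd c)) \<and>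
     (\<forall>c\<in>A. \<forall>d\<in>A. smooth_on (snd c ` (fst c \<inter> fst d)) (transition c d))"

text \<open>An orientation is given by an atlas with orientation preserving coordinate changes.\<close>

definition oriented_atlas :: "('m, real^'n::finite) chart set \<Rightarrow> bool" where
  "oriented_atlas A \<longleftrightarrow>
     (\<forall>c\<in>A. \<forall>d\<in>A. \<forall>x\<in>snd c ` (fst c \<inter> fst d).
        det (matrix (frechet_derivative (transition c d) (at x))) > 0)"

definition smooth_map ::
  "'m topology \<Rightarrow> ('m, 'e::euclidean_space) chart set \<Rightarrow>
   'y topology \<Rightarrow> ('y, 'k::euclidean_space) chart set \<Rightarrow> ('m \<Rightarrow> 'y) \<Rightarrow> bool" where
  "smooth_map M A Y B F \<longleftrightarrow>
     continuous_map M Y F \<and>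
     (\<forall>c\<in>A. \<forall>d\<in>B. smooth_on (snd c ` (fst c \<inter> F -` fst d)) (snd d \<circ> F \<circ> chart_inv c))"

section \<open>Riemannian metrics and harmonic maps\<close>

text \<open>A tangent vector at a point \<open>p\<close> is represented by its coordinate vector in a chart around
  \<open>p\<close>.  Correspondingly, a bilinear form on the tangent spaces is a function \<open>g\<close> such that
  \<open>g c p v w\<close> is the value at \<open>p\<close> on the two tangent vectors whose coordinates in the chart
  \<open>c\<close> are \<open>v\<close> and \<open>w\<close>.\<close>

type_synonym ('m, 'e) form2 = "('m, 'e) chart \<Rightarrow> 'm \<Rightarrow> 'e \<Rightarrow> 'e \<Rightarrow> real"

definition local_form :: "('m, 'e) form2 \<Rightarrow> ('m, 'e) chart \<Rightarrow> 'e \<Rightarrow> 'e \<Rightarrow> 'e \<Rightarrow> real" where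
  "local_form g c x = g c (chart_inv c x)"

definition riemannian_metric :: "('m, 'e::euclidean_space) chart set \<Rightarrow> ('m, 'e) form2 \<Rightarrow> bool" where
  "riemannian_metric A g \<longleftrightarrow>
     (\<forall>c\<in>A. \<forall>p\<in>fst c. bilinear (g c p) \<and> (\<forall>v w. g c p v w = g c p w v) \<and>
        (\<forall>v. v \<noteq> 0 \<longrightarrow> g c p v v > 0)) \<and>
     (\<forall>c\<in>A. \<forall>v w. smooth_on (chart_image c) (\<lambda>x. local_form g c x v w)) \<and>
     (\<forall>c\<in>A. \<forall>d\<in>A. \<forall>p\<in>fst c \<inter> fst d. \<forall>v w.
        g c p v w = g d p (frechet_derivative (transition c d) (at (snd c p)) v)
                          (frechet_derivative (transition c d) (at (snd c p)) w))"

text \<open>Christoffel symbols of the Levi-Civita connection of a metric \<open>G\<close> on an open subset of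
  Euclidean space, as the vector-valued bilinear map \<open>(u, v) \<mapsto> \<Gamma>(u, v)\<close> determined by the
  Koszul formula for constant vector fields.\<close>

definition christoffel ::
  "('e::euclidean_space \<Rightarrow> 'e \<Rightarrow> 'e \<Rightarrow> real) \<Rightarrow> 'e \<Rightarrow> 'e \<Rightarrow> 'e \<Rightarrow> 'e" where
  "christoffel G x u v = (THE z. \<forall>w.
     G x z w = (frechet_derivative (\<lambda>y. G y v w) (at x) u
              + frechet_derivative (\<lambda>y. G y u w) (at x) v
              - frechet_derivative (\<lambda>y. G y u v) (at x) w) / 2)"

definition gram_matrix :: "(real^'n::finite \<Rightarrow> real^'n \<Rightarrow> real) \<Rightarrow> real^'n^'n" where
  "gram_matrix b = (\<chi> i j. b (axis i 1) (axis j 1))"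

text \<open>The tension field
  \<open>h\<^sup>i\<^sup>j (\<partial>\<^sub>i \<partial>\<^sub>j u - \<Gamma>\<^sup>h(e\<^sub>i, e\<^sub>j)\<^sup>k \<partial>\<^sub>k u + \<Gamma>\<^sup>g\<^sub>u(\<partial>\<^sub>i u, \<partial>\<^sub>j u))\<close>,
  i.e. the trace with respect to \<open>h\<close> of the second fundamental form of
  \<open>F : (M, h) \<rightarrow> (Y, g)\<close>, in the charts \<open>c\<close> and \<open>d\<close> at the coordinate point \<open>x\<close>.\<close>

definition tension_field ::
  "('m, real^'n::finite) form2 \<Rightarrow> ('y, 'k::euclidean_space) form2 \<Rightarrow>
   ('m, real^'n) chart \<Rightarrow> ('y, 'k) chart \<Rightarrow> ('m \<Rightarrow> 'y) \<Rightarrow> real^'n \<Rightarrow> 'k" where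
  "tension_field h g c d F x =
     (let u = snd d \<circ> F \<circ> chart_inv c;
          du = (\<lambda>y. frechet_derivative u (at y));
          e = (\<lambda>i. axis i 1)
      in \<Sum>i\<in>UNIV. \<Sum>j\<in>UNIV. (matrix_inv (gram_matrix (local_form h c x)) $ i $ j) *\<^sub>R
           (frechet_derivative (\<lambda>y. du y (e j)) (at x) (e i)
            - du x (christoffel (local_form h c) x (e i) (e j))
            + christoffel (local_form g d) (u x) (du x (e i)) (du x (e j))))"

definition harmonic_map ::
  "'m topology \<Rightarrow> ('m, real^'n::finite) chart set \<Rightarrow> ('m, real^'n) form2 \<Rightarrow>
   'y topology \<Rightarrow> ('y, 'k::euclidean_space) chart set \<Rightarrow> ('y, 'k) form2 \<Rightarrow> ('m \<Rightarrow> 'y) \<Rightarrow> bool" where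
  "harmonic_map M A h Y B g F \<longleftrightarrow>
     smooth_map M A Y B F \<and>
     (\<forall>c\<in>A. \<forall>d\<in>B. \<forall>x\<in>snd c ` (fst c \<inter> F -` fst d). tension_field h g c d F x = 0)"

section \<open>Hyperbolic affine spheres\<close>

text \<open>The volume form of \<open>h\<close> on a manifold with an oriented atlas.\<close>

definition volume_form ::
  "('m, real^'n::finite) form2 \<Rightarrow> ('m, real^'n) chart \<Rightarrow> 'm \<Rightarrow> ('n \<Rightarrow> real^'n) \<Rightarrow> real" where
  "volume_form h c p X = sqrt (det (gram_matrix (h c p))) * det (\<chi> r i. X i $ r)"

text \<open>For an \<open>n\<close>-element type \<open>'n\<close>, the space \<open>real^('n option)\<close> is
  \<open>(n + 1)\<close>-dimensional.  The following is the determinant of the matrix with columns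
  \<open>X\<^sub>i\<close> for \<open>i :: 'n\<close> and the additional column \<open>y\<close>.\<close>

definition det_extend :: "('n::finite \<Rightarrow> real^('n option)) \<Rightarrow> real^('n option) \<Rightarrow> real" where
  "det_extend X y = det (\<chi> r c. case c of None \<Rightarrow> y $ r | Some i \<Rightarrow> X i $ r)"

definition coord_rep :: "('m, 'e) chart \<Rightarrow> ('m \<Rightarrow> 'b) \<Rightarrow> 'e \<Rightarrow> 'b" where
  "coord_rep c f = f \<circ> chart_inv c"

text \<open>The differential of a vector-valued map at \<open>p\<close>, on coordinate vectors in the chart
  \<open>c\<close>.\<close>

definition differential ::
  "('m, 'e::euclidean_space) chart \<Rightarrow> ('m \<Rightarrow> 'b::euclidean_space) \<Rightarrow> 'm \<Rightarrow> 'e \<Rightarrow> 'b" where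
  "differential c f p = frechet_derivative (coord_rep c f) (at (snd c p))"

definition cov_deriv ::
  "('e::euclidean_space \<Rightarrow> 'e \<Rightarrow> 'e \<Rightarrow> 'e) \<Rightarrow> ('e \<Rightarrow> 'e) \<Rightarrow> 'e \<Rightarrow> 'e \<Rightarrow> 'e" where
  "cov_deriv \<Gamma> Y x v = frechet_derivative Y (at x) v + \<Gamma> x v (Y x)"

text \<open>The structure equation \<open>D\<^sub>X f\<^sub>* Y = f\<^sub>*(\<nabla>\<^sub>X Y) + h(X, Y) f\<close>.  The connection
  \<open>\<nabla>\<close> is given by its Christoffel symbols \<open>\<Gamma> c\<close> in each chart; the vector field \<open>Y\<close> is
  given by its coordinates, and the vector \<open>X\<close> at the point \<open>x\<close> by \<open>v\<close>.  When \<open>f\<close> is an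
  immersion transversal to its position vector, the equation determines \<open>\<Gamma>\<close> and
  \<open>h\<close>, and it implies the transformation law of Christoffel symbols.\<close>

definition structure_equation ::
  "('m, real^'n::finite) chart set \<Rightarrow> ('m \<Rightarrow> real^('n option)) \<Rightarrow>
   (('m, real^'n) chart \<Rightarrow> real^'n \<Rightarrow> real^'n \<Rightarrow> real^'n \<Rightarrow> real^'n) \<Rightarrow> ('m, real^'n) form2 \<Rightarrow> bool"
  where
  "structure_equation A f \<Gamma> h \<longleftrightarrow>
     (\<forall>c\<in>A. \<forall>x\<in>chart_image c. \<forall>v. \<forall>Y. smooth_on (chart_image c) Y \<longrightarrow>
        frechet_derivative (\<lambda>y. frechet_derivative (coord_rep c f) (at y) (Y y)) (at x) v =
          frechet_derivative (coord_rep c f) (at x) (cov_deriv (\<Gamma> c) Y x v)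
          + local_form h c x v (Y x) *\<^sub>R coord_rep c f x)"

definition hyperbolic_affine_sphere ::
  "'m topology \<Rightarrow> ('m, real^'n::finite) chart set \<Rightarrow> ('m \<Rightarrow> real^('n option)) \<Rightarrow>
   ('m, real^'n) form2 \<Rightarrow> bool" where
  "hyperbolic_affine_sphere M A f h \<longleftrightarrow>
     smooth_map M A euclidean {(UNIV, id)} f \<and>
     (\<forall>c\<in>A. \<forall>p\<in>fst c. inj (differential c f p) \<and>
        range (differential c f p) \<inter> span {f p} = {0} \<and>
        {u + w | u w. u \<in> range (differential c f p) \<and> w \<in> span {f p}} = UNIV) \<and>
     riemannian_metric A h \<and>
     (\<exists>\<Gamma>. (\<forall>c\<in>A. \<forall>x\<in>chart_image c. bilinear (\<Gamma> c x)) \<and> structure_equation A f \<Gamma> h) \<and>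
     (\<forall>c\<in>A. \<forall>p\<in>fst c.
        (\<forall>X. det_extend (\<lambda>i. differential c f p (X i)) (f p) = volume_form h c p X) \<or>
        (\<forall>X. det_extend (\<lambda>i. differential c f p (X i)) (f p) = - volume_form h c p X))"

section \<open>The Blaschke lift\<close>

definition scalar_products :: "(real^'k::finite^'k) set" where
  "scalar_products =
     {N. transpose N = N \<and> (\<forall>x. x \<noteq> 0 \<longrightarrow> x \<bullet> (N *v x) > 0) \<and> det N = 1}"

definition blaschke_lift ::
  "('m, real^'n::finite) chart set \<Rightarrow> ('m \<Rightarrow> real^('n option)) \<Rightarrow> ('m, real^'n) form2 \<Rightarrow>
   'm \<Rightarrow> real^('n option)^('n option)" where
  "blaschke_lift A f h p = (THE N. N \<in> scalar_products \<and>
     (\<forall>c\<in>A. p \<in> fst c \<longrightarrow>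
        (\<forall>v w. differential c f p v \<bullet> (N *v differential c f p w) = h c p v w) \<and>
        (\<forall>v. f p \<bullet> (N *v differential c f p v) = 0)))"

section \<open>The symmetric space of positive definite subspaces\<close>

definition bform :: "(real^'k::finite) \<times> (real^'k) \<Rightarrow> (real^'k) \<times> (real^'k) \<Rightarrow> real" where
  "bform u v = (fst u \<bullet> snd v + snd u \<bullet> fst v) / 2"

definition positive_subspaces :: "((real^'k::finite) \<times> (real^'k)) set set" where
  "positive_subspaces =
     {P. subspace P \<and> dim P = CARD('k) \<and> (\<forall>u\<in>P. u \<noteq> 0 \<longrightarrow> bform u u > 0)}"

definition graph :: "real^'k::finite^'k \<Rightarrow> ((real^'k) \<times> (real^'k)) set" where
  "graph N = {(x, N *v x) | x. True}"

text \<open>The smooth structure is that of an open subset of the Grassmannian.  Since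
  \<open>bform\<close> vanishes on \<open>{0} \<times> real^'k\<close>, every positive definite subspace of dimension
  \<open>CARD('k)\<close> is complementary to it, hence the graph of a unique (not necessarily symmetric)
  matrix: the single affine chart \<open>graph N \<mapsto> N\<close> of the Grassmannian covers the whole space.\<close>

definition graph_chart :: "(((real^'k::finite) \<times> (real^'k)) set, real^'k^'k) chart" where
  "graph_chart = (positive_subspaces, \<lambda>P. THE N. P = graph N)"

definition Y_topology :: "((real^'k::finite) \<times> (real^'k)) set topology" where
  "Y_topology = pullback_topology positive_subspaces (snd graph_chart) euclidean"

definition Y_atlas :: "(((real^'k::finite) \<times> (real^'k)) set, real^'k^'k) chart set" where
  "Y_atlas = {graph_chart}"

definition Phi :: "real^'k::finite^'k \<Rightarrow> ((real^'k) \<times> (real^'k)) set" where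
  "Phi N = graph N"

subsection \<open>The metric induced by the Killing form\<close>

type_synonym 'k endo = "((real^'k) \<times> (real^'k)) \<Rightarrow>\<^sub>L ((real^'k) \<times> (real^'k))"

definition so_b :: "'k::finite endo set" where
  "so_b = {X. \<forall>u v. bform (blinfun_apply X u) v + bform u (blinfun_apply X v) = 0}"

text \<open>The trace of a linear endomorphism of a finite-dimensional subspace \<open>S\<close>.\<close>

definition trace_on :: "'a::real_vector set \<Rightarrow> ('a \<Rightarrow> 'a) \<Rightarrow> real" where
  "trace_on S T = (let B = SOME B. independent B \<and> span B = S
                   in \<Sum>b\<in>B. representation B (T b) b)"

definition ad :: "'k::finite endo \<Rightarrow> 'k endo \<Rightarrow> 'k endo" where
  "ad X Z = (X o\<^sub>L Z) - (Z o\<^sub>L X)"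

definition killing_form :: "'k::finite endo \<Rightarrow> 'k endo \<Rightarrow> real" where
  "killing_form X Z = trace_on so_b (ad X \<circ> ad Z)"

definition isotropy_algebra :: "((real^'k::finite) \<times> (real^'k)) set \<Rightarrow> 'k endo set" where
  "isotropy_algebra P = {X \<in> so_b. blinfun_apply X ` P \<subseteq> P}"

definition cartan_complement :: "((real^'k::finite) \<times> (real^'k)) set \<Rightarrow> 'k endo set" where
  "cartan_complement P = {X \<in> so_b. \<forall>Z\<in>isotropy_algebra P. killing_form X Z = 0}"

definition endo_exp :: "'k::finite endo \<Rightarrow> 'k endo" where
  "endo_exp X = (\<Sum>j. (1 / fact j) *\<^sub>R ((\<lambda>Z. X o\<^sub>L Z) ^^ j) id_blinfun)"

text \<open>Differentiating the action of one-parameter subgroups at \<open>P\<close> identifies the complement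
  (with respect to the Killing form) of the isotropy algebra with the tangent space at
  \<open>P\<close>.  The following is the inverse of this identification, on coordinate vectors.\<close>

definition cartan_lift ::
  "(((real^'k::finite) \<times> (real^'k)) set, real^'k^'k) chart \<Rightarrow>
   ((real^'k) \<times> (real^'k)) set \<Rightarrow> real^'k^'k \<Rightarrow> 'k endo" where
  "cartan_lift d P v = (THE X. X \<in> cartan_complement P \<and>
     ((\<lambda>t. snd d (blinfun_apply (endo_exp (t *\<^sub>R X)) ` P)) has_vector_derivative v) (at 0))"

definition killing_metric :: "(((real^'k::finite) \<times> (real^'k)) set, real^'k^'k) form2" where
  "killing_metric d P v w = killing_form (cartan_lift d P v) (cartan_lift d P w)"

end

theory Submission
  imports Defs
begin

text \<open>Every positive definite subspace is the graph of a matrix \<open>P\<close> with positive definite symmetric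
  part \<open>S\<close>.  The Killing form is a positive multiple of the trace form, and the invariant metric becomes
  a positive multiple of \<open>tr (S\<^sup>-\<^sup>1 v S\<^sup>-\<^sup>1 w\<^sup>T)\<close> at \<open>P\<close>.  Hence along symmetric \<open>P\<close> its Christoffel symbols in
  symmetric directions are \<open>- (u P\<^sup>-\<^sup>1 v + v P\<^sup>-\<^sup>1 u) / 2\<close>, and harmonicity of the Blaschke lift \<open>Q\<close> means
  \<open>\<Delta> Q = tr\<^sub>h (dQ Q\<^sup>-\<^sup>1 dQ)\<close>.

  This equation is tested on the frame \<open>F, \<partial>\<^sub>i F\<close> of the ambient space.  The orthogonality relations
  defining \<open>Q\<close> give \<open>\<partial>\<^sub>i Q F = - 2 Q \<partial>\<^sub>i F\<close>.  Differentiating once more shows that \<open>\<partial>\<^sub>i Q \<partial>\<^sub>j F\<close> is symmetric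
  in \<open>i, j\<close>, the Koszul formula gives \<open>2 Q (\<partial>\<^sub>i\<partial>\<^sub>j F - \<Gamma>\<^sub>i\<^sub>j\<^sup>l \<partial>\<^sub>l F) = - \<partial>\<^sub>i Q \<partial>\<^sub>j F\<close>, and \<open>det Q = 1\<close> gives the
  apolarity condition \<open>h\<^sup>i\<^sup>j \<partial>\<^sub>i Q \<partial>\<^sub>j F = - 2 n Q F\<close>.  The equation on \<open>F\<close> follows at once, and the equation
  on \<open>\<partial>\<^sub>k F\<close> follows by differentiating the apolarity condition.\<close>

section \<open>Calculus of smooth maps\<close>

text \<open>The Blaschke volume condition links the determinant normalization to the frame. The
  frame of \<open>F\<close> and its partial derivatives has squared determinant det h, while its
  Gram determinant for \<open>Q\<close> is Q(F,F) det h; with \<open>det Q = 1\<close> this forces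
  Q(F,F) = 1, so \<open>Q F\<close> is the conormal. The chart of the target consists of all
  matrices with positive definite symmetric part, not only the symmetric ones in the image of
  \<open>Phi\<close>. The metric must therefore be known at nonsymmetric points and tested against
  nonsymmetric directions. The skew part \<open>K\<close> of such a point is removed by the
  isometric shear (x, y) to (x, y + K x). Transposition is an isometry of the resulting metric that
  fixes the symmetric matrices, which explains why no skew terms appear in their Christoffel
  symbols. The trace form carries the factor 2 (n + 1) - 2, positive because n is at least 1. Of the
  second fundamental form of \<open>Q\<close>, every single component annihilates \<open>F\<close>;
  on tangent vectors it is the \<open>h\<close>-trace that is shown to vanish, and this is where
  apolarity enters.\<close>

lemma bounded_bilinear_matrix_mult:
  "bounded_bilinear ((**) :: real^'n::finite^'m::finite \<Rightarrow> real^'p::finite^'n \<Rightarrow> real^'p^'m)"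
  unfolding bilinear_conv_bounded_bilinear[symmetric] bilinear_def linear_iff
  by (simp add: matrix_matrix_mult_def vec_eq_iff sum.distrib sum_distrib_left ring_distribs mult.assoc mult.left_commute)

lemma bounded_bilinear_matrix_vector_mult:
  "bounded_bilinear ((*v) :: real^'n::finite^'m::finite \<Rightarrow> real^'n \<Rightarrow> real^'m)"
  unfolding bilinear_conv_bounded_bilinear[symmetric] bilinear_def linear_iff
  by (simp add: matrix_vector_mult_def vec_eq_iff sum.distrib sum_distrib_left ring_distribs mult.assoc mult.left_commute)

lemma bounded_linear_transpose: "bounded_linear (transpose :: real^'n::finite^'m::finite \<Rightarrow> real^'m^'n)"
  by (rule linear_conv_bounded_linear[THEN iffD1]) (simp add: linear_iff transpose_def vec_eq_iff)

lemma Ck_on_continuous_on: "Ck_on k S f \<Longrightarrow> continuous_on S f"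
  by (cases k) (auto intro!: differentiable_imp_continuous_on
      simp: differentiable_on_def differentiable_at_withinI)

lemma Ck_on_SucD: "Ck_on (Suc k) S f \<Longrightarrow> Ck_on k S f"
proof (induction k arbitrary: f)
  case 0
  then show ?case using Ck_on_continuous_on[OF 0] by simp
next
  case (Suc k)
  then show ?case by (metis Ck_on.simps(2))
qed

text \<open>Since \<open>S\<close> is open, equality on \<open>S\<close> is equality near each of
  its points, so the derivatives agree as well.\<close>

lemma Ck_on_cong:
  assumes "open S" "\<And>x. x \<in> S \<Longrightarrow> f x = g x" "Ck_on k S f"
  shows "Ck_on k S g"
  using assms(2,3)
proof (induction k arbitrary: f g)
  case 0
  then show ?case by (simp cong: continuous_on_cong)
next
  case (Suc k)
  have d: "g differentiable (at x)" "frechet_derivative g (at x) = frechet_derivative f (at x)"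
    if "x \<in> S" for x
  proof -
    have "f differentiable (at x)" using Suc that by simp
    then have "(g has_derivative frechet_derivative f (at x)) (at x)"
      using has_derivative_transform_within_open[OF _ assms(1) that Suc.prems(1)]
      by (simp add: frechet_derivative_works)
    then show "g differentiable (at x)" "frechet_derivative g (at x) = frechet_derivative f (at x)"
      using differentiableI frechet_derivative_at by (blast, metis)
  qed
  show ?case
  proof (simp, intro conjI ballI allI)
    show "g differentiable (at x)" if "x \<in> S" for x using d that by blast
    show "Ck_on k S (\<lambda>x. frechet_derivative g (at x) v)" for v
      by (rule Suc.IH[of "\<lambda>x. frechet_derivative f (at x) v"]) (use d Suc.prems(2) in auto)
  qed
qed

lemma Ck_on_SucI:
  assumes "open S" "\<And>x. x \<in> S \<Longrightarrow> (f has_derivative f' x) (at x)" "\<And>v. Ck_on k S (\<lambda>x. f' x v)"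
  shows "Ck_on (Suc k) S f"
proof -
  have "frechet_derivative f (at x) = f' x" if "x \<in> S" for x
    using frechet_derivative_at[OF assms(2)[OF that]] by simp
  then have "Ck_on k S (\<lambda>x. frechet_derivative f (at x) v)" for v
    by (intro Ck_on_cong[OF assms(1) _ assms(3)[of v]]) auto
  then show ?thesis using assms(2) by (auto simp: differentiable_def)
qed

lemma Ck_on_SucE:
  assumes "Ck_on (Suc k) S f" "x \<in> S"
  shows "(f has_derivative frechet_derivative f (at x)) (at x)"
  using assms by (simp add: frechet_derivative_works)

lemma Ck_on_const: "Ck_on k S (\<lambda>x. c)"
  by (induction k arbitrary: c) (auto intro!: continuous_intros)

lemma Ck_on_linear:
  assumes S: "open S" and L: "bounded_linear L" and f: "Ck_on k S f"
  shows "Ck_on k S (\<lambda>x. L (f x))"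
  using f
proof (induction k arbitrary: f)
  case 0
  then show ?case by (auto intro: bounded_linear.continuous_on[OF L])
next
  case (Suc k)
  show ?case
    by (rule Ck_on_SucI[OF S bounded_linear.has_derivative[OF L Ck_on_SucE[OF Suc.prems]]])
       (use Suc in auto)
qed

lemma Ck_on_add:
  assumes S: "open S" and f: "Ck_on k S f" and g: "Ck_on k S g"
  shows "Ck_on k S (\<lambda>x. f x + g x)"
  using f g
proof (induction k arbitrary: f g)
  case 0
  then show ?case by (auto intro: continuous_intros)
next
  case (Suc k)
  show ?case
    by (rule Ck_on_SucI[OF S has_derivative_add[OF Ck_on_SucE[OF Suc.prems(1)] Ck_on_SucE[OF Suc.prems(2)]]])
       (use Suc in auto)
qed

text \<open>One product rule serves scalar, inner, matrix and matrix-vector products. Each summand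
  of the derivative keeps one factor undifferentiated, and \<open>Ck_on_SucD\<close> lowers that
  factor to the required order.\<close>

lemma Ck_on_bilinear:
  assumes S: "open S" and B: "bounded_bilinear B" and f: "Ck_on k S f" and g: "Ck_on k S g"
  shows "Ck_on k S (\<lambda>x. B (f x) (g x))"
  using f g
proof (induction k arbitrary: f g)
  case 0
  then show ?case by (auto intro: bounded_bilinear.continuous_on[OF B])
next
  case (Suc k)
  show ?case
    by (rule Ck_on_SucI[OF S bounded_bilinear.FDERIV[OF B Ck_on_SucE[OF Suc.prems(1)] Ck_on_SucE[OF Suc.prems(2)]]])
       (use Suc Ck_on_SucD[OF Suc.prems(1)] Ck_on_SucD[OF Suc.prems(2)] in \<open>auto intro!: Ck_on_add[OF S]\<close>)
qed

text \<open>The derivative of 1/f is a product of the derivative of \<open>f\<close> with two copies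
  of 1/f, so the induction hypothesis on 1/f closes the step.\<close>

lemma Ck_on_inverse:
  fixes f :: "'a::euclidean_space \<Rightarrow> real"
  assumes S: "open S" and f: "Ck_on k S f" and nz: "\<And>x. x \<in> S \<Longrightarrow> f x \<noteq> 0"
  shows "Ck_on k S (\<lambda>x. inverse (f x))"
  using f
proof (induction k)
  case 0
  then show ?case using nz by (auto intro: continuous_intros)
next
  case (Suc k)
  have i: "Ck_on k S (\<lambda>x. inverse (f x))" using Suc Ck_on_SucD by blast
  note mult = Ck_on_bilinear[OF S bounded_bilinear_mult]
  have "Ck_on k S (\<lambda>x. - (inverse (f x) * frechet_derivative f (at x) v * inverse (f x)))" for v
    using Suc.prems by (intro mult Ck_on_linear[OF S bounded_linear_minus[OF bounded_linear_ident]] i) auto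
  then show ?case
    by (intro Ck_on_SucI[OF S Deriv.has_derivative_inverse[OF nz Ck_on_SucE[OF Suc.prems]]]) auto
qed

lemma Ck_on_sum:
  assumes "open S" "\<And>i. i \<in> I \<Longrightarrow> Ck_on k S (f i)"
  shows "Ck_on k S (\<lambda>x. \<Sum>i\<in>I. f i x)"
  using assms(2) by (induction I rule: infinite_finite_induct) (auto intro!: Ck_on_add assms(1) Ck_on_const)

lemma Ck_on_prod:
  fixes f :: "'i \<Rightarrow> 'a::euclidean_space \<Rightarrow> real"
  assumes "open S" "\<And>i. i \<in> I \<Longrightarrow> Ck_on k S (f i)"
  shows "Ck_on k S (\<lambda>x. \<Prod>i\<in>I. f i x)"
  using assms(2) by (induction I rule: infinite_finite_induct)
    (auto intro!: Ck_on_bilinear[OF assms(1) bounded_bilinear_mult] Ck_on_const)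

lemma Ck_on_vec:
  fixes f :: "'a::euclidean_space \<Rightarrow> 'b::euclidean_space^'n::finite"
  assumes S: "open S" and f: "\<And>i. Ck_on k S (\<lambda>x. f x $ i)"
  shows "Ck_on k S f"
proof -
  define L :: "'n \<Rightarrow> 'b \<Rightarrow> 'b^'n" where "L i y = axis i y" for i y
  have L: "bounded_linear (L i)" for i
    by (rule linear_conv_bounded_linear[THEN iffD1]) (simp add: L_def linear_iff axis_def vec_eq_iff)
  have "Ck_on k S (\<lambda>x. \<Sum>i\<in>UNIV. L i (f x $ i))"
    by (intro Ck_on_sum[OF S] Ck_on_linear[OF S L] f)
  moreover have "(\<lambda>x. \<Sum>i\<in>UNIV. L i (f x $ i)) = f"
    by (rule ext) (simp add: L_def vec_eq_iff axis_def if_distrib cong: if_cong)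
  ultimately show ?thesis by simp
qed

lemma Ck_on_vec_nth:
  fixes f :: "'a::euclidean_space \<Rightarrow> 'b::euclidean_space^'n::finite"
  assumes S: "open S" and f: "Ck_on k S f"
  shows "Ck_on k S (\<lambda>x. f x $ i)"
  using Ck_on_linear[OF S bounded_linear_vec_nth f] .

lemma Ck_on_det:
  fixes A :: "'a::euclidean_space \<Rightarrow> real^'n::finite^'n"
  assumes S: "open S" and A: "Ck_on k S A"
  shows "Ck_on k S (\<lambda>x. det (A x))"
  unfolding det_def
  by (intro Ck_on_sum[OF S] Ck_on_prod[OF S] Ck_on_bilinear[OF S bounded_bilinear_mult]
      Ck_on_const Ck_on_vec_nth[OF S] A)

section \<open>Inverse and determinant of a matrix: smoothness and derivatives\<close>

lemma matrix_inv_mult: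
  fixes A :: "real^'n::finite^'n"
  assumes "det A \<noteq> 0"
  shows "A ** matrix_inv A = mat 1" "matrix_inv A ** A = mat 1"
proof -
  have "\<exists>B. A ** B = mat 1 \<and> B ** A = mat 1"
    using assms by (simp add: invertible_det_nz[symmetric] invertible_def)
  then show "A ** matrix_inv A = mat 1" "matrix_inv A ** A = mat 1"
    unfolding matrix_inv_def by (rule someI2_ex; simp)+
qed

text \<open>Cramer's rule, applied to the columns of the inverse, writes its entries as quotients of
  polynomials in the entries of \<open>A\<close>; this gives smoothness.\<close>

lemma matrix_inv_cramer:
  fixes A :: "real^'n::finite^'n"
  assumes "det A \<noteq> 0"
  shows "matrix_inv A $ k $ l = det (\<chi> i j. if j = k then axis l 1 $ i else A $ i $ j) * inverse (det A)"
proof -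
  have "A *v (matrix_inv A *v axis l 1) = axis l 1"
    using matrix_inv_mult[OF assms] by (simp add: matrix_vector_mul_assoc)
  then have "matrix_inv A *v axis l 1 = (\<chi> k. det (\<chi> i j. if j = k then axis l 1 $ i else A $ i $ j) / det A)"
    using cramer[OF assms] by blast
  then have "(matrix_inv A *v axis l 1) $ k = det (\<chi> i j. if j = k then axis l 1 $ i else A $ i $ j) / det A"
    by simp
  then show ?thesis
    by (simp add: matrix_vector_mult_basis column_def divide_inverse)
qed

lemma Ck_on_matrix_inv:
  fixes A :: "'a::euclidean_space \<Rightarrow> real^'n::finite^'n"
  assumes S: "open S" and A: "Ck_on k S A" and nz: "\<And>x. x \<in> S \<Longrightarrow> det (A x) \<noteq> 0"
  shows "Ck_on k S (\<lambda>x. matrix_inv (A x))"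
proof (intro Ck_on_vec[OF S])
  fix i j
  have "Ck_on k S (\<lambda>x. det (\<chi> i' j'. if j' = i then axis j 1 $ i' else A x $ i' $ j') * inverse (det (A x)))"
  proof (intro Ck_on_bilinear[OF S bounded_bilinear_mult] Ck_on_det[OF S] Ck_on_inverse[OF S] Ck_on_vec[OF S] A nz)
    fix i' j'
    show "Ck_on k S (\<lambda>x. (\<chi> i' j'. if j' = i then axis j 1 $ i' else A x $ i' $ j') $ i' $ j')"
      by (cases "j' = i") (auto intro!: Ck_on_const Ck_on_vec_nth[OF S] A)
  qed (auto simp: nz intro!: Ck_on_vec_nth[OF S] A)
  then show "Ck_on k S (\<lambda>x. matrix_inv (A x) $ i $ j)"
    by (rule Ck_on_cong[OF S, rotated]) (simp add: matrix_inv_cramer nz)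
qed

lemma Ck_on_ident: "open S \<Longrightarrow> Ck_on k S (\<lambda>x. x)"
  by (cases k) (auto simp: Ck_on_const)

lemma open_det_nonzero: "open {A :: real^'n::finite^'n. det A \<noteq> 0}"
proof -
  have "Ck_on 0 UNIV (\<lambda>A::real^'n^'n. det A)"
    by (intro Ck_on_det Ck_on_ident) auto
  then have "continuous_on UNIV (\<lambda>A::real^'n^'n. det A)" by simp
  then show ?thesis by (intro open_Collect_neq) (auto intro: continuous_intros)
qed

text \<open>Differentiability is already known from Cramer's rule, so differentiating
  \<open>A ** matrix_inv A = mat 1\<close> determines the derivative.\<close>

lemma has_derivative_matrix_inv:
  fixes A :: "real^'n::finite^'n"
  assumes "det A \<noteq> 0"
  shows "(matrix_inv has_derivative (\<lambda>u. - (matrix_inv A ** u ** matrix_inv A))) (at A)"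
proof -
  let ?S = "{A :: real^'n^'n. det A \<noteq> 0}"
  have AS: "A \<in> ?S" using assms by simp
  have "Ck_on (Suc 0) ?S (\<lambda>A. matrix_inv A)"
    by (intro Ck_on_matrix_inv open_det_nonzero Ck_on_ident) auto
  then obtain D where D: "(matrix_inv has_derivative D) (at A)"
    using Ck_on_SucE AS by blast
  have "((\<lambda>A. A ** matrix_inv A) has_derivative (\<lambda>u. A ** D u + u ** matrix_inv A)) (at A)"
    using bounded_bilinear.FDERIV[OF bounded_bilinear_matrix_mult has_derivative_ident D] by simp
  moreover have "((\<lambda>A. A ** matrix_inv A) has_derivative (\<lambda>u. 0)) (at A)"
    by (rule has_derivative_transform_within_open[OF has_derivative_const[of "mat 1"] open_det_nonzero AS])
       (simp add: matrix_inv_mult)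
  ultimately have "(\<lambda>u. A ** D u + u ** matrix_inv A) = (\<lambda>u. 0)"
    by (rule has_derivative_unique)
  then have "A ** D u + u ** matrix_inv A = 0" for u by meson
  then have "A ** D u = - (u ** matrix_inv A)" for u
    by (metis add_eq_0_iff2)
  then have "matrix_inv A ** (A ** D u) = matrix_inv A ** (- (u ** matrix_inv A))" for u by simp
  then have "D u = - (matrix_inv A ** u ** matrix_inv A)" for u
    using assms bounded_bilinear.minus_right[OF bounded_bilinear_matrix_mult]
    by (metis matrix_inv_mult(2) matrix_mul_assoc matrix_mul_lid)
  then have "D = (\<lambda>u. - (matrix_inv A ** u ** matrix_inv A))" by blast
  with D show ?thesis by simp
qed

lemma has_derivative_det_mat_1:
  "(det has_derivative trace) (at (mat 1 :: real^'n::finite^'n))"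
proof -
  let ?I = "mat 1 :: real^'n^'n"
  have p: "((\<lambda>A. of_int (sign p) * (\<Prod>i\<in>UNIV. A $ i $ p i)) has_derivative
      (\<lambda>B. of_int (sign p) * (\<Sum>i\<in>UNIV. B $ i $ p i * (\<Prod>j\<in>UNIV - {i}. ?I $ j $ p j)))) (at ?I)" for p :: "'n \<Rightarrow> 'n"
    by (intro has_derivative_mult_right has_derivative_prod
        bounded_linear.has_derivative[OF bounded_linear_vec_nth] has_derivative_ident)
  have 1: "(det has_derivative (\<lambda>B. \<Sum>p\<in>{p. p permutes (UNIV::'n set)}.
      of_int (sign p) * (\<Sum>i\<in>UNIV. B $ i $ p i * (\<Prod>j\<in>UNIV - {i}. ?I $ j $ p j)))) (at ?I)"
    unfolding det_def[abs_def] by (intro has_derivative_sum p)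
  \<comment> \<open>A permutation other than the identity moves at least two points. Even after the
    factor at \<open>i\<close> has been differentiated, an off-diagonal entry of the identity matrix
    remains in the product.\<close>
  have z: "(\<Prod>j\<in>UNIV - {i}. ?I $ j $ p j) = 0" if p: "p permutes (UNIV::'n set)" "p \<noteq> id" for p i
  proof -
    have "\<exists>j. j \<noteq> i \<and> p j \<noteq> j"
    proof (rule ccontr)
      assume "\<not> ?thesis"
      then have j: "p j = j" if "j \<noteq> i" for j using that by blast
      then have "p i = i" using p(1) by (metis permutes_def)
      with j have "p x = x" for x by (cases "x = i") auto
      then have "p = id" by auto
      with p(2) show False by simp
    qed
    then obtain j where "j \<noteq> i" "p j \<noteq> j" by blast
    then show ?thesis by (intro prod_zero) (auto simp: mat_def intro!: bexI[of _ j])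
  qed
  have "(\<Sum>p\<in>{p. p permutes (UNIV::'n set)}.
      of_int (sign p) * (\<Sum>i\<in>UNIV. B $ i $ p i * (\<Prod>j\<in>UNIV - {i}. ?I $ j $ p j))) = trace B" for B :: "real^'n^'n"
  proof -
    have "(\<Sum>p\<in>{p. p permutes (UNIV::'n set)}.
      of_int (sign p) * (\<Sum>i\<in>UNIV. B $ i $ p i * (\<Prod>j\<in>UNIV - {i}. ?I $ j $ p j)))
      = (\<Sum>p\<in>{id}. of_int (sign p) * (\<Sum>i\<in>UNIV. B $ i $ p i * (\<Prod>j\<in>UNIV - {i}. ?I $ j $ p j)))"
      by (rule sum.mono_neutral_right) (auto simp: z permutes_id finite_permutations)
    also have "\<dots> = trace B" by (simp add: trace_def mat_def)
    finally show ?thesis .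
  qed
  then have "(\<lambda>B. \<Sum>p\<in>{p. p permutes (UNIV::'n set)}.
      of_int (sign p) * (\<Sum>i\<in>UNIV. B $ i $ p i * (\<Prod>j\<in>UNIV - {i}. ?I $ j $ p j))) = trace"
    by (rule ext)
  with 1 show ?thesis by simp
qed

text \<open>Multiplicativity of the determinant moves the base point from \<open>A\<close> to the
  identity.\<close>

lemma has_derivative_det:
  fixes A :: "real^'n::finite^'n"
  assumes "det A \<noteq> 0"
  shows "(det has_derivative (\<lambda>u. det A * trace (matrix_inv A ** u))) (at A)"
proof -
  have l: "((\<lambda>Y. matrix_inv A ** Y) has_derivative (\<lambda>u. matrix_inv A ** u)) (at A)"
    by (intro bounded_linear_imp_has_derivative bounded_bilinear.bounded_linear_right bounded_bilinear_matrix_mult)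
  have "((\<lambda>Y. det (matrix_inv A ** Y)) has_derivative (\<lambda>u. trace (matrix_inv A ** u))) (at A)"
    using has_derivative_compose[OF l, of det trace] has_derivative_det_mat_1
    by (simp add: matrix_inv_mult assms)
  then have "((\<lambda>Y. det A * det (matrix_inv A ** Y)) has_derivative (\<lambda>u. det A * trace (matrix_inv A ** u))) (at A)"
    by (rule has_derivative_mult_right)
  moreover have "det A * det (matrix_inv A ** Y) = det Y" for Y
    by (metis det_mul matrix_inv_mult(1)[OF assms] matrix_mul_assoc matrix_mul_lid)
  ultimately show ?thesis by simp
qed

section \<open>Symmetry of second derivatives\<close>

lemma symmetric_second_derivative_real:
  fixes f :: "'a::euclidean_space \<Rightarrow> real"
  assumes S: "open S" "x \<in> S" and f: "Ck_on (Suc (Suc 0)) S f"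
  shows "frechet_derivative (\<lambda>y. frechet_derivative f (at y) v) (at x) u
       = frechet_derivative (\<lambda>y. frechet_derivative f (at y) u) (at x) v"
proof -
  \<comment> \<open>Two applications of the mean value theorem express the second difference over
    the parallelogram spanned by t u and t v as a value of a mixed derivative. The difference is
    symmetric in u and v, so continuity makes both mixed derivatives agree.\<close>
  have mvt: "\<exists>p q. 0 < p \<and> p < t \<and> 0 < q \<and> q < t \<and>
      f (x + t *\<^sub>R u + t *\<^sub>R v) - f (x + t *\<^sub>R u) - (f (x + t *\<^sub>R v) - f x) =
      t * t * frechet_derivative (\<lambda>y. frechet_derivative f (at y) u) (at (x + p *\<^sub>R u + q *\<^sub>R v)) v"
    if t: "t > 0" and B: "\<And>p q. 0 \<le> p \<Longrightarrow> p \<le> t \<Longrightarrow> 0 \<le> q \<Longrightarrow> q \<le> t \<Longrightarrow> x + p *\<^sub>R u + q *\<^sub>R v \<in> S"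
    for t u v
  proof -
    have lin: "linear (frechet_derivative g (at y))" if "Ck_on (Suc 0) S g" "y \<in> S" for g :: "'a \<Rightarrow> real" and y
      using that by (simp add: linear_frechet_derivative)
    have line: "((\<lambda>s. g (a + s *\<^sub>R w)) has_real_derivative frechet_derivative g (at (a + r *\<^sub>R w)) w) (at r)"
      if g: "Ck_on (Suc 0) S g" and r: "a + r *\<^sub>R w \<in> S" for g :: "'a \<Rightarrow> real" and a r w
    proof -
      have 1: "((\<lambda>s. a + s *\<^sub>R w) has_derivative (\<lambda>s. s *\<^sub>R w)) (at r)"
        by (auto intro!: derivative_eq_intros)
      have "((\<lambda>s. g (a + s *\<^sub>R w)) has_derivative (\<lambda>s. frechet_derivative g (at (a + r *\<^sub>R w)) (s *\<^sub>R w))) (at r)"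
        by (rule has_derivative_compose[OF 1 Ck_on_SucE[OF g r]])
      then show ?thesis
        by (rule has_derivative_imp_has_field_derivative) (simp add: linear_cmul[OF lin[OF g r]])
    qed
    have f1: "Ck_on (Suc 0) S f" using f Ck_on_SucD by blast
    have f2: "Ck_on (Suc 0) S (\<lambda>y. frechet_derivative f (at y) u)" using f by simp
    define phi where "phi s = f (x + t *\<^sub>R v + s *\<^sub>R u) - f (x + s *\<^sub>R u)" for s
    have "\<exists>p. 0 < p \<and> p < t \<and> phi t - phi 0 = (t - 0) *
        (frechet_derivative f (at (x + t *\<^sub>R v + p *\<^sub>R u)) u - frechet_derivative f (at (x + p *\<^sub>R u)) u)"
      unfolding phi_def
    proof (rule MVT2[OF t])
      fix s assume s: "0 \<le> s" "s \<le> t"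
      have e: "x + t *\<^sub>R v + s *\<^sub>R u = x + s *\<^sub>R u + t *\<^sub>R v" by (simp add: algebra_simps)
      have "x + t *\<^sub>R v + s *\<^sub>R u \<in> S" "x + s *\<^sub>R u \<in> S"
        unfolding e using B[OF s, of t] B[OF s, of 0] t by auto
      then show "((\<lambda>s. f (x + t *\<^sub>R v + s *\<^sub>R u) - f (x + s *\<^sub>R u)) has_real_derivative
          frechet_derivative f (at (x + t *\<^sub>R v + s *\<^sub>R u)) u - frechet_derivative f (at (x + s *\<^sub>R u)) u) (at s)"
        by (intro DERIV_diff line f1)
    qed
    then obtain p where p: "0 < p" "p < t" and e1: "phi t - phi 0 = t *
        (frechet_derivative f (at (x + t *\<^sub>R v + p *\<^sub>R u)) u - frechet_derivative f (at (x + p *\<^sub>R u)) u)"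
      by auto
    have "\<exists>q. 0 < q \<and> q < t \<and> frechet_derivative f (at (x + p *\<^sub>R u + t *\<^sub>R v)) u - frechet_derivative f (at (x + p *\<^sub>R u + 0 *\<^sub>R v)) u
      = (t - 0) * frechet_derivative (\<lambda>y. frechet_derivative f (at y) u) (at (x + p *\<^sub>R u + q *\<^sub>R v)) v"
      by (rule MVT2[OF t]) (use B p in \<open>auto intro!: line[OF f2]\<close>)
    then obtain q where q: "0 < q" "q < t" and e2: "frechet_derivative f (at (x + p *\<^sub>R u + t *\<^sub>R v)) u - frechet_derivative f (at (x + p *\<^sub>R u)) u
      = t * frechet_derivative (\<lambda>y. frechet_derivative f (at y) u) (at (x + p *\<^sub>R u + q *\<^sub>R v)) v"
      by auto
    have c: "x + t *\<^sub>R v + r *\<^sub>R u = x + r *\<^sub>R u + t *\<^sub>R v" for r by (simp add: algebra_simps)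
    show ?thesis
      using e1 e2 p q unfolding phi_def c
      by (intro exI[of _ p] exI[of _ q]) (simp add: mult.assoc)
  qed
  let ?uv = "\<lambda>y. frechet_derivative (\<lambda>y. frechet_derivative f (at y) u) (at y) v"
  let ?vu = "\<lambda>y. frechet_derivative (\<lambda>y. frechet_derivative f (at y) v) (at y) u"
  have c: "continuous_on S ?uv" "continuous_on S ?vu" using f by auto
  show ?thesis
  proof (rule ccontr)
    assume ne: "?vu x \<noteq> ?uv x"
    \<comment> \<open>With \<open>e\<close> half the gap, the values of the two mixed derivatives
      near \<open>x\<close> lie in disjoint intervals. Below, \<open>t\<close> is small enough to
      keep the parallelogram in the ball of radius \<open>d\<close>.\<close>
    define e where "e = \<bar>?vu x - ?uv x\<bar> / 2"
    have e: "e > 0" using ne by (simp add: e_def)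
    obtain d0 where d0: "d0 > 0" "ball x d0 \<subseteq> S" using S open_contains_ball by blast
    obtain d1 where d1: "d1 > 0" "\<And>y. y \<in> S \<Longrightarrow> dist y x < d1 \<Longrightarrow> dist (?uv y) (?uv x) < e"
      using c(1) S(2) e unfolding continuous_on_iff by meson
    obtain d2 where d2: "d2 > 0" "\<And>y. y \<in> S \<Longrightarrow> dist y x < d2 \<Longrightarrow> dist (?vu y) (?vu x) < e"
      using c(2) S(2) e unfolding continuous_on_iff by meson
    define d where "d = min d0 (min d1 d2)"
    have d: "d > 0" using d0 d1 d2 by (simp add: d_def)
    define t where "t = d / (2 * (norm u + norm v + 1))"
    have t: "t > 0" using d by (simp add: t_def add_nonneg_pos)
    have nn: "norm u + norm v + 1 > 0" by (simp add: add_nonneg_pos)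
    have td: "t * (norm u + norm v) < d"
    proof -
      have "t * (norm u + norm v) \<le> t * (norm u + norm v + 1)" using t by (simp)
      also have "\<dots> = d / 2" using nn by (simp add: t_def field_simps)
      also have "\<dots> < d" using d by simp
      finally show ?thesis .
    qed
    have B: "dist (x + p *\<^sub>R a + q *\<^sub>R b) x < d" "x + p *\<^sub>R a + q *\<^sub>R b \<in> S"
      if "0 \<le> p" "p \<le> t" "0 \<le> q" "q \<le> t" "(a, b) = (u, v) \<or> (a, b) = (v, u)" for p q a b
    proof -
      have "norm (p *\<^sub>R a + q *\<^sub>R b) \<le> p * norm a + q * norm b"
        using that norm_triangle_ineq[of "p *\<^sub>R a" "q *\<^sub>R b"] by simp
      also have "\<dots> \<le> t * norm a + t * norm b" using that by (intro add_mono mult_right_mono) auto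
      also have "\<dots> = t * (norm u + norm v)" using that(5) by (auto simp: algebra_simps)
      finally show "dist (x + p *\<^sub>R a + q *\<^sub>R b) x < d" using td by (simp add: dist_norm add.assoc)
      then show "x + p *\<^sub>R a + q *\<^sub>R b \<in> S" using d0 by (auto simp: d_def dist_commute)
    qed
    obtain p q where pq: "0 < p" "p < t" "0 < q" "q < t" and
      1: "f (x + t *\<^sub>R u + t *\<^sub>R v) - f (x + t *\<^sub>R u) - (f (x + t *\<^sub>R v) - f x) = t * t * ?uv (x + p *\<^sub>R u + q *\<^sub>R v)"
      using mvt[of t u v, OF t B(2)] by auto
    obtain p' q' where pq': "0 < p'" "p' < t" "0 < q'" "q' < t" and
      2: "f (x + t *\<^sub>R v + t *\<^sub>R u) - f (x + t *\<^sub>R v) - (f (x + t *\<^sub>R u) - f x) = t * t * ?vu (x + p' *\<^sub>R v + q' *\<^sub>R u)"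
      using mvt[of t v u, OF t B(2)] by auto
    have "f (x + t *\<^sub>R v + t *\<^sub>R u) = f (x + t *\<^sub>R u + t *\<^sub>R v)" by (simp add: algebra_simps)
    with 1 2 have "t * t * ?uv (x + p *\<^sub>R u + q *\<^sub>R v) = t * t * ?vu (x + p' *\<^sub>R v + q' *\<^sub>R u)" by linarith
    then have eq: "?uv (x + p *\<^sub>R u + q *\<^sub>R v) = ?vu (x + p' *\<^sub>R v + q' *\<^sub>R u)" using t by simp
    have "dist (?uv (x + p *\<^sub>R u + q *\<^sub>R v)) (?uv x) < e"
      using B[of p q u v] pq by (intro d1(2)) (auto simp: d_def)
    moreover have "dist (?vu (x + p' *\<^sub>R v + q' *\<^sub>R u)) (?vu x) < e"
      using B[of p' q' v u] pq' by (intro d2(2)) (auto simp: d_def)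
    moreover have False if "\<bar>c - a\<bar> < \<bar>b - a\<bar> / 2" "\<bar>c - b\<bar> < \<bar>b - a\<bar> / 2" for a b c :: real
      using that by (smt (verit) field_sum_of_halves)
    ultimately show False using eq unfolding e_def dist_real_def by metis
  qed
qed

lemma symmetric_second_derivative:
  fixes f :: "'a::euclidean_space \<Rightarrow> 'b::euclidean_space"
  assumes S: "open S" "x \<in> S" and f: "Ck_on (Suc (Suc 0)) S f"
  shows "frechet_derivative (\<lambda>y. frechet_derivative f (at y) v) (at x) u
       = frechet_derivative (\<lambda>y. frechet_derivative f (at y) u) (at x) v"
proof (rule euclidean_eqI)
  fix b :: 'b
  have inner: "frechet_derivative (\<lambda>y. g y \<bullet> b) (at z) w = frechet_derivative g (at z) w \<bullet> b"
    if "Ck_on (Suc 0) S g" "z \<in> S" for g z w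
    using frechet_derivative_at[OF bounded_linear.has_derivative[OF bounded_linear_inner_left Ck_on_SucE[OF that]]]
    by (simp add: fun_eq_iff)
  have f1: "Ck_on (Suc 0) S f" using f Ck_on_SucD by blast
  have i2: "frechet_derivative (\<lambda>y. frechet_derivative f (at y) v) (at x) u \<bullet> b =
      frechet_derivative (\<lambda>y. frechet_derivative (\<lambda>y. f y \<bullet> b) (at y) v) (at x) u" for u v
  proof -
    have fv: "Ck_on (Suc 0) S (\<lambda>y. frechet_derivative f (at y) v)" using f by simp
    have e: "frechet_derivative f (at y) v \<bullet> b = frechet_derivative (\<lambda>y. f y \<bullet> b) (at y) v" if "y \<in> S" for y
      using inner[OF f1 that] by simp
    have "((\<lambda>y. frechet_derivative f (at y) v \<bullet> b) has_derivative
         (\<lambda>u. frechet_derivative (\<lambda>y. frechet_derivative f (at y) v) (at x) u \<bullet> b)) (at x)"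
      by (rule bounded_linear.has_derivative[OF bounded_linear_inner_left Ck_on_SucE[OF fv S(2)]])
    then have "((\<lambda>y. frechet_derivative (\<lambda>y. f y \<bullet> b) (at y) v) has_derivative
         (\<lambda>u. frechet_derivative (\<lambda>y. frechet_derivative f (at y) v) (at x) u \<bullet> b)) (at x)"
      by (rule has_derivative_transform_within_open[OF _ S]) (rule e)
    from frechet_derivative_at[OF this] show ?thesis by (simp add: fun_eq_iff)
  qed
  show "frechet_derivative (\<lambda>y. frechet_derivative f (at y) v) (at x) u \<bullet> b
       = frechet_derivative (\<lambda>y. frechet_derivative f (at y) u) (at x) v \<bullet> b"
    unfolding i2 by (rule symmetric_second_derivative_real[OF S])
      (rule Ck_on_linear[OF S(1) bounded_linear_inner_left f])
qed

section \<open>The Killing form\<close>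

text \<open>The frame may be overcomplete: any expansion with linear coefficients writes the
  identity of \<open>S\<close> as the sum of the tensors of \<open>e k\<close> with
  \<open>phi k\<close>, which suffices for a trace. Thus the basis chosen by \<open>SOME\<close> in
  \<open>trace_on\<close> never has to be known.\<close>

lemma trace_on_frame:
  fixes e :: "'i \<Rightarrow> 'a::real_vector"
  assumes S: "subspace S" and K: "finite K" and e: "\<And>k. k \<in> K \<Longrightarrow> e k \<in> S"
    and phi: "\<And>k. k \<in> K \<Longrightarrow> linear (phi k)"
    and frame: "\<And>y. y \<in> S \<Longrightarrow> y = (\<Sum>k\<in>K. phi k y *\<^sub>R e k)"
    and T: "linear T" "\<And>y. y \<in> S \<Longrightarrow> T y \<in> S"
  shows "trace_on S T = (\<Sum>k\<in>K. phi k (T (e k)))"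
proof -
  define B where "B = (SOME B. independent B \<and> span B = S)"
  have "\<exists>B. independent B \<and> span B = S"
  proof -
    obtain B where B: "B \<subseteq> S" "independent B" "S \<subseteq> span B"
      by (rule real_vector.basis_exists[of S])
    then have "span B = S" using real_vector.span_subspace[OF B(1,3) S] by simp
    with B(2) show ?thesis by auto
  qed
  from someI_ex[OF this] have B: "independent B" "span B = S" unfolding B_def by auto
  then have BS: "b \<in> S" if "b \<in> B" for b using real_vector.span_base[OF that] by simp
  have "S \<subseteq> span (e ` K)"
  proof
    fix y assume "y \<in> S"
    show "y \<in> span (e ` K)"
      by (subst frame[OF \<open>y \<in> S\<close>])
        (rule real_vector.span_sum, rule real_vector.span_scale, rule real_vector.span_base, rule imageI)
  qed
  then have fin: "finite B"
    using real_vector.independent_span_bound[of "e ` K" B] K B(1) BS by blast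
  have "trace_on S T = (\<Sum>b\<in>B. representation B (T b) b)"
    unfolding trace_on_def B_def Let_def by simp
  also have "\<dots> = (\<Sum>b\<in>B. \<Sum>k\<in>K. phi k b * representation B (T (e k)) b)"
  proof (rule sum.cong[OF refl])
    fix b assume b: "b \<in> B"
    have "T b = T (\<Sum>k\<in>K. phi k b *\<^sub>R e k)" using frame[OF BS[OF b]] by simp
    also have "\<dots> = (\<Sum>k\<in>K. phi k b *\<^sub>R T (e k))"
      by (simp add: linear_sum[OF T(1)] linear_cmul[OF T(1)])
    finally have "representation B (T b) b = representation B (\<Sum>k\<in>K. phi k b *\<^sub>R T (e k)) b" by simp
    also have "\<dots> = (\<Sum>k\<in>K. representation B (phi k b *\<^sub>R T (e k)) b)"
      using T(2) e B(2) by (subst real_vector.representation_sum[OF B(1)]) (auto simp: real_vector.span_scale)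
    also have "\<dots> = (\<Sum>k\<in>K. phi k b * representation B (T (e k)) b)"
      using T(2) e B(2) by (intro sum.cong) (auto simp: real_vector.representation_scale[OF B(1)])
    finally show "representation B (T b) b = (\<Sum>k\<in>K. phi k b * representation B (T (e k)) b)" .
  qed
  also have "\<dots> = (\<Sum>k\<in>K. \<Sum>b\<in>B. phi k b * representation B (T (e k)) b)" by (rule sum.swap)
  also have "\<dots> = (\<Sum>k\<in>K. phi k (T (e k)))"
  proof (rule sum.cong[OF refl])
    fix k assume k: "k \<in> K"
    have "T (e k) \<in> span B" using T(2) e k B(2) by simp
    from real_vector.sum_representation_eq[OF B(1) this fin]
    have "phi k (\<Sum>b\<in>B. representation B (T (e k)) b *\<^sub>R b) = phi k (T (e k))" by simp
    then show "(\<Sum>b\<in>B. phi k b * representation B (T (e k)) b) = phi k (T (e k))"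
      by (simp add: linear_sum[OF phi[OF k]] linear_cmul[OF phi[OF k]] mult.commute)
  qed
  finally show ?thesis .
qed

section \<open>A frame of the orthogonal Lie algebra and the trace of
  \<open>ad X \<circ> ad Z\<close>\<close>

definition blinfun_trace :: "('a::euclidean_space \<Rightarrow>\<^sub>L 'a) \<Rightarrow> real" where
  "blinfun_trace X = (\<Sum>j\<in>Basis. blinfun_apply X j \<bullet> j)"

lemma blinfun_trace_compose_commute:
  fixes X Z :: "'a::euclidean_space \<Rightarrow>\<^sub>L 'a"
  shows "blinfun_trace (X o\<^sub>L Z) = blinfun_trace (Z o\<^sub>L X)"
proof -
  have *: "blinfun_trace (X o\<^sub>L Z) = (\<Sum>j\<in>Basis. \<Sum>i\<in>Basis. (Z j \<bullet> i) * (X i \<bullet> j))" for X Z :: "'a \<Rightarrow>\<^sub>L 'a"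
  proof -
    have "X (Z j) \<bullet> j = (\<Sum>i\<in>Basis. (Z j \<bullet> i) * (X i \<bullet> j))" for j
      by (subst euclidean_representation[of "Z j", symmetric])
        (simp add: blinfun.sum_right blinfun.scaleR_right inner_sum_left del: euclidean_representation)
    then show ?thesis by (simp add: blinfun_trace_def)
  qed
  show ?thesis unfolding * by (subst sum.swap) (simp add: mult.commute)
qed

lemma sum_Basis_swap:
  fixes g :: "'a::euclidean_space \<times> 'a \<Rightarrow> 'b::comm_monoid_add"
  shows "(\<Sum>j\<in>Basis. g (prod.swap j)) = (\<Sum>j\<in>Basis. g j)"
proof (rule sum.reindex_bij_witness[of _ prod.swap prod.swap])
qed (auto simp: Basis_prod_def)

lemma inner_swap_swap: "prod.swap u \<bullet> prod.swap v = u \<bullet> v"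
  by (simp add: inner_prod_def)

lemma inner_swap_left: "prod.swap u \<bullet> v = u \<bullet> prod.swap v"
  by (simp add: inner_prod_def)

lemma linear_swap: "linear (prod.swap :: 'a::real_vector \<times> 'a \<Rightarrow> _)"
  by (auto simp: linear_iff)

text \<open>Up to the factor 1/2 the swap J is the Gram operator of \<open>bform\<close>; membership
  of X in \<open>so_b\<close> then reads X^T J = - J X.\<close>

lemma bform_swap: "bform u v = (u \<bullet> prod.swap v) / 2"
  by (simp add: bform_def inner_prod_def inner_commute)

lemma so_b_iff: "X \<in> so_b \<longleftrightarrow> (\<forall>u v. X u \<bullet> prod.swap v = - (u \<bullet> prod.swap (X v)))"
  unfolding so_b_def bform_swap by (auto simp: field_simps eq_neg_iff_add_eq_0)

lemma so_b_skew: "X \<in> so_b \<Longrightarrow> X u \<bullet> prod.swap v = - (u \<bullet> prod.swap (X v))"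
  unfolding so_b_iff by blast

text \<open>Conjugation by the swap preserves the trace and turns X into minus its
  transpose.\<close>

lemma blinfun_trace_so_b:
  fixes X :: "'k::finite endo"
  assumes "X \<in> so_b"
  shows "blinfun_trace X = 0"
proof -
  have e: "X j \<bullet> j = - (X (prod.swap j) \<bullet> prod.swap j)" for j
  proof -
    have "X (prod.swap j) \<bullet> prod.swap j = - (prod.swap j \<bullet> prod.swap (X j))" by (rule so_b_skew[OF assms])
    also have "prod.swap j \<bullet> prod.swap (X j) = X j \<bullet> j" by (simp only: inner_swap_swap inner_commute)
    finally show ?thesis by simp
  qed
  have "blinfun_trace X = - (\<Sum>j\<in>Basis. X (prod.swap j) \<bullet> prod.swap j)"
    unfolding blinfun_trace_def sum_negf[symmetric] by (rule sum.cong[OF refl e])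
  also have "\<dots> = - blinfun_trace X"
    unfolding blinfun_trace_def by (simp only: sum_Basis_swap[of "\<lambda>j. X j \<bullet> j"])
  finally show ?thesis by simp
qed

lemma subspace_so_b: "subspace so_b"
  by (auto simp: subspace_def so_b_iff blinfun.bilinear_simps inner_left_distrib linear_add[OF linear_swap]
      inner_right_distrib linear_cmul[OF linear_swap] linear_0[OF linear_swap])

lemma ad_so_b:
  fixes X Z :: "'k::finite endo"
  assumes "X \<in> so_b" "Z \<in> so_b"
  shows "ad X Z \<in> so_b"
proof -
  have 1: "X (Z u) \<bullet> prod.swap v = u \<bullet> prod.swap (Z (X v))" for u v
    by (simp only: so_b_skew[OF assms(1), of "Z u"] so_b_skew[OF assms(2), of u] minus_minus)
  have 2: "Z (X u) \<bullet> prod.swap v = u \<bullet> prod.swap (X (Z v))" for u v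
    by (simp only: so_b_skew[OF assms(2), of "X u"] so_b_skew[OF assms(1), of u] minus_minus)
  show ?thesis
    unfolding so_b_iff ad_def
    by (simp add: blinfun.diff_left inner_diff_left inner_diff_right linear_diff[OF linear_swap] 1 2)
qed

lemma linear_ad: "linear (ad X)"
  by (rule linearI; rule blinfun_eqI; simp add: ad_def blinfun.bilinear_simps scaleR_diff_right)

definition rank_one :: "'a::euclidean_space \<Rightarrow> 'a \<Rightarrow> 'a \<Rightarrow>\<^sub>L 'a" where
  "rank_one i j = Blinfun (\<lambda>v. (v \<bullet> j) *\<^sub>R i)"

lemma rank_one_apply [simp]: "blinfun_apply (rank_one i j) v = (v \<bullet> j) *\<^sub>R i"
  unfolding rank_one_def by (subst bounded_linear_Blinfun_apply) (auto intro!: bounded_linear_intros)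

text \<open>The image of a matrix unit E under the projection E to (E - J E^T J) / 2 onto
  \<open>so_b\<close>, where J is the swap. These elements span but are not independent.\<close>

definition so_b_frame :: "(real^'k::finite) \<times> (real^'k) \<Rightarrow> (real^'k) \<times> (real^'k) \<Rightarrow> 'k endo" where
  "so_b_frame i j = (1/2) *\<^sub>R (rank_one i j - rank_one (prod.swap j) (prod.swap i))"

lemma so_b_frame_in: "so_b_frame i j \<in> so_b"
  unfolding so_b_iff so_b_frame_def
  by (simp add: blinfun.bilinear_simps inner_diff_left inner_diff_right linear_diff[OF linear_swap]
      linear_cmul[OF linear_swap] inner_swap_swap inner_swap_left algebra_simps inner_commute)

lemma so_b_frame_expansion:
  assumes Y: "Y \<in> so_b"
  shows "Y = (\<Sum>(i,j)\<in>Basis \<times> Basis. (Y j \<bullet> i) *\<^sub>R so_b_frame i j)"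
proof (rule blinfun_eqI)
  fix v
  have 1: "(\<Sum>j\<in>Basis. \<Sum>i\<in>Basis. (Y j \<bullet> i) *\<^sub>R ((v \<bullet> j) *\<^sub>R i)) = Y v"
  proof -
    have "(\<Sum>i\<in>Basis. (Y j \<bullet> i) *\<^sub>R ((v \<bullet> j) *\<^sub>R i)) = (v \<bullet> j) *\<^sub>R Y j" for j
    proof -
      have "(\<Sum>i\<in>Basis. (Y j \<bullet> i) *\<^sub>R ((v \<bullet> j) *\<^sub>R i)) = (v \<bullet> j) *\<^sub>R (\<Sum>i\<in>Basis. (Y j \<bullet> i) *\<^sub>R i)"
        by (simp add: scaleR_sum_right mult.commute del: euclidean_representation)
      then show ?thesis by (simp add: euclidean_representation)
    qed
    then have "(\<Sum>j\<in>Basis. \<Sum>i\<in>Basis. (Y j \<bullet> i) *\<^sub>R ((v \<bullet> j) *\<^sub>R i)) = Y (\<Sum>j\<in>Basis. (v \<bullet> j) *\<^sub>R j)"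
      by (simp add: blinfun.sum_right blinfun.scaleR_right del: euclidean_representation)
    then show ?thesis by (simp add: euclidean_representation)
  qed
  \<comment> \<open>This double sum is J Y^T J applied to \<open>v\<close>, hence minus
    \<open>Y v\<close>: the projection defining the frame fixes \<open>Y\<close>.\<close>
  have 2: "(\<Sum>j\<in>Basis. \<Sum>i\<in>Basis. (Y j \<bullet> i) *\<^sub>R ((v \<bullet> prod.swap i) *\<^sub>R prod.swap j)) = - Y v"
  proof -
    have "(\<Sum>i\<in>Basis. (Y j \<bullet> i) *\<^sub>R ((v \<bullet> prod.swap i) *\<^sub>R prod.swap j)) = (Y j \<bullet> prod.swap v) *\<^sub>R prod.swap j" for j
    proof -
      have "(\<Sum>i\<in>Basis. (Y j \<bullet> i) *\<^sub>R ((v \<bullet> prod.swap i) *\<^sub>R prod.swap j))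
          = (\<Sum>i\<in>Basis. (Y j \<bullet> i) * (prod.swap v \<bullet> i)) *\<^sub>R prod.swap j"
        by (simp add: scaleR_sum_left inner_swap_left)
      then show ?thesis by (simp add: euclidean_inner[symmetric])
    qed
    also have "(Y j \<bullet> prod.swap v) *\<^sub>R prod.swap j = - ((Y v \<bullet> prod.swap j) *\<^sub>R prod.swap j)" for j
    proof -
      have "Y j \<bullet> prod.swap v = - (Y v \<bullet> prod.swap j)"
        using so_b_skew[OF Y, of j v] by (simp only: inner_swap_left[symmetric] inner_commute)
      then show ?thesis by simp
    qed
    finally have "(\<Sum>j\<in>Basis. \<Sum>i\<in>Basis. (Y j \<bullet> i) *\<^sub>R ((v \<bullet> prod.swap i) *\<^sub>R prod.swap j))
        = - (\<Sum>j\<in>Basis. (Y v \<bullet> prod.swap j) *\<^sub>R prod.swap j)"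
      by (simp add: sum_negf)
    also have "\<dots> = - (\<Sum>j\<in>Basis. (Y v \<bullet> j) *\<^sub>R j)"
      by (simp only: sum_Basis_swap[of "\<lambda>j. (Y v \<bullet> j) *\<^sub>R j"])
    finally show ?thesis by (simp add: euclidean_representation)
  qed
  have "blinfun_apply (\<Sum>(i,j)\<in>Basis \<times> Basis. (Y j \<bullet> i) *\<^sub>R so_b_frame i j) v
      = (\<Sum>i\<in>Basis. \<Sum>j\<in>Basis. blinfun_apply ((Y j \<bullet> i) *\<^sub>R so_b_frame i j) v)"
    by (simp add: blinfun.sum_left sum.cartesian_product case_prod_beta)
  also have "\<dots> = (\<Sum>j\<in>Basis. \<Sum>i\<in>Basis. blinfun_apply ((Y j \<bullet> i) *\<^sub>R so_b_frame i j) v)"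
    by (rule sum.swap)
  also have "\<dots> = (1/2) *\<^sub>R ((\<Sum>j\<in>Basis. \<Sum>i\<in>Basis. (Y j \<bullet> i) *\<^sub>R ((v \<bullet> j) *\<^sub>R i))
      - (\<Sum>j\<in>Basis. \<Sum>i\<in>Basis. (Y j \<bullet> i) *\<^sub>R ((v \<bullet> prod.swap i) *\<^sub>R prod.swap j)))"
    by (simp add: so_b_frame_def blinfun.bilinear_simps scaleR_sum_right sum_subtractf[symmetric]
        scaleR_diff_right mult.commute mult.left_commute)
  also have "\<dots> = Y v" unfolding 1 2 by (simp add: scaleR_2[symmetric])
  finally show "Y v = blinfun_apply (\<Sum>(i,j)\<in>Basis \<times> Basis. (Y j \<bullet> i) *\<^sub>R so_b_frame i j) v" by simp
qed

text \<open>In the coordinates \<open>Y j \<bullet> i\<close> this is the trace of the map Y to A Y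
  B on all endomorphisms. The next lemma does the same for Y to A J Y^T J B, with J the
  swap.\<close>

lemma sum_rank_one_conj:
  fixes A B :: "'a::euclidean_space \<Rightarrow>\<^sub>L 'a"
  shows "(\<Sum>i\<in>Basis. \<Sum>j\<in>Basis. A (rank_one i j (B j)) \<bullet> i) = blinfun_trace A * blinfun_trace B"
  by (simp add: blinfun_trace_def blinfun.bilinear_simps sum_product mult.commute)

lemma sum_rank_one_conj_swap:
  fixes A B :: "('a::euclidean_space \<times> 'a) \<Rightarrow>\<^sub>L ('a \<times> 'a)"
  shows "(\<Sum>i\<in>Basis. \<Sum>j\<in>Basis. A (rank_one (prod.swap j) (prod.swap i) (B j)) \<bullet> i)
      = (\<Sum>j\<in>Basis. prod.swap (B j) \<bullet> A (prod.swap j))"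
proof -
  have "(\<Sum>i\<in>Basis. \<Sum>j\<in>Basis. A (rank_one (prod.swap j) (prod.swap i) (B j)) \<bullet> i)
      = (\<Sum>j\<in>Basis. \<Sum>i\<in>Basis. (prod.swap (B j) \<bullet> i) * (A (prod.swap j) \<bullet> i))"
    by (subst sum.swap) (simp add: blinfun.bilinear_simps inner_swap_left)
  then show ?thesis by (simp add: euclidean_inner[symmetric])
qed

lemma blinfun_trace_id: "blinfun_trace (id_blinfun :: 'a::euclidean_space \<Rightarrow>\<^sub>L 'a) = DIM('a)"
  by (simp add: blinfun_trace_def)

text \<open>The classical factor d - 2 of the orthogonal Lie algebra of a nondegenerate form in
  dimension d, here with d = 2 CARD('k).\<close>

lemma killing_form_eq:
  fixes X Z :: "'k::finite endo"
  assumes X: "X \<in> so_b" and Z: "Z \<in> so_b"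
  shows "killing_form X Z = (2 * real CARD('k) - 2) * blinfun_trace (X o\<^sub>L Z)"
proof -
  let ?B = "Basis :: ((real^'k) \<times> (real^'k)) set"
  let ?J = "prod.swap :: (real^'k) \<times> (real^'k) \<Rightarrow> _"
  let ?T = "ad X \<circ> ad Z"
  let ?t = "blinfun_trace (X o\<^sub>L Z)"
  have lin: "linear (\<lambda>Y :: 'k endo. Y j \<bullet> i)" for i j
    by (simp add: linear_iff blinfun.bilinear_simps inner_left_distrib)
  have "trace_on so_b ?T = (\<Sum>k\<in>?B \<times> ?B. (\<lambda>(i,j) Y. blinfun_apply Y j \<bullet> i) k (?T ((\<lambda>(i,j). so_b_frame i j) k)))"
  proof (rule trace_on_frame[OF subspace_so_b])
    show "finite (?B \<times> ?B)" by simp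
    show "linear ?T" by (intro linear_compose linear_ad)
    show "?T y \<in> so_b" if "y \<in> so_b" for y using that by (simp add: ad_so_b X Z)
    fix y :: "'k endo" assume "y \<in> so_b"
    then show "y = (\<Sum>k\<in>?B \<times> ?B. (\<lambda>(i,j) Y. blinfun_apply Y j \<bullet> i) k y *\<^sub>R (\<lambda>(i,j). so_b_frame i j) k)"
      using so_b_frame_expansion[of y] by (simp add: case_prod_beta)
  qed (auto simp: so_b_frame_in lin)
  also have "\<dots> = (\<Sum>i\<in>?B. \<Sum>j\<in>?B. ?T (so_b_frame i j) j \<bullet> i)"
    by (simp add: sum.cartesian_product case_prod_beta)
  also have "\<dots> = (1/2) * (
      (\<Sum>i\<in>?B. \<Sum>j\<in>?B. (X o\<^sub>L Z) (rank_one i j (id_blinfun j)) \<bullet> i)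
    - (\<Sum>i\<in>?B. \<Sum>j\<in>?B. X (rank_one i j (Z j)) \<bullet> i)
    - (\<Sum>i\<in>?B. \<Sum>j\<in>?B. Z (rank_one i j (X j)) \<bullet> i)
    + (\<Sum>i\<in>?B. \<Sum>j\<in>?B. id_blinfun (rank_one i j ((Z o\<^sub>L X) j)) \<bullet> i)
    - ((\<Sum>i\<in>?B. \<Sum>j\<in>?B. (X o\<^sub>L Z) (rank_one (?J j) (?J i) (id_blinfun j)) \<bullet> i)
    - (\<Sum>i\<in>?B. \<Sum>j\<in>?B. X (rank_one (?J j) (?J i) (Z j)) \<bullet> i)
    - (\<Sum>i\<in>?B. \<Sum>j\<in>?B. Z (rank_one (?J j) (?J i) (X j)) \<bullet> i)
    + (\<Sum>i\<in>?B. \<Sum>j\<in>?B. id_blinfun (rank_one (?J j) (?J i) ((Z o\<^sub>L X) j)) \<bullet> i)))"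
  proof -
    have "?T (so_b_frame i j) j \<bullet> i = (1/2) * (
      (X o\<^sub>L Z) (rank_one i j (id_blinfun j)) \<bullet> i - X (rank_one i j (Z j)) \<bullet> i
      - Z (rank_one i j (X j)) \<bullet> i + id_blinfun (rank_one i j ((Z o\<^sub>L X) j)) \<bullet> i
    - ((X o\<^sub>L Z) (rank_one (?J j) (?J i) (id_blinfun j)) \<bullet> i - X (rank_one (?J j) (?J i) (Z j)) \<bullet> i
      - Z (rank_one (?J j) (?J i) (X j)) \<bullet> i + id_blinfun (rank_one (?J j) (?J i) ((Z o\<^sub>L X) j)) \<bullet> i))" for i j
      by (simp add: ad_def so_b_frame_def blinfun.bilinear_simps inner_diff_left inner_left_distrib
          diff_divide_distrib add_divide_distrib del: rank_one_apply)
    then show ?thesis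
      by (simp only: sum_distrib_left[symmetric] sum.distrib sum_subtractf)
  qed
  \<comment> \<open>The untwisted terms with both factors on one side give d times \<open>?t\<close>
    each, and the mixed ones vanish because \<open>X\<close> and \<open>Z\<close> are traceless. The
    four twisted sums are \<open>?t\<close>, \<open>- ?t\<close>, \<open>- ?t\<close>,
    \<open>?t\<close>, and their signs add up to - 4 \<open>?t\<close>.\<close>
  also have "\<dots> = (1/2) * (?t * (2 * real CARD('k)) + (2 * real CARD('k)) * ?t - 4 * ?t)"
  proof -
    have J: "?J p \<bullet> Y (?J q) = - (Y p \<bullet> q)" if "Y \<in> so_b" for Y :: "'k endo" and p q
      using so_b_skew[OF that, of p "?J q"] by (simp add: inner_swap_left)
    have "(\<Sum>j\<in>?B. ?J j \<bullet> X (Z (?J j))) = ?t"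
      using sum_Basis_swap[of "\<lambda>j. j \<bullet> X (Z j)"] by (simp add: blinfun_trace_def inner_commute)
    moreover have "(\<Sum>j\<in>?B. ?J (Z j) \<bullet> X (?J j)) = - ?t"
      by (simp add: J[OF X] sum_negf blinfun_trace_def)
    moreover have "(\<Sum>j\<in>?B. ?J (X j) \<bullet> Z (?J j)) = - ?t"
      by (simp add: J[OF Z] sum_negf blinfun_trace_compose_commute[of X Z]) (simp add: blinfun_trace_def)
    moreover have "(\<Sum>j\<in>?B. ?J (Z (X j)) \<bullet> ?J j) = ?t"
      by (simp add: inner_swap_swap blinfun_trace_compose_commute[of X Z]) (simp add: blinfun_trace_def)
    ultimately show ?thesis
      unfolding sum_rank_one_conj sum_rank_one_conj_swap
      by (simp add: blinfun_trace_so_b X Z blinfun_trace_id blinfun_trace_compose_commute[of Z X])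
  qed
  finally show ?thesis unfolding killing_form_def by (simp add: algebra_simps)
qed

section \<open>Block form of the Lie algebra\<close>

lemmas matrix_mult_simps =
  bounded_bilinear.add_left[OF bounded_bilinear_matrix_mult]
  bounded_bilinear.add_right[OF bounded_bilinear_matrix_mult]
  bounded_bilinear.diff_left[OF bounded_bilinear_matrix_mult]
  bounded_bilinear.diff_right[OF bounded_bilinear_matrix_mult]
  bounded_bilinear.minus_left[OF bounded_bilinear_matrix_mult]
  bounded_bilinear.minus_right[OF bounded_bilinear_matrix_mult]
  bounded_bilinear.scaleR_left[OF bounded_bilinear_matrix_mult]
  bounded_bilinear.scaleR_right[OF bounded_bilinear_matrix_mult]
  bounded_bilinear.zero_left[OF bounded_bilinear_matrix_mult]
  bounded_bilinear.zero_right[OF bounded_bilinear_matrix_mult]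

lemmas matrix_vector_simps =
  bounded_bilinear.add_left[OF bounded_bilinear_matrix_vector_mult]
  bounded_bilinear.add_right[OF bounded_bilinear_matrix_vector_mult]
  bounded_bilinear.diff_left[OF bounded_bilinear_matrix_vector_mult]
  bounded_bilinear.diff_right[OF bounded_bilinear_matrix_vector_mult]
  bounded_bilinear.minus_left[OF bounded_bilinear_matrix_vector_mult]
  bounded_bilinear.minus_right[OF bounded_bilinear_matrix_vector_mult]
  bounded_bilinear.scaleR_left[OF bounded_bilinear_matrix_vector_mult]
  bounded_bilinear.scaleR_right[OF bounded_bilinear_matrix_vector_mult]
  bounded_bilinear.zero_left[OF bounded_bilinear_matrix_vector_mult]
  bounded_bilinear.zero_right[OF bounded_bilinear_matrix_vector_mult]

lemma transpose_simps:
  fixes A B :: "real^'n::finite^'m::finite"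
  shows "transpose (A + B) = transpose A + transpose B" "transpose (A - B) = transpose A - transpose B"
    "transpose (- A) = - transpose A" "transpose (r *\<^sub>R A) = r *\<^sub>R transpose A"
  by (simp_all add: transpose_def vec_eq_iff)

lemma inner_matrix_left: "(A *v x) \<bullet> y = x \<bullet> (transpose A *v y)" for A :: "real^'n::finite^'m::finite"
  by (metis dot_lmul_matrix transpose_matrix_vector transpose_transpose)

lemma trace_mult_transpose: "trace (A ** transpose B) = A \<bullet> B" for A B :: "real^'n::finite^'m::finite"
  by (simp add: trace_def matrix_matrix_mult_def transpose_def inner_vec_def)

lemma trace_transpose: "trace (transpose A) = trace A"
  by (simp add: trace_def transpose_def)

lemma trace_scaleR: "trace (r *\<^sub>R A) = r * trace A" for A :: "real^'n::finite^'n"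
  by (simp add: trace_def sum_distrib_left)

lemma trace_minus: "trace (- A) = - trace A" for A :: "real^'n::finite^'n"
  by (simp add: trace_def sum_negf)

text \<open>In the coordinates \<open>(x, y - K x)\<close>, the blocks of the following endomorphism are
  \<open>a\<close>, \<open>b\<close>, \<open>g\<close>, \<open>d\<close>.  For skew \<open>K\<close> these coordinates are isometric for \<open>bform\<close>, and they turn
  the graph of \<open>K + S\<close> into the graph of \<open>S\<close>.\<close>

definition block_endo ::
  "real^'k::finite^'k \<Rightarrow> real^'k^'k \<Rightarrow> real^'k^'k \<Rightarrow> real^'k^'k \<Rightarrow> real^'k^'k \<Rightarrow> 'k endo" where
  "block_endo K a b g d = Blinfun (\<lambda>u.
     let x = fst u; y = snd u - K *v x; z = a *v x + b *v y in (z, K *v z + g *v x + d *v y))"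

lemma block_endo_apply:
  "blinfun_apply (block_endo K a b g d) (x, y + K *v x)
     = (a *v x + b *v y, K *v (a *v x + b *v y) + g *v x + d *v y)"
  unfolding block_endo_def
  by (subst bounded_linear_Blinfun_apply, rule linear_conv_bounded_linear[THEN iffD1])
     (auto simp: linear_iff Let_def matrix_vector_simps scaleR_add_right scaleR_diff_right)

lemma shear_exhaust:
  fixes K :: "real^'k::finite^'k"
  obtains x y where "u = (x, y + K *v x)"
  using that[of "fst u" "snd u - K *v fst u"] by simp

lemma block_endo_compose:
  "block_endo K a b g d o\<^sub>L block_endo K a' b' g' d'
   = block_endo K (a ** a' + b ** g') (a ** b' + b ** d') (g ** a' + d ** g') (g ** b' + d ** d')"
proof (rule blinfun_eqI)
  fix u
  obtain x y where u: "u = (x, y + K *v x)" by (rule shear_exhaust)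
  have 1: "K *v (a' *v x + b' *v y) + g' *v x + d' *v y = (g' *v x + d' *v y) + K *v (a' *v x + b' *v y)"
    by (simp add: add_ac)
  show "blinfun_apply (block_endo K a b g d o\<^sub>L block_endo K a' b' g' d') u
   = blinfun_apply (block_endo K (a ** a' + b ** g') (a ** b' + b ** d') (g ** a' + d ** g') (g ** b' + d ** d')) u"
    unfolding u blinfun_apply_blinfun_compose block_endo_apply
    unfolding 1 block_endo_apply
    by (simp add: matrix_vector_simps matrix_vector_mul_assoc[symmetric] add_ac)
qed

text \<open>The shear is a change of coordinates, so \<open>K\<close> leaves no trace: its
  contributions cancel as traces of \<open>b ** K\<close> and \<open>K ** b\<close>.\<close>

lemma blinfun_trace_block_endo:
  fixes K :: "real^'k::finite^'k"
  shows "blinfun_trace (block_endo K a b g d) = trace a + trace d"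
proof -
  have e1: "(axis i 1, 0) = (axis i 1, - (K *v axis i 1) + K *v axis i 1)" for i by simp
  have e2: "(0, axis i 1) = (0, axis i 1 + K *v 0)" for i by simp
  have entry: "(M *v (N *v axis i 1)) $ j = (M ** N) $ j $ i" "(M *v axis i 1) $ j = M $ j $ i"
    for M N :: "real^'k^'k" and i j
    unfolding matrix_vector_mul_assoc by (simp_all only: matrix_vector_mult_basis column_def vec_lambda_beta)
  have 1: "blinfun_apply (block_endo K a b g d) (axis i 1, 0) \<bullet> (axis i 1, 0) = a $ i $ i - (b ** K) $ i $ i" for i
    unfolding e1[of i] block_endo_apply
    by (simp add: inner_axis matrix_vector_simps entry)
  have 2: "blinfun_apply (block_endo K a b g d) (0, axis i 1) \<bullet> (0, axis i 1) = (K ** b) $ i $ i + d $ i $ i" for i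
    unfolding e2[of i] block_endo_apply
    by (simp add: inner_axis matrix_vector_simps entry)
  have B: "(\<Sum>j\<in>Basis. g j) = (\<Sum>i\<in>UNIV. g (axis i 1))" for g :: "real^'k \<Rightarrow> real"
  proof -
    have 1: "Basis = range (\<lambda>i. axis i 1 :: real^'k)" by (auto simp: Basis_vec_def)
    have "inj (\<lambda>i. axis i 1 :: real^'k)" by (simp add: inj_on_def axis_eq_axis)
    then show ?thesis unfolding 1 by (subst sum.reindex) auto
  qed
  have P: "(\<Sum>j\<in>Basis. g j) = (\<Sum>i\<in>Basis. g (i, 0)) + (\<Sum>i\<in>Basis. g (0, i))"
    for g :: "(real^'k) \<times> (real^'k) \<Rightarrow> real"
    unfolding Basis_prod_def by (subst sum.union_disjoint) (auto simp: sum.reindex inj_on_def)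
  have "blinfun_trace (block_endo K a b g d) = trace a - trace (b ** K) + (trace (K ** b) + trace d)"
    unfolding blinfun_trace_def P B 1 2 by (simp add: trace_def sum_subtractf sum.distrib)
  then show ?thesis by (simp add: trace_mul_sym[of b K])
qed

lemma skew_inner: "transpose K = - K \<Longrightarrow> (K *v x) \<bullet> y = - (x \<bullet> (K *v y))" for K :: "real^'n::finite^'n"
  unfolding inner_matrix_left[of K] by (simp add: matrix_vector_simps del: transpose_matrix_vector)

lemma skewI:
  fixes b :: "real^'n::finite^'n"
  assumes "\<And>x y. (b *v x) \<bullet> y = - (x \<bullet> (b *v y))"
  shows "transpose b = - b"
proof -
  have "transpose b *v y = - b *v y" for y
  proof (rule vector_eq_ldot[THEN iffD1], rule allI)
    fix x
    have "x \<bullet> (transpose b *v y) = (b *v x) \<bullet> y" by (rule inner_matrix_left[symmetric])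
    also have "\<dots> = x \<bullet> (- b *v y)" unfolding assms by (simp add: matrix_vector_simps)
    finally show "x \<bullet> (transpose b *v y) = x \<bullet> (- b *v y)" .
  qed
  then show ?thesis by (simp add: matrix_eq del: transpose_matrix_vector)
qed

lemma bform_shear:
  fixes K :: "real^'k::finite^'k"
  assumes "transpose K = - K"
  shows "bform (x, y + K *v x) (z, w + K *v z) = (x \<bullet> w + y \<bullet> z) / 2"
  using skew_inner[OF assms, of z x]
  by (simp add: bform_def inner_right_distrib inner_commute)

lemma block_endo_in_so_b:
  fixes K :: "real^'k::finite^'k"
  assumes K: "transpose K = - K" and b: "transpose b = - b" and g: "transpose g = - g"
  shows "block_endo K a b g (- transpose a) \<in> so_b"
  unfolding so_b_def
proof (intro CollectI allI)
  fix u v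
  obtain x y where u: "u = (x, y + K *v x)" by (rule shear_exhaust)
  obtain z w where v: "v = (z, w + K *v z)" by (rule shear_exhaust)
  have e: "block_endo K a b g (- transpose a) (p, q + K *v p)
    = (a *v p + b *v q, (g *v p - transpose a *v q) + K *v (a *v p + b *v q))" for p q
    unfolding block_endo_apply by (simp add: matrix_vector_simps del: transpose_matrix_vector)
  have "(a *v x) \<bullet> w = x \<bullet> (transpose a *v w)" "(transpose a *v y) \<bullet> z = y \<bullet> (a *v z)"
    by (simp_all add: inner_matrix_left del: transpose_matrix_vector)
  then show "bform (block_endo K a b g (- transpose a) u) v + bform u (block_endo K a b g (- transpose a) v) = 0"
    unfolding u v e bform_shear[OF K]
    using skew_inner[OF b, of y w] skew_inner[OF g, of x z]
    by (simp add: inner_left_distrib inner_right_distrib inner_diff_left inner_diff_right field_simps del: transpose_matrix_vector)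
qed

lemma so_b_block_endo:
  fixes K :: "real^'k::finite^'k"
  assumes X: "X \<in> so_b" and K: "transpose K = - K"
  obtains a b g where "X = block_endo K a b g (- transpose a)" "transpose b = - b" "transpose g = - g"
proof -
  define p where "p x y = fst (X (x, y + K *v x))" for x y
  define q where "q x y = snd (X (x, y + K *v x)) - K *v p x y" for x y
  have Xe: "X (x, y + K *v x) = (p x y, q x y + K *v p x y)" for x y
    by (simp add: p_def q_def)
  \<comment> \<open>Setting two of the four vectors to zero isolates the relations between single
    blocks. Later instantiations of this fact list the vectors in their order of occurrence: x, y,
    w, z.\<close>
  have key: "p x y \<bullet> w + q x y \<bullet> z + x \<bullet> q z w + y \<bullet> p z w = 0" for x y z w
  proof -
    have "bform (X (x, y + K *v x)) (z, w + K *v z) + bform (x, y + K *v x) (X (z, w + K *v z)) = 0"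
      using X unfolding so_b_def by blast
    then show ?thesis unfolding Xe bform_shear[OF K] by (simp add: add_divide_distrib[symmetric] add_ac)
  qed
  have e: "X (x + x', (y + y') + K *v (x + x')) = X (x, y + K *v x) + X (x', y' + K *v x')"
       "X (r *\<^sub>R x, (r *\<^sub>R y) + K *v (r *\<^sub>R x)) = r *\<^sub>R X (x, y + K *v x)" for x x' y y' r
  proof -
    have "(x + x', (y + y') + K *v (x + x')) = (x, y + K *v x) + (x', y' + K *v x')"
      by (simp add: matrix_vector_simps)
    then show "X (x + x', (y + y') + K *v (x + x')) = X (x, y + K *v x) + X (x', y' + K *v x')"
      by (metis blinfun.add_right)
    have "(r *\<^sub>R x, (r *\<^sub>R y) + K *v (r *\<^sub>R x)) = r *\<^sub>R (x, y + K *v x)"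
      by (simp add: matrix_vector_simps scaleR_add_right)
    then show "X (r *\<^sub>R x, (r *\<^sub>R y) + K *v (r *\<^sub>R x)) = r *\<^sub>R X (x, y + K *v x)"
      by (metis blinfun.scaleR_right)
  qed
  have padd: "p (x + x') (y + y') = p x y + p x' y'" and pscale: "p (r *\<^sub>R x) (r *\<^sub>R y) = r *\<^sub>R p x y" for x x' y y' r
    unfolding p_def by (simp_all only: e fst_add fst_scaleR)
  have qadd: "q (x + x') (y + y') = q x y + q x' y'" and qscale: "q (r *\<^sub>R x) (r *\<^sub>R y) = r *\<^sub>R q x y" for x x' y y' r
    unfolding q_def padd pscale e snd_add snd_scaleR by (simp_all add: matrix_vector_simps scaleR_diff_right)
  have lin: "linear (\<lambda>x. p x 0)" "linear (p 0)" "linear (\<lambda>x. q x 0)" "linear (q 0)"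
    using padd[of _ _ 0 0] padd[of 0 0] qadd[of _ _ 0 0] qadd[of 0 0]
      pscale[of _ _ 0] pscale[of _ 0] qscale[of _ _ 0] qscale[of _ 0]
    by (auto simp: linear_iff)
  define a where "a = matrix (\<lambda>x. p x 0)"
  define b where "b = matrix (p 0)"
  define g where "g = matrix (\<lambda>x. q x 0)"
  have ap: "a *v x = p x 0" and bp: "b *v x = p 0 x" and gp: "g *v x = q x 0" for x
    by (simp_all add: a_def b_def g_def lin)
  have p: "p x y = a *v x + b *v y" and q0: "q x y = g *v x + q 0 y" for x y
    using padd[of x 0 0 y] qadd[of x 0 0 y] by (simp_all add: ap bp gp)
  have z: "p 0 0 = 0" "q 0 0 = 0" using pscale[of 0 0 0] qscale[of 0 0 0] by auto
  have d: "q 0 y = - transpose a *v y" for y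
  proof (rule vector_eq_ldot[THEN iffD1], rule allI)
    fix z
    have "z \<bullet> (- transpose a *v y) = - ((a *v z) \<bullet> y)"
      unfolding inner_matrix_left[of a] by (simp add: matrix_vector_simps del: transpose_matrix_vector)
    then show "z \<bullet> q 0 y = z \<bullet> (- transpose a *v y)"
      using key[of z 0 y 0] unfolding ap by (simp add: z)
  qed
  have "transpose b = - b"
    by (rule skewI) (use key[of 0 _ _ 0] in \<open>simp add: bp eq_neg_iff_add_eq_0\<close>)
  moreover have "transpose g = - g"
    by (rule skewI) (use key[of _ 0 0 _] in \<open>simp add: gp eq_neg_iff_add_eq_0\<close>)
  moreover have "X = block_endo K a b g (- transpose a)"
  proof (rule blinfun_eqI)
    fix u
    obtain x y where u: "u = (x, y + K *v x)" by (rule shear_exhaust)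
    show "blinfun_apply X u = block_endo K a b g (- transpose a) u"
      unfolding u Xe block_endo_apply q0[of x y] d p by (simp add: add_ac)
  qed
  ultimately show ?thesis by (rule that[rotated])
qed

lemma blinfun_trace_so_b_compose:
  "blinfun_trace (block_endo K a b g (- transpose a) o\<^sub>L block_endo K a' b' g' (- transpose a'))
   = 2 * trace (a ** a') + trace (b ** g') + trace (g ** b')"
proof -
  have "trace (transpose a ** transpose a') = trace (a ** a')"
    by (metis matrix_transpose_mul trace_mul_sym trace_transpose)
  then show ?thesis
    by (simp add: block_endo_compose blinfun_trace_block_endo trace_add matrix_mult_simps)
qed

section \<open>The metric of the symmetric space in the graph chart\<close>

text \<open>The part of the exponential series from degree two on is at most a constant times t^2
  for |t| at most 1, so only the linear term contributes at 0.\<close>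

lemma has_vector_derivative_endo_exp:
  fixes X :: "'k::finite endo"
  shows "((\<lambda>t. endo_exp (t *\<^sub>R X)) has_vector_derivative X) (at 0)"
proof -
  define p where "p j = ((\<lambda>Z. X o\<^sub>L Z) ^^ j) id_blinfun" for j
  have p0: "p 0 = id_blinfun" and pS: "p (Suc j) = X o\<^sub>L p j" for j by (simp_all add: p_def)
  have p1: "p (Suc 0) = X" by (simp add: pS p0 blinfun_eqI)
  have np: "norm (p j) \<le> norm X ^ j" for j
  proof (induction j)
    case 0
    then show ?case by (simp add: p0 norm_blinfun_id_le)
  next
    case (Suc j)
    have "norm (p (Suc j)) \<le> norm X * norm (p j)" unfolding pS by (rule norm_blinfun_compose)
    also have "\<dots> \<le> norm X * norm X ^ j" by (intro mult_left_mono Suc) auto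
    finally show ?case by simp
  qed
  have pt: "((\<lambda>Z. (t *\<^sub>R X) o\<^sub>L Z) ^^ j) id_blinfun = t ^ j *\<^sub>R p j" for t j
  proof (induction j)
    case 0
    then show ?case by (simp add: p0)
  next
    case (Suc j)
    then show ?case by (auto simp: pS intro!: blinfun_eqI simp: blinfun.bilinear_simps)
  qed
  have E: "endo_exp (t *\<^sub>R X) = (\<Sum>j. (t ^ j / fact j) *\<^sub>R p j)" for t
    unfolding endo_exp_def pt by (simp add: divide_inverse mult.commute)
  have se: "summable (\<lambda>j. norm X ^ j / fact j)"
    using summable_exp[of "norm X"] by (simp add: divide_inverse mult.commute)
  have bound: "norm (endo_exp (t *\<^sub>R X) - id_blinfun - t *\<^sub>R X) \<le> t\<^sup>2 * (\<Sum>j. norm X ^ (j + 2) / fact (j + 2))"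
    if t: "\<bar>t\<bar> \<le> 1" for t
  proof -
    have "norm ((t ^ j / fact j) *\<^sub>R p j) \<le> norm X ^ j / fact j" for j
    proof -
      have "norm ((t ^ j / fact j) *\<^sub>R p j) = \<bar>t\<bar> ^ j * norm (p j) / fact j"
        by (simp add: power_abs)
      also have "\<dots> \<le> 1 * norm X ^ j / fact j"
        using t np[of j] by (intro divide_right_mono mult_mono power_le_one) auto
      finally show ?thesis by simp
    qed
    then have s: "summable (\<lambda>j. (t ^ j / fact j) *\<^sub>R p j)"
      by (intro summable_comparison_test'[OF se])
    have "endo_exp (t *\<^sub>R X) = (\<Sum>j. (t ^ (j + 2) / fact (j + 2)) *\<^sub>R p (j + 2)) + (\<Sum>j<2. (t ^ j / fact j) *\<^sub>R p j)"
      unfolding E by (rule suminf_split_initial_segment[OF s])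
    also have "(\<Sum>j<2. (t ^ j / fact j) *\<^sub>R p j) = id_blinfun + t *\<^sub>R X"
      by (simp add: numeral_2_eq_2 p0 p1)
    finally have "endo_exp (t *\<^sub>R X) - id_blinfun - t *\<^sub>R X = (\<Sum>j. (t ^ (j + 2) / fact (j + 2)) *\<^sub>R p (j + 2))"
      by simp
    also have "norm \<dots> \<le> (\<Sum>j. t\<^sup>2 * (norm X ^ (j + 2) / fact (j + 2)))"
    proof (rule norm_suminf_le)
      show "summable (\<lambda>j. t\<^sup>2 * (norm X ^ (j + 2) / fact (j + 2)))"
        by (intro summable_mult summable_ignore_initial_segment se)
      fix j
      have "norm ((t ^ (j + 2) / fact (j + 2)) *\<^sub>R p (j + 2)) = t\<^sup>2 * (\<bar>t\<bar> ^ j * norm (p (j + 2)) / fact (j + 2))"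
        by (simp add: power_add abs_mult power_abs power2_eq_square del: fact_Suc)
      also have "\<dots> \<le> t\<^sup>2 * (1 * norm X ^ (j + 2) / fact (j + 2))"
        using t np[of "j + 2"] by (intro mult_left_mono divide_right_mono mult_mono power_le_one) auto
      finally show "norm ((t ^ (j + 2) / fact (j + 2)) *\<^sub>R p (j + 2)) \<le> t\<^sup>2 * (norm X ^ (j + 2) / fact (j + 2))"
        by simp
    qed
    also have "\<dots> = t\<^sup>2 * (\<Sum>j. norm X ^ (j + 2) / fact (j + 2))"
      by (rule suminf_mult) (intro summable_ignore_initial_segment se)
    finally show ?thesis .
  qed
  define C where "C = (\<Sum>j. norm X ^ (j + 2) / fact (j + 2))"
  have E0: "endo_exp (0 *\<^sub>R X) = id_blinfun"
    using bound[of 0] by simp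
  show ?thesis
    unfolding has_vector_derivative_def
  proof (rule has_derivativeI_sandwich[where e = 1 and H = "\<lambda>t. \<bar>t\<bar> * C"])
    show "bounded_linear (\<lambda>t. t *\<^sub>R X)" by (rule bounded_linear_scaleR_left)
    show "((\<lambda>t. \<bar>t\<bar> * C) \<longlongrightarrow> 0) (at 0)"
      by (rule tendsto_eq_intros | simp)+
    fix t :: real assume t: "t \<noteq> 0" "dist t 0 < 1"
    then have "norm (endo_exp (t *\<^sub>R X) - id_blinfun - t *\<^sub>R X) \<le> t\<^sup>2 * C" unfolding C_def by (intro bound) auto
    then have "norm (endo_exp (t *\<^sub>R X) - id_blinfun - t *\<^sub>R X) / \<bar>t\<bar> \<le> t\<^sup>2 * C / \<bar>t\<bar>"
      by (rule divide_right_mono) simp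
    also have "\<dots> = \<bar>t\<bar> * C" using t(1) by (simp add: power2_eq_square abs_if)
    finally show "norm (endo_exp (t *\<^sub>R X) - endo_exp (0 *\<^sub>R X) - (t - 0) *\<^sub>R X) / norm (t - 0) \<le> \<bar>t\<bar> * C"
      unfolding E0 by simp
  qed simp
qed

lemma endo_exp_0: "endo_exp (0 :: 'k::finite endo) = id_blinfun"
proof -
  have "(1 / fact j) *\<^sub>R ((\<lambda>Z. 0 o\<^sub>L Z) ^^ j) id_blinfun = (if j = 0 then id_blinfun else (0 :: 'k endo))" for j
    by (cases j) (auto intro!: blinfun_eqI)
  then have "endo_exp (0 :: 'k endo) = (\<Sum>j :: nat. if j = 0 then id_blinfun else 0)"
    unfolding endo_exp_def by presburger
  also have "\<dots> = (\<Sum>j\<in>{0 :: nat}. if j = 0 then id_blinfun else 0)"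
    by (rule suminf_finite) auto
  finally show ?thesis by simp
qed

lemma graph_inj: "graph N = graph N' \<Longrightarrow> N = N'"
proof -
  assume "graph N = graph N'"
  then have "(x, N *v x) \<in> graph N'" for x by (auto simp: graph_def)
  then have "N *v x = N' *v x" for x by (auto simp: graph_def)
  then show ?thesis by (simp add: matrix_eq)
qed

lemma snd_graph_chart: "snd graph_chart (graph N) = N"
  unfolding graph_chart_def by (auto intro!: the_equality dest: graph_inj)

text \<open>The action on subspaces is by fractional linear maps in the chart: the image consists of
  the pairs (A x, C x), reparametrized by A x.\<close>

lemma graph_image:
  fixes Y :: "'k::finite endo" and P :: "real^'k^'k"
  defines "A \<equiv> matrix (\<lambda>x. fst (Y (x, P *v x)))" and "C \<equiv> matrix (\<lambda>x. snd (Y (x, P *v x)))"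
  assumes A: "det A \<noteq> 0"
  shows "blinfun_apply Y ` graph P = graph (C ** matrix_inv A)"
proof -
  have lin: "linear (\<lambda>x. Y (x, P *v x))"
    by (intro linear_compose[of "\<lambda>x. (x, P *v x)" "blinfun_apply Y", unfolded o_def])
       (auto simp: linear_iff matrix_vector_simps blinfun.bilinear_simps)
  have AC: "Y (x, P *v x) = (A *v x, C *v x)" for x
    using linear_compose[OF lin linear_fst] linear_compose[OF lin linear_snd]
    unfolding A_def C_def o_def by (simp add: matrix_works prod_eq_iff)
  have "blinfun_apply Y ` graph P = range (\<lambda>x. (A *v x, C *v x))"
    unfolding graph_def by (auto simp: AC[symmetric])
  also have "\<dots> = graph (C ** matrix_inv A)"
  proof -
    have "(A *v x, C *v x) = (A *v x, (C ** matrix_inv A) *v (A *v x))" for x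
      by (metis A matrix_inv_mult(2) matrix_mul_assoc matrix_mul_rid matrix_vector_mul_assoc)
    moreover have "(x, (C ** matrix_inv A) *v x) = (A *v (matrix_inv A *v x), C *v (matrix_inv A *v x))" for x
      by (simp add: matrix_vector_mul_assoc A matrix_inv_mult)
    ultimately show ?thesis unfolding graph_def by (auto simp: image_iff)
  qed
  finally show ?thesis .
qed

lemma matrix_inv_mat_1: "matrix_inv (mat 1 :: real^'n::finite^'n) = mat 1"
  using matrix_inv_mult(1)[of "mat 1 :: real^'n^'n"] by simp

lemma bounded_linear_matrixI:
  fixes g :: "'a::real_normed_vector \<Rightarrow> real^'n::finite^'m::finite"
  assumes "\<And>i j. bounded_linear (\<lambda>Y. g Y $ i $ j)"
  shows "bounded_linear g"
proof -
  have eq: "g = (\<lambda>Y. \<Sum>i\<in>UNIV. \<Sum>j\<in>UNIV. (g Y $ i $ j) *\<^sub>R axis i (axis j 1))"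
  proof (rule ext)
    fix Y
    have row: "(\<Sum>j\<in>UNIV. (v $ j) *\<^sub>R axis j 1) = v" for v :: "real^'n"
      using basis_expansion[of v] by (simp add: scalar_mult_eq_scaleR)
    have ax: "x *\<^sub>R axis i y = axis i (x *\<^sub>R y)" for x and i :: 'm and y :: "real^'n"
      by (simp add: axis_def vec_eq_iff)
    have axs: "(\<Sum>j\<in>UNIV. axis i (w j)) = axis i (\<Sum>j\<in>UNIV. w j)" for i :: 'm and w :: "'n \<Rightarrow> real^'n"
      by (simp add: axis_def vec_eq_iff)
    have "(\<Sum>i\<in>UNIV. \<Sum>j\<in>UNIV. (g Y $ i $ j) *\<^sub>R axis i (axis j 1)) = (\<Sum>i\<in>UNIV. axis i (g Y $ i))"
      unfolding ax axs row ..
    also have "\<dots> = g Y"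
      by (simp add: vec_eq_iff[of _ "g Y"] axis_def if_distrib[of "\<lambda>v. v $ _"] cong: if_cong)
    finally show "g Y = (\<Sum>i\<in>UNIV. \<Sum>j\<in>UNIV. (g Y $ i $ j) *\<^sub>R axis i (axis j 1))" ..
  qed
  have bl: "bounded_linear (\<lambda>Y. \<Sum>i\<in>UNIV. \<Sum>j\<in>UNIV. (g Y $ i $ j) *\<^sub>R (axis i (axis j 1) :: real^'n^'m))"
    by (intro bounded_linear_sum bounded_linear_scaleR_const assms)
  show ?thesis by (rule back_subst[of bounded_linear, OF bl eq[symmetric]])
qed

lemma has_vector_derivative_graph_chart:
  fixes X :: "'k::finite endo" and P :: "real^'k^'k"
  defines "A \<equiv> matrix (\<lambda>x. fst (X (x, P *v x)))" and "C \<equiv> matrix (\<lambda>x. snd (X (x, P *v x)))"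
  shows "((\<lambda>t. snd graph_chart (blinfun_apply (endo_exp (t *\<^sub>R X)) ` graph P))
    has_vector_derivative (C - P ** A)) (at 0)"
proof -
  define At where "At Y = matrix (\<lambda>x. fst (blinfun_apply Y (x, P *v x)))" for Y :: "'k endo"
  define Ct where "Ct Y = matrix (\<lambda>x. snd (blinfun_apply Y (x, P *v x)))" for Y :: "'k endo"
  have bl: "bounded_linear (\<lambda>Y :: 'k endo. fst (blinfun_apply Y v) $ i)" 
    "bounded_linear (\<lambda>Y :: 'k endo. snd (blinfun_apply Y v) $ i)" for v i
    by (rule bounded_linear_compose[OF bounded_linear_vec_nth],
        rule bounded_linear_compose[OF bounded_linear_fst blinfun.bounded_linear_left]
             bounded_linear_compose[OF bounded_linear_snd blinfun.bounded_linear_left])+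
  have blA: "bounded_linear At" and blC: "bounded_linear Ct"
    by (rule bounded_linear_matrixI, simp add: At_def Ct_def matrix_def bl)+
  have A0: "At id_blinfun = mat 1" and C0: "Ct id_blinfun = P"
    using matrix_id_mat_1 by (auto simp: At_def Ct_def id_def)
  define a where "a t = At (endo_exp (t *\<^sub>R X))" for t
  define c where "c t = Ct (endo_exp (t *\<^sub>R X))" for t
  have a: "(a has_vector_derivative At X) (at 0)" and c: "(c has_vector_derivative Ct X) (at 0)"
    unfolding a_def[abs_def] c_def[abs_def]
    by (intro bounded_linear.has_vector_derivative[OF blA] bounded_linear.has_vector_derivative[OF blC]
        has_vector_derivative_endo_exp)+
  have a0: "a 0 = mat 1" and c0: "c 0 = P" by (simp_all add: a_def c_def endo_exp_0 A0 C0)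
  have i: "((\<lambda>t. matrix_inv (a t)) has_derivative (\<lambda>s. s *\<^sub>R (- At X))) (at 0)"
  proof -
    have "(matrix_inv has_derivative (\<lambda>u. - (matrix_inv (mat 1) ** u ** matrix_inv (mat 1)))) (at (a 0))"
      unfolding a0 by (rule has_derivative_matrix_inv) simp
    from has_derivative_compose[OF a[unfolded has_vector_derivative_def] this]
    show ?thesis by (simp add: matrix_inv_mat_1 matrix_mult_simps)
  qed
  have "((\<lambda>t. c t ** matrix_inv (a t)) has_derivative (\<lambda>s. c 0 ** (s *\<^sub>R (- At X)) + (s *\<^sub>R Ct X) ** matrix_inv (a 0))) (at 0)"
    by (rule bounded_bilinear.FDERIV[OF bounded_bilinear_matrix_mult c[unfolded has_vector_derivative_def] i])
  also have "(\<lambda>s. c 0 ** (s *\<^sub>R (- At X)) + (s *\<^sub>R Ct X) ** matrix_inv (a 0)) = (\<lambda>s. s *\<^sub>R (Ct X - P ** At X))"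
    by (simp add: fun_eq_iff a0 c0 matrix_inv_mat_1 matrix_mult_simps scaleR_diff_right)
  finally have d: "((\<lambda>t. c t ** matrix_inv (a t)) has_derivative (\<lambda>s. s *\<^sub>R (Ct X - P ** At X))) (at 0)" .
  have "(a \<longlongrightarrow> mat 1) (at 0)"
    using has_vector_derivative_continuous[OF a] by (simp add: continuous_within a0)
  \<comment> \<open>At \<open>t = 0\<close> the first component is the identity, hence it remains
    invertible nearby and the fractional linear formula is valid there.\<close>
  then have ev: "eventually (\<lambda>t. det (a t) \<noteq> 0) (at 0)"
    using topological_tendstoD[OF _ open_det_nonzero, of a "mat 1"] by simp
  have gr: "snd graph_chart (blinfun_apply (endo_exp (t *\<^sub>R X)) ` graph P) = c t ** matrix_inv (a t)"
    if "det (a t) \<noteq> 0" for t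
    using graph_image[of "endo_exp (t *\<^sub>R X)" P] that by (simp add: a_def c_def At_def Ct_def snd_graph_chart)
  have "((\<lambda>t. snd graph_chart (blinfun_apply (endo_exp (t *\<^sub>R X)) ` graph P))
    has_derivative (\<lambda>s. s *\<^sub>R (Ct X - P ** At X))) (at 0)"
  proof (rule has_derivative_transform_eventually[OF d])
    show "\<forall>\<^sub>F t in at 0. c t ** matrix_inv (a t) = snd graph_chart (blinfun_apply (endo_exp (t *\<^sub>R X)) ` graph P)"
      using ev by (rule eventually_mono) (rule gr[symmetric])
    show "c 0 ** matrix_inv (a 0) = snd graph_chart (blinfun_apply (endo_exp (0 *\<^sub>R X)) ` graph P)"
      by (rule gr[symmetric]) (simp add: a0)
  qed simp
  then show ?thesis
    by (simp add: has_vector_derivative_def A_def C_def At_def Ct_def)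
qed

section \<open>The infinitesimal action and the Cartan decomposition at a graph\<close>

definition graph_velocity :: "real^'k::finite^'k \<Rightarrow> 'k endo \<Rightarrow> real^'k^'k" where
  "graph_velocity P X = matrix (\<lambda>x. snd (X (x, P *v x)) - P *v fst (X (x, P *v x)))"

lemma linear_blinfun_graph:
  fixes X :: "'k::finite endo"
  shows "linear (\<lambda>x. fst (X (x, P *v x)))" "linear (\<lambda>x. snd (X (x, P *v x)))"
proof -
  have "linear (\<lambda>x. X (x, P *v x))"
    by (intro linear_compose[of "\<lambda>x. (x, P *v x)" "blinfun_apply X", unfolded o_def])
       (auto simp: linear_iff matrix_vector_simps blinfun.bilinear_simps)
  from linear_compose[OF this linear_fst] linear_compose[OF this linear_snd]
  show "linear (\<lambda>x. fst (X (x, P *v x)))" "linear (\<lambda>x. snd (X (x, P *v x)))" by (simp_all add: o_def)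
qed

lemma graph_velocity_mult: "graph_velocity P X *v x = snd (X (x, P *v x)) - P *v fst (X (x, P *v x))"
proof -
  have "linear (\<lambda>x. snd (X (x, P *v x)) - P *v fst (X (x, P *v x)))"
    by (intro linear_compose_sub linear_blinfun_graph linear_compose[OF linear_blinfun_graph(1), unfolded o_def] matrix_vector_mul_linear)
  then show ?thesis unfolding graph_velocity_def by (simp add: matrix_works)
qed

lemma has_vector_derivative_graph_velocity:
  fixes X :: "'k::finite endo" and P :: "real^'k^'k"
  shows "((\<lambda>t. snd graph_chart (blinfun_apply (endo_exp (t *\<^sub>R X)) ` graph P))
    has_vector_derivative graph_velocity P X) (at 0)"
proof -
  have "matrix (\<lambda>x. snd (X (x, P *v x))) - P ** matrix (\<lambda>x. fst (X (x, P *v x))) = graph_velocity P X"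
    unfolding matrix_eq graph_velocity_mult
    by (simp add: matrix_vector_simps matrix_vector_mul_assoc[symmetric] linear_blinfun_graph)
  then show ?thesis using has_vector_derivative_graph_chart[of X P] by simp
qed

lemma graph_velocity_diff: "graph_velocity P (X - Y) = graph_velocity P X - graph_velocity P Y"
  unfolding matrix_eq by (simp add: matrix_vector_simps graph_velocity_mult blinfun.bilinear_simps)

text \<open>A Riccati expression, in which \<open>K\<close> no longer occurs. For symmetric
  \<open>S\<close> and skew \<open>b\<close>, \<open>g\<close> its skew part is
  \<open>g - S ** b ** S\<close> and the remaining terms form its symmetric part; this decouples
  \<open>b\<close>, \<open>g\<close> from \<open>a\<close> in the arguments below.\<close>

lemma graph_velocity_block_endo:
  fixes K :: "real^'k::finite^'k"
  shows "graph_velocity (K + S) (block_endo K a b g (- transpose a)) = g - transpose a ** S - S ** a - S ** b ** S"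
proof -
  have "blinfun_apply (block_endo K a b g (- transpose a)) (x, (K + S) *v x) =
      (a *v x + b *v (S *v x), K *v (a *v x + b *v (S *v x)) + g *v x + (- transpose a) *v (S *v x))" for x
    unfolding block_endo_apply[symmetric] by (simp add: matrix_vector_simps add_ac)
  then show ?thesis
    unfolding matrix_eq graph_velocity_mult
    by (simp add: matrix_vector_simps matrix_vector_mul_assoc[symmetric] del: transpose_matrix_vector)
qed

lemma isotropy_algebra_graph: "X \<in> isotropy_algebra (graph P) \<longleftrightarrow> X \<in> so_b \<and> graph_velocity P X = 0"
proof -
  have "blinfun_apply X ` graph P \<subseteq> graph P \<longleftrightarrow> (\<forall>x. snd (X (x, P *v x)) = P *v fst (X (x, P *v x)))"
    unfolding graph_def by (auto simp: image_subset_iff prod_eq_iff)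
  also have "\<dots> \<longleftrightarrow> graph_velocity P X = 0"
    unfolding matrix_eq graph_velocity_mult by simp
  finally show ?thesis unfolding isotropy_algebra_def by simp
qed

lemma killing_form_block_endo:
  fixes K :: "real^'k::finite^'k"
  assumes "transpose K = - K" "transpose b = - b" "transpose g = - g" "transpose b' = - b'" "transpose g' = - g'"
  shows "killing_form (block_endo K a b g (- transpose a)) (block_endo K a' b' g' (- transpose a'))
    = (2 * real CARD('k) - 2) * (2 * trace (a ** a') + trace (b ** g') + trace (g ** b'))"
  by (simp add: killing_form_eq block_endo_in_so_b assms blinfun_trace_so_b_compose)

lemma trace_skew_square: "transpose A = - A \<Longrightarrow> trace (A ** A) = - (A \<bullet> A)" for A :: "real^'n::finite^'n"
  using trace_mult_transpose[of A A] by (simp add: matrix_mult_simps trace_minus)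

text \<open>The Killing form is nondegenerate on the isotropy algebra: pair the block endomorphism with
  blocks \<open>a, b\<close> with the one with blocks \<open>S a S, S\<^sup>-\<^sup>1 b S\<^sup>-\<^sup>1\<close>.\<close>

lemma isotropy_inter_complement:
  fixes K S :: "real^'k::finite^'k"
  assumes K: "transpose K = - K" and S: "transpose S = S" "det S \<noteq> 0" and card: "CARD('k) \<ge> 2"
    and D: "D \<in> cartan_complement (graph (K + S))" "D \<in> isotropy_algebra (graph (K + S))"
  shows "D = 0"
proof -
  let ?T = "matrix_inv S"
  have Dso: "D \<in> so_b" and Dv: "graph_velocity (K + S) D = 0"
    using D(2) by (auto simp: isotropy_algebra_graph)
  obtain a b g where De: "D = block_endo K a b g (- transpose a)" and b: "transpose b = - b" and g: "transpose g = - g"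
    using so_b_block_endo[OF Dso K] .
  have e1: "g - transpose a ** S - S ** a - S ** b ** S = 0"
    using Dv unfolding De graph_velocity_block_endo .
  then have "transpose (g - transpose a ** S - S ** a - S ** b ** S) = 0" by (simp add: transpose_def vec_eq_iff)
  \<comment> \<open>Comparing the equation with its transpose separates the skew part, involving
    \<open>g\<close> and \<open>b\<close>, from the symmetric part, involving
    \<open>a\<close>.\<close>
  then have e2: "- g - S ** a - transpose a ** S + S ** b ** S = 0"
    by (simp add: transpose_simps matrix_transpose_mul S b g matrix_mult_simps matrix_mul_assoc)
  have gb: "g = S ** b ** S"
  proof -
    have "2 *\<^sub>R (g - S ** b ** S) = (g - transpose a ** S - S ** a - S ** b ** S)
          - (- g - S ** a - transpose a ** S + S ** b ** S)"
        by (simp add: scaleR_2 del: transpose_matrix_vector)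
      then have "2 *\<^sub>R (g - S ** b ** S) = 0" unfolding e1 e2 by simp
    then show ?thesis by simp
  qed
  define \<sigma> where "\<sigma> = S ** a"
  have \<sigma>: "transpose \<sigma> = - \<sigma>"
    using e1 unfolding gb \<sigma>_def by (simp add: matrix_transpose_mul S add_eq_0_iff algebra_simps)
  have TS: "?T ** S = mat 1" "S ** ?T = mat 1" using matrix_inv_mult S(2) by auto
  have tT: "transpose ?T = ?T"
    by (metis TS S(1) matrix_transpose_mul matrix_mul_assoc matrix_mul_lid matrix_mul_rid transpose_mat)
  define a' where "a' = S ** a ** S"
  define b' where "b' = ?T ** b ** ?T"
  define Z where "Z = block_endo K a' b' b (- transpose a')"
  have b': "transpose b' = - b'"
    by (simp add: b'_def matrix_transpose_mul tT b matrix_mult_simps matrix_mul_assoc)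
  have SbS: "S ** b' ** S = b"
    unfolding b'_def by (metis TS matrix_mul_assoc matrix_mul_lid matrix_mul_rid)
  have a'\<sigma>: "a' = \<sigma> ** S" by (simp add: a'_def \<sigma>_def)
  have "graph_velocity (K + S) Z = 0"
    unfolding Z_def graph_velocity_block_endo SbS a'\<sigma>
    by (simp add: matrix_transpose_mul S \<sigma> matrix_mult_simps matrix_mul_assoc)
  then have "Z \<in> isotropy_algebra (graph (K + S))"
    unfolding isotropy_algebra_graph Z_def using block_endo_in_so_b[OF K b' b] by simp
  then have "killing_form D Z = 0" using D(1) unfolding cartan_complement_def by blast
  then have t0: "2 * trace (a ** a') + trace (b ** b) + trace (g ** b') = 0"
    unfolding De Z_def killing_form_block_endo[OF K b g b' b] using card by auto
  have "trace (a ** a') = trace (\<sigma> ** \<sigma>)"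
    unfolding a'_def \<sigma>_def by (metis matrix_mul_assoc trace_mul_sym)
  moreover have "trace (g ** b') = trace (b ** b)"
  proof -
    have "trace (g ** b') = trace (b ** (S ** b' ** S))"
      unfolding gb by (metis matrix_mul_assoc trace_mul_sym)
    then show ?thesis by (simp add: SbS)
  qed
  \<comment> \<open>The trace of the square of a skew matrix is minus its squared norm, so all terms
    of the pairing have the same sign.\<close>
  ultimately have "\<sigma> \<bullet> \<sigma> + b \<bullet> b = 0" using t0 by (simp add: trace_skew_square \<sigma> b)
  then have z: "\<sigma> = 0" "b = 0" using inner_ge_zero[of \<sigma>] inner_ge_zero[of b]
    by (simp_all add: add_nonneg_eq_0_iff)
  have "a = ?T ** \<sigma>" by (simp add: \<sigma>_def matrix_mul_assoc TS)
  then have "a = 0" "b = 0" "g = 0" by (simp_all add: gb z matrix_mult_simps)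
  then have "blinfun_apply D u = 0" for u
    unfolding De by (rule_tac shear_exhaust[of u K]) (auto simp: block_endo_apply matrix_vector_simps simp del: transpose_matrix_vector simp: transpose_def zero_vec_def[symmetric] zero_prod_def)
  then show ?thesis by (intro blinfun_eqI) simp
qed

lemma so_b_diff: "X \<in> so_b \<Longrightarrow> Y \<in> so_b \<Longrightarrow> X - Y \<in> so_b"
  by (rule subspace_diff[OF subspace_so_b])

lemma cartan_complement_diff:
  assumes "X \<in> cartan_complement Q" "Y \<in> cartan_complement Q"
  shows "X - Y \<in> cartan_complement Q"
proof -
  have "killing_form (X - Y) Z = killing_form X Z - killing_form Y Z" if "Z \<in> so_b" for Z
  proof -
    have "(X - Y) o\<^sub>L Z = (X o\<^sub>L Z) - (Y o\<^sub>L Z)" by (rule blinfun_eqI) (simp add: blinfun.diff_left)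
    then have "blinfun_trace ((X - Y) o\<^sub>L Z) = blinfun_trace (X o\<^sub>L Z) - blinfun_trace (Y o\<^sub>L Z)"
      by (simp add: blinfun_trace_def blinfun.diff_left inner_diff_left sum_subtractf)
    then show ?thesis
      using assms that by (simp add: cartan_complement_def killing_form_eq so_b_diff right_diff_distrib)
  qed
  then show ?thesis
    using assms so_b_diff by (auto simp: cartan_complement_def isotropy_algebra_def)
qed

definition sym_part :: "real^'k::finite^'k \<Rightarrow> real^'k^'k" where
  "sym_part v = (1/2) *\<^sub>R (v + transpose v)"

definition skew_part :: "real^'k::finite^'k \<Rightarrow> real^'k^'k" where
  "skew_part v = (1/2) *\<^sub>R (v - transpose v)"

lemma sym_skew_part:
  "transpose (sym_part v) = sym_part v" "transpose (skew_part v) = - skew_part v" "sym_part v + skew_part v = v"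
  "skew_part v + sym_part v = v"
  by (simp_all add: sym_part_def skew_part_def transpose_def vec_eq_iff field_simps)

text \<open>The isotropy algebra is given by \<open>S ** a\<close> skew and
  \<open>g = S ** b ** S\<close>. This suggests the complement with \<open>S ** a\<close> symmetric
  and \<open>g = - S ** b ** S\<close>. There the velocity is 2 g - 2 S a, and matching its skew and
  symmetric parts with those of \<open>v\<close> produces the three factors 1/2.\<close>

lemma cartan_lift_graph:
  fixes K S :: "real^'k::finite^'k" and v :: "real^'k^'k"
  assumes K: "transpose K = - K" and S: "transpose S = S" "det S \<noteq> 0" and card: "CARD('k) \<ge> 2"
  defines "b \<equiv> - (1/2) *\<^sub>R (matrix_inv S ** skew_part v ** matrix_inv S)"
    and "a \<equiv> - (1/2) *\<^sub>R (matrix_inv S ** sym_part v)"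
  shows "cartan_lift graph_chart (graph (K + S)) v = block_endo K a b ((1/2) *\<^sub>R skew_part v) (- transpose a)"
    and "transpose b = - b"
proof -
  let ?T = "matrix_inv S"
  let ?g = "(1/2) *\<^sub>R skew_part v"
  let ?X = "block_endo K a b ?g (- transpose a)"
  have TS: "?T ** S = mat 1" "S ** ?T = mat 1" using matrix_inv_mult S(2) by auto
  have tT: "transpose ?T = ?T"
    by (metis TS S(1) matrix_transpose_mul matrix_mul_assoc matrix_mul_lid matrix_mul_rid transpose_mat)
  show b: "transpose b = - b"
    by (simp add: b_def transpose_simps matrix_transpose_mul tT sym_skew_part matrix_mult_simps matrix_mul_assoc)
  have g: "transpose ?g = - ?g" by (simp add: transpose_simps sym_skew_part)
  have Sa: "S ** a = - (1/2) *\<^sub>R sym_part v"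
    by (simp add: a_def matrix_mult_simps matrix_mul_assoc TS)
  have aS: "transpose a ** S = - (1/2) *\<^sub>R sym_part v"
    by (metis Sa S(1) matrix_transpose_mul transpose_simps(4) sym_skew_part(1))
  have SbS: "S ** b ** S = - ?g"
    by (simp add: b_def matrix_mult_simps matrix_mul_assoc TS matrix_mul_assoc[symmetric, of _ ?T S])
  have vel: "graph_velocity (K + S) ?X = v"
    unfolding graph_velocity_block_endo Sa aS SbS
    using sym_skew_part(3)[of v] by (simp add: scaleR_add_left[symmetric] algebra_simps)
  have so: "?X \<in> so_b" by (rule block_endo_in_so_b[OF K b g])
  have "killing_form ?X Z = 0" if Z: "Z \<in> isotropy_algebra (graph (K + S))" for Z
  proof -
    have Zso: "Z \<in> so_b" and Zv: "graph_velocity (K + S) Z = 0"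
      using Z by (auto simp: isotropy_algebra_graph)
    obtain a' b' g' where Ze: "Z = block_endo K a' b' g' (- transpose a')" and b': "transpose b' = - b'" and g': "transpose g' = - g'"
      using so_b_block_endo[OF Zso K] .
    have e1: "g' - transpose a' ** S - S ** a' - S ** b' ** S = 0"
      using Zv unfolding Ze graph_velocity_block_endo .
    then have "transpose (g' - transpose a' ** S - S ** a' - S ** b' ** S) = 0" by (simp add: transpose_def vec_eq_iff)
    then have e2: "- g' - S ** a' - transpose a' ** S + S ** b' ** S = 0"
      by (simp add: transpose_simps matrix_transpose_mul S b' g' matrix_mult_simps matrix_mul_assoc)
    have gb: "g' = S ** b' ** S"
    proof -
      have "2 *\<^sub>R (g' - S ** b' ** S) = (g' - transpose a' ** S - S ** a' - S ** b' ** S)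
          - (- g' - S ** a' - transpose a' ** S + S ** b' ** S)"
        by (simp add: scaleR_2 del: transpose_matrix_vector)
      then have "2 *\<^sub>R (g' - S ** b' ** S) = 0" unfolding e1 e2 by simp
      then show ?thesis by simp
    qed
    define \<sigma> where "\<sigma> = S ** a'"
    have \<sigma>: "transpose \<sigma> = - \<sigma>"
      using e1 unfolding gb \<sigma>_def by (simp add: matrix_transpose_mul S add_eq_0_iff algebra_simps)
    have a'\<sigma>: "a' = ?T ** \<sigma>" unfolding \<sigma>_def by (simp add: matrix_mul_assoc TS)
    have "trace (a ** a') = 0"
    proof -
      \<comment> \<open>The product is a symmetric matrix times the skew \<open>\<sigma>\<close>, so
        transposition shows that its trace is its own negative.\<close>
      let ?u = "?T ** sym_part v ** ?T"
      have u: "transpose ?u = ?u" by (simp add: matrix_transpose_mul tT sym_skew_part matrix_mul_assoc)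
      have "trace (?u ** \<sigma>) = trace (transpose (?u ** \<sigma>))" by (rule trace_transpose[symmetric])
      also have "\<dots> = - trace (?u ** \<sigma>)"
        unfolding matrix_transpose_mul[of ?u] u \<sigma> by (simp add: matrix_mult_simps trace_minus trace_mul_sym[of \<sigma>])
      finally have "trace (?u ** \<sigma>) = 0" by simp
      then show ?thesis by (simp add: a_def a'\<sigma> matrix_mult_simps trace_scaleR trace_minus matrix_mul_assoc)
    qed
    \<comment> \<open>By cyclicity this pairing becomes one of \<open>S ** b ** S = - ?g\<close>
      with \<open>b'\<close>, and so cancels the remaining term of the Killing form.\<close>
    moreover have "trace (b ** g') = trace (S ** b ** S ** b')"
      unfolding gb by (metis matrix_mul_assoc trace_mul_sym)
    ultimately show ?thesis
      unfolding Ze killing_form_block_endo[OF K b g b' g'] by (simp add: SbS matrix_mult_simps trace_minus)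
  qed
  then have X: "?X \<in> cartan_complement (graph (K + S))" using so by (simp add: cartan_complement_def)
  show "cartan_lift graph_chart (graph (K + S)) v = ?X"
    unfolding cartan_lift_def
  proof (rule the_equality)
    show "?X \<in> cartan_complement (graph (K + S)) \<and>
      ((\<lambda>t. snd graph_chart (blinfun_apply (endo_exp (t *\<^sub>R ?X)) ` graph (K + S))) has_vector_derivative v) (at 0)"
      using X has_vector_derivative_graph_velocity[of ?X "K + S"] vel by simp
    \<comment> \<open>Two lifts of the same velocity differ by an element of both the isotropy
      algebra and its complement.\<close>
    fix Y assume Y: "Y \<in> cartan_complement (graph (K + S)) \<and>
      ((\<lambda>t. snd graph_chart (blinfun_apply (endo_exp (t *\<^sub>R Y)) ` graph (K + S))) has_vector_derivative v) (at 0)"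
    then have "graph_velocity (K + S) Y = v"
      using vector_derivative_unique_at has_vector_derivative_graph_velocity by blast
    then have "graph_velocity (K + S) (Y - ?X) = 0" by (simp add: graph_velocity_diff vel)
    moreover have c: "Y - ?X \<in> cartan_complement (graph (K + S))" using X Y cartan_complement_diff by blast
    ultimately have "Y - ?X \<in> isotropy_algebra (graph (K + S))"
      by (simp add: isotropy_algebra_graph cartan_complement_def)
    from isotropy_inter_complement[OF K S card c this] show "Y = ?X" by simp
  qed
qed

text \<open>The lift makes the symmetric parts contribute with a plus sign and the skew parts with a
  minus sign. The transpose on \<open>w\<close> absorbs this sign, and the mixed terms are traces of
  symmetric against skew factors, which vanish.\<close>

lemma killing_metric_graph:
  fixes P v w :: "real^'k::finite^'k"
  assumes P: "det (sym_part P) \<noteq> 0" and card: "CARD('k) \<ge> 2"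
  shows "killing_metric graph_chart (graph P) v w = (real CARD('k) - 1) *
    trace (matrix_inv (sym_part P) ** v ** matrix_inv (sym_part P) ** transpose w)"
proof -
  let ?S = "sym_part P" and ?T = "matrix_inv (sym_part P)"
  have TS: "?T ** ?S = mat 1" "?S ** ?T = mat 1" using matrix_inv_mult P by auto
  have e: "graph P = graph (skew_part P + ?S)" by (simp add: sym_skew_part)
  note lift = cartan_lift_graph[OF sym_skew_part(2) sym_skew_part(1) P card]
  have g: "transpose ((1/2) *\<^sub>R skew_part v) = - ((1/2) *\<^sub>R skew_part v)" for v :: "real^'k^'k"
    by (simp add: transpose_simps sym_skew_part)
  have "killing_metric graph_chart (graph P) v w = (2 * real CARD('k) - 2) *
     ((1/2) * trace (?T ** sym_part v ** ?T ** sym_part w)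
      - (1/4) * trace (?T ** skew_part v ** ?T ** skew_part w) - (1/4) * trace (skew_part v ** (?T ** skew_part w ** ?T)))"
    unfolding killing_metric_def e lift(1) killing_form_block_endo[OF sym_skew_part(2) lift(2) g lift(2) g]
    by (simp add: matrix_mult_simps trace_scaleR trace_minus matrix_mul_assoc algebra_simps)
  also have "trace (skew_part v ** (?T ** skew_part w ** ?T)) = trace (?T ** skew_part v ** ?T ** skew_part w)"
    by (metis matrix_mul_assoc trace_mul_sym)
  finally have 1: "killing_metric graph_chart (graph P) v w = (real CARD('k) - 1) *
     (trace (?T ** sym_part v ** ?T ** sym_part w) - trace (?T ** skew_part v ** ?T ** skew_part w))"
    by (simp add: field_simps)
  have tT: "transpose ?T = ?T"
    by (metis TS sym_skew_part(1) matrix_transpose_mul matrix_mul_assoc matrix_mul_lid matrix_mul_rid transpose_mat)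
  have cross: "trace (?T ** s ** ?T ** k) = 0" if s: "transpose s = s" and k: "transpose k = - k" for s k
  proof -
    have "trace (?T ** s ** ?T ** k) = trace (transpose (?T ** s ** ?T ** k))" by (rule trace_transpose[symmetric])
    also have "\<dots> = - trace (k ** (?T ** s ** ?T))"
      by (simp add: matrix_transpose_mul tT s k matrix_mult_simps trace_minus matrix_mul_assoc)
    also have "\<dots> = - trace (?T ** s ** ?T ** k)" by (simp add: trace_mul_sym[of k])
    finally show ?thesis by simp
  qed
  have v: "v = sym_part v + skew_part v" and w: "transpose w = sym_part w - skew_part w"
    by (simp_all add: sym_skew_part) (simp add: sym_part_def skew_part_def scaleR_diff_right[symmetric] scaleR_2[symmetric])
  have cross': "trace (?T ** skew_part v ** ?T ** sym_part w) = 0"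
    using cross[OF sym_skew_part(1) sym_skew_part(2), of w v] by (metis matrix_mul_assoc trace_mul_sym)
  have "trace (?T ** v ** ?T ** transpose w) =
     trace (?T ** (sym_part v + skew_part v) ** ?T ** (sym_part w - skew_part w))"
    using v w by metis
  also have "\<dots> = trace (?T ** sym_part v ** ?T ** sym_part w) - trace (?T ** skew_part v ** ?T ** skew_part w)"
    by (simp add: matrix_mult_simps trace_add trace_sub cross[OF sym_skew_part(1) sym_skew_part(2)] cross')
  finally show ?thesis using 1 by simp
qed

section \<open>Positive definite matrices, symmetric or not, as the image of the graph chart\<close>

definition pos_def :: "real^'n::finite^'n \<Rightarrow> bool" where
  "pos_def P \<longleftrightarrow> (\<forall>x. x \<noteq> 0 \<longrightarrow> x \<bullet> (P *v x) > 0)"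

lemma det_nonzero_iff: "det A \<noteq> 0 \<longleftrightarrow> (\<forall>x. A *v x = 0 \<longrightarrow> x = 0)" for A :: "real^'n::finite^'n"
  by (metis invertible_det_nz invertible_left_inverse matrix_left_invertible_ker)

lemma inner_sym_part: "x \<bullet> (sym_part P *v x) = x \<bullet> (P *v x)"
proof -
  have "x \<bullet> (transpose P *v x) = x \<bullet> (P *v x)" by (metis inner_commute inner_matrix_left)
  then show ?thesis by (simp add: sym_part_def matrix_vector_simps inner_right_distrib del: transpose_matrix_vector)
qed

lemma pos_def_det: "pos_def P \<Longrightarrow> det P \<noteq> 0"
  unfolding det_nonzero_iff pos_def_def by (metis inner_zero_right less_irrefl)

lemma pos_def_det_sym_part: "pos_def P \<Longrightarrow> det (sym_part P) \<noteq> 0"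
  by (rule pos_def_det) (simp add: pos_def_def inner_sym_part)

text \<open>Openness allows the metric coefficients to be differentiated in all matrix directions,
  including nonsymmetric ones.\<close>

lemma open_pos_def: "open {P :: real^'n::finite^'n. pos_def P}"
  unfolding open_dist
proof (intro ballI)
  fix P :: "real^'n^'n" assume "P \<in> {P. pos_def P}"
  then have P: "x \<noteq> 0 \<Longrightarrow> x \<bullet> (P *v x) > 0" for x by (simp add: pos_def_def)
  obtain K where K: "K > 0" "\<And>A x. norm ((A :: real^'n^'n) *v x) \<le> norm A * norm x * K"
    using bounded_bilinear.pos_bounded[OF bounded_bilinear_matrix_vector_mult] by blast
  have "continuous_on (sphere 0 1) (\<lambda>x. x \<bullet> (P *v x))"
    by (intro continuous_intros linear_continuous_on bounded_linear_intros matrix_vector_mul_bounded_linear)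
  moreover have "sphere (0 :: real^'n) 1 \<noteq> {}" by simp
  ultimately obtain x0 where x0: "x0 \<in> sphere 0 1" "\<And>x. x \<in> sphere 0 1 \<Longrightarrow> x0 \<bullet> (P *v x0) \<le> x \<bullet> (P *v x)"
    using continuous_attains_inf[OF compact_sphere, of 0 1 "\<lambda>x. x \<bullet> (P *v x)"] by blast
  define m where "m = x0 \<bullet> (P *v x0)"
  have "x0 \<noteq> 0" using x0(1) by auto
  then have m: "m > 0" unfolding m_def using P by blast
  show "\<exists>e>0. \<forall>Q. dist Q P < e \<longrightarrow> Q \<in> {P. pos_def P}"
  \<comment> \<open>Here \<open>m\<close> is the minimum of the quadratic form on the unit sphere,
    and \<open>K\<close> bounds matrix-vector multiplication. A perturbation of norm below
    \<open>m / K\<close> changes the form on unit vectors by less than \<open>m\<close>.\<close>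
  proof (intro exI[of _ "m / K"] conjI allI impI)
    show "m / K > 0" using m K by simp
    fix Q assume Q: "dist Q P < m / K"
    have "x \<bullet> (Q *v x) > 0" if x: "x \<noteq> 0" for x
    proof -
      define y where "y = (1 / norm x) *\<^sub>R x"
      have y: "norm y = 1" using x by (simp add: y_def)
      have "\<bar>y \<bullet> ((Q - P) *v y)\<bar> \<le> norm y * norm ((Q - P) *v y)" by (rule Cauchy_Schwarz_ineq2)
      also have "\<dots> \<le> norm (Q - P) * K" using K(2)[of "Q - P" y] y by simp
      also have "\<dots> < m" using Q K(1) by (simp add: dist_norm pos_less_divide_eq)
      finally have "\<bar>y \<bullet> ((Q - P) *v y)\<bar> < m" .
      moreover have "m \<le> y \<bullet> (P *v y)" unfolding m_def using x0(2) y by simp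
      ultimately have "y \<bullet> (Q *v y) > 0" by (simp add: matrix_vector_simps inner_diff_right)
      moreover have "y \<bullet> (Q *v y) = (x \<bullet> (Q *v x)) / (norm x)\<^sup>2"
        by (simp add: y_def matrix_vector_simps power2_eq_square)
      ultimately show ?thesis using x by (simp add: zero_less_divide_iff)
    qed
    then show "Q \<in> {P. pos_def P}" by (simp add: pos_def_def)
  qed
qed

lemma bform_graph: "bform (x, P *v x) (x, P *v x) = x \<bullet> (P *v x)"
  by (simp add: bform_def inner_commute)

lemma dim_graph: "subspace (graph P) \<and> dim (graph (P :: real^'k::finite^'k)) = CARD('k)"
proof -
  have lin: "linear (\<lambda>x. (x, P *v x))" by (simp add: linear_iff matrix_vector_simps)
  have g: "graph P = range (\<lambda>x. (x, P *v x))" by (auto simp: graph_def)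
  have "dim (range (\<lambda>x. (x, P *v x))) = dim (UNIV :: (real^'k) set)"
    by (rule dim_image_eq[OF lin]) (auto simp: inj_on_def)
  then show ?thesis unfolding g using linear_subspace_image[OF lin subspace_UNIV] by simp
qed

lemma graph_in_positive_subspaces: "graph P \<in> positive_subspaces \<longleftrightarrow> pos_def P"
proof -
  have "(\<forall>u\<in>graph P. u \<noteq> 0 \<longrightarrow> bform u u > 0) \<longleftrightarrow> pos_def P"
    unfolding pos_def_def graph_def by (auto simp: bform_graph zero_prod_def)
  then show ?thesis unfolding positive_subspaces_def using dim_graph[of P] by blast
qed

lemma positive_subspace_graph:
  fixes Q :: "((real^'k::finite) \<times> (real^'k)) set"
  assumes "Q \<in> positive_subspaces"
  obtains N where "Q = graph N"
proof -
  have Q: "subspace Q" "dim Q = CARD('k)" "\<And>u. u \<in> Q \<Longrightarrow> u \<noteq> 0 \<Longrightarrow> bform u u > 0"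
    using assms by (auto simp: positive_subspaces_def)
  have zero: "y = 0" if "(0, y) \<in> Q" for y
    using Q(3)[OF that] by (auto simp: bform_def zero_prod_def)
  have uniq: "y = y'" if "(x, y) \<in> Q" "(x, y') \<in> Q" for x y y'
    using zero[of "y - y'"] subspace_diff[OF Q(1) that] by simp
  have inj: "inj_on fst Q" by (auto simp: inj_on_def intro: uniq)
  have "dim (fst ` Q) = dim Q"
    by (rule dim_image_eq[OF linear_fst]) (simp add: inj span_eq_iff[THEN iffD2, OF Q(1)])
  then have "fst ` Q = UNIV"
    using Q(2) dim_eq_full[of "fst ` Q"] linear_subspace_image[OF linear_fst Q(1)] by (simp add: span_eq_iff[THEN iffD2])
  then have "\<forall>x. \<exists>y. (x, y) \<in> Q" by (metis UNIV_I imageE prod.collapse)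
  then obtain F where F: "\<And>x. (x, F x) \<in> Q" by metis
  have "linear F"
  proof (rule linearI)
    show "F (x + y) = F x + F y" for x y
      using uniq[OF F[of "x + y"]] subspace_add[OF Q(1) F[of x] F[of y]] by simp
    show "F (r *\<^sub>R x) = r *\<^sub>R F x" for r x
      using uniq[OF F[of "r *\<^sub>R x"]] subspace_scale[OF Q(1) F[of x], of r] by simp
  qed
  then have "matrix F *v x = F x" for x by (simp add: matrix_works)
  then have "Q = graph (matrix F)" unfolding graph_def using F uniq by auto
  then show ?thesis by (rule that)
qed

lemma chart_inv_graph_chart:
  assumes "pos_def P"
  shows "chart_inv graph_chart P = graph P"
proof -
  have "inv_into positive_subspaces (snd graph_chart) (snd graph_chart (graph P)) = graph P"
  proof (rule inv_into_f_f)
    show "inj_on (snd graph_chart) positive_subspaces"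
      by (rule inj_onI) (metis positive_subspace_graph snd_graph_chart)
    show "graph P \<in> positive_subspaces" using assms by (simp add: graph_in_positive_subspaces)
  qed
  then show ?thesis by (simp add: chart_inv_def snd_graph_chart) (simp add: graph_chart_def)
qed

lemma local_killing_metric:
  fixes P :: "real^'k::finite^'k"
  assumes "pos_def P" "CARD('k) \<ge> 2"
  shows "local_form killing_metric graph_chart P v w = (real CARD('k) - 1) *
    trace (matrix_inv (sym_part P) ** v ** matrix_inv (sym_part P) ** transpose w)"
  unfolding local_form_def chart_inv_graph_chart[OF assms(1)]
  by (rule killing_metric_graph[OF pos_def_det_sym_part[OF assms(1)] assms(2)])

section \<open>Levi-Civita connection of the Killing metric at symmetric matrices\<close>

lemma bounded_linear_sym_part: "bounded_linear (sym_part :: real^'k::finite^'k \<Rightarrow> _)"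
  unfolding sym_part_def
  by (intro bounded_linear_const_scaleR bounded_linear_add bounded_linear_ident bounded_linear_transpose)

lemma bounded_linear_trace: "bounded_linear (trace :: real^'k::finite^'k \<Rightarrow> real)"
  by (rule linear_conv_bounded_linear[THEN iffD1])
     (auto simp: linear_iff trace_def sum.distrib sum_distrib_left)

text \<open>The base point enters the metric only through the inverse of its symmetric part, so a
  direction \<open>u\<close> acts only through \<open>sym_part u\<close>. All three vectors stay
  arbitrary because the Koszul formula also differentiates in the direction of its test
  vector.\<close>

lemma frechet_derivative_local_killing_metric:
  fixes P :: "real^'k::finite^'k"
  assumes P: "pos_def P" "transpose P = P" and card: "CARD('k) \<ge> 2"
  defines "T \<equiv> matrix_inv P"
  shows "frechet_derivative (\<lambda>y. local_form killing_metric graph_chart y v w) (at P) u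
    = - (real CARD('k) - 1) * (trace (T ** sym_part u ** T ** v ** T ** transpose w)
        + trace (T ** v ** T ** sym_part u ** T ** transpose w))"
proof -
  have sP: "sym_part P = P" using P(2) by (simp add: sym_part_def scaleR_2[symmetric])
  define g where "g Q = matrix_inv (sym_part Q)" for Q :: "real^'k^'k"
  have g: "(g has_derivative (\<lambda>u. - (T ** sym_part u ** T))) (at P)"
    unfolding g_def[abs_def] T_def
    using has_derivative_compose[OF bounded_linear_imp_has_derivative[OF bounded_linear_sym_part],
        of matrix_inv "\<lambda>u. - (matrix_inv P ** u ** matrix_inv P)" P UNIV, unfolded sP]
      has_derivative_matrix_inv[OF pos_def_det[OF P(1)]] by simp
  note mm = bounded_bilinear.FDERIV[OF bounded_bilinear_matrix_mult]
  have gP: "g P = T" by (simp add: g_def T_def sP)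
  have "((\<lambda>Q. (real CARD('k) - 1) * trace (g Q ** v ** g Q ** transpose w)) has_derivative
      (\<lambda>u. (real CARD('k) - 1) * trace ((g P ** v ** g P) ** 0 + (g P ** v ** (- (T ** sym_part u ** T)) +
         (g P ** 0 + (- (T ** sym_part u ** T)) ** v) ** g P) ** transpose w))) (at P)"
    by (intro has_derivative_mult_right bounded_linear.has_derivative[OF bounded_linear_trace] mm g has_derivative_const)
  then have D: "((\<lambda>y. local_form killing_metric graph_chart y v w) has_derivative
      (\<lambda>u. (real CARD('k) - 1) * trace ((g P ** v ** g P) ** 0 + (g P ** v ** (- (T ** sym_part u ** T)) +
         (g P ** 0 + (- (T ** sym_part u ** T)) ** v) ** g P) ** transpose w))) (at P)"
    by (rule has_derivative_transform_within_open[OF _ open_pos_def])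
       (use P in \<open>auto simp: local_killing_metric[OF _ card] g_def\<close>)
  show ?thesis
    unfolding frechet_derivative_at[OF D, symmetric] gP matrix_mult_simps matrix_mul_assoc
      trace_add trace_minus trace_sub add_0_left
    by (simp add: matrix_mult_simps trace_add trace_minus trace_sub) (simp add: algebra_simps)
qed

text \<open>The Koszul formula contains each of the two cyclic trace terms twice with a minus sign
  and once with a plus sign, hence half of each with a minus sign in the end. The result is
  symmetric, as expected for the fixed set of the isometry given by transposition.\<close>

lemma christoffel_killing_metric:
  fixes P :: "real^'k::finite^'k"
  assumes P: "pos_def P" "transpose P = P" and card: "CARD('k) \<ge> 2"
    and u: "transpose u = u" and v: "transpose v = v"
  shows "christoffel (local_form killing_metric graph_chart) P u v
    = - (1/2) *\<^sub>R (u ** matrix_inv P ** v + v ** matrix_inv P ** u)"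
proof -
  let ?T = "matrix_inv P"
  let ?z = "- (1/2) *\<^sub>R (u ** ?T ** v + v ** ?T ** u)"
  let ?M = "?T ** u ** ?T ** v ** ?T + ?T ** v ** ?T ** u ** ?T"
  let ?k = "real CARD('k) - 1"
  let ?G = "local_form killing_metric graph_chart"
  have TP: "?T ** P = mat 1" "P ** ?T = mat 1" using matrix_inv_mult pos_def_det[OF P(1)] by auto
  have tT: "transpose ?T = ?T"
    by (metis TP P(2) matrix_transpose_mul matrix_mul_assoc matrix_mul_lid matrix_mul_rid transpose_mat)
  have sP: "sym_part P = P" "sym_part u = u" "sym_part v = v"
    using P(2) u v by (simp_all add: sym_part_def scaleR_2[symmetric])
  have G: "?G P a w = ?k * trace (?T ** a ** ?T ** transpose w)" for a w
    using local_killing_metric[OF P(1) card] by (simp add: sP)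
  note D = frechet_derivative_local_killing_metric[OF P card]
  have tM: "transpose ?M = ?M"
    by (simp add: transpose_simps matrix_transpose_mul tT u v matrix_mul_assoc)
  \<comment> \<open>Since \<open>?M\<close> is symmetric, the skew part of \<open>w\<close> does not
    see it; so the derivative in direction \<open>w\<close> has the same shape as the other two
    terms.\<close>
  have "trace (?M ** sym_part w) = trace (?M ** transpose w)" for w
  proof -
    have "trace (?M ** w) = trace (transpose (?M ** w))" by (rule trace_transpose[symmetric])
    also have "\<dots> = trace (?M ** transpose w)"
      unfolding matrix_transpose_mul[of ?M] tM by (rule trace_mul_sym)
    finally show ?thesis by (simp add: sym_part_def matrix_mult_simps trace_scaleR trace_add)
  qed
  then have M: "trace (?T ** u ** ?T ** v ** ?T ** sym_part w) + trace (?T ** v ** ?T ** u ** ?T ** sym_part w)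
     = trace (?T ** u ** ?T ** v ** ?T ** transpose w) + trace (?T ** v ** ?T ** u ** ?T ** transpose w)" for w
    by (simp add: matrix_mult_simps trace_add)
  have c1: "trace (?T ** sym_part w ** ?T ** u ** ?T ** v) = trace (?T ** u ** ?T ** v ** ?T ** sym_part w)" for w
    using trace_mul_sym[of "?T ** sym_part w" "?T ** u ** ?T ** v"] by (simp only: matrix_mul_assoc)
  have c2: "trace (?T ** u ** ?T ** sym_part w ** ?T ** v) = trace (?T ** v ** ?T ** u ** ?T ** sym_part w)" for w
    using trace_mul_sym[of "?T ** u ** ?T ** sym_part w" "?T ** v"] by (simp only: matrix_mul_assoc)
  have koszul: "(frechet_derivative (\<lambda>y. ?G y v w) (at P) u + frechet_derivative (\<lambda>y. ?G y u w) (at P) v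
      - frechet_derivative (\<lambda>y. ?G y u v) (at P) w) / 2 = ?G P ?z w" for w
  proof -
    have "(frechet_derivative (\<lambda>y. ?G y v w) (at P) u + frechet_derivative (\<lambda>y. ?G y u w) (at P) v
      - frechet_derivative (\<lambda>y. ?G y u v) (at P) w) / 2
      = - ?k * (trace (?T ** u ** ?T ** v ** ?T ** transpose w) + trace (?T ** v ** ?T ** u ** ?T ** transpose w)) / 2"
      unfolding D sP v c1 c2 using M[of w] by (simp add: algebra_simps)
    also have "\<dots> = ?G P ?z w"
      unfolding G by (simp add: matrix_mult_simps trace_scaleR trace_minus trace_add trace_sub matrix_mul_assoc field_simps)
    finally show ?thesis .
  qed
  show ?thesis
    unfolding christoffel_def koszul
  proof (rule the_equality)
    fix z assume z: "\<forall>w. ?G P z w = ?G P ?z w"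
    \<comment> \<open>After cancelling the nonzero factor \<open>?k\<close>, equality of all metric
      pairings is equality of all Frobenius inner products.\<close>
    have "(?T ** z ** ?T) \<bullet> w = (?T ** ?z ** ?T) \<bullet> w" for w
      using z card unfolding G trace_mult_transpose by auto
    then have "?T ** z ** ?T = ?T ** ?z ** ?T" using vector_eq_rdot by blast
    then have "P ** (?T ** z ** ?T) ** P = P ** (?T ** ?z ** ?T) ** P" by (rule arg_cong)
    moreover have "P ** (?T ** d ** ?T) ** P = d" for d
      by (metis TP matrix_mul_assoc matrix_mul_lid matrix_mul_rid)
    ultimately show "z = ?z" by metis
  qed simp
qed

section \<open>The Blaschke lift in a chart\<close>

text \<open>The direction is the first argument and the point the last, so that
  \<open>dird u f\<close> is again a function and second derivatives are iterated
  applications.\<close>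

definition dird :: "'a::euclidean_space \<Rightarrow> ('a \<Rightarrow> 'b::euclidean_space) \<Rightarrow> 'a \<Rightarrow> 'b" where
  "dird u f x = frechet_derivative f (at x) u"

lemma dird_eqI: "(f has_derivative f') (at x) \<Longrightarrow> dird u f x = f' u"
  unfolding dird_def using frechet_derivative_at by metis

lemma dird_const [simp]: "dird u (\<lambda>y. c) x = 0"
  by (simp add: dird_def)

lemma smooth_on_has_derivative: "smooth_on V f \<Longrightarrow> x \<in> V \<Longrightarrow> (f has_derivative (\<lambda>u. dird u f x)) (at x)"
  unfolding smooth_on_def dird_def using Ck_on_SucE by blast

lemma smooth_on_dird: "smooth_on V f \<Longrightarrow> smooth_on V (dird u f)"
  unfolding smooth_on_def dird_def[abs_def] using Ck_on.simps(2) by blast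

lemma linear_dird: "smooth_on V f \<Longrightarrow> x \<in> V \<Longrightarrow> linear (\<lambda>u. dird u f x)"
  using has_derivative_linear smooth_on_has_derivative by blast

lemma smooth_on_cong: "open V \<Longrightarrow> (\<And>x. x \<in> V \<Longrightarrow> f x = g x) \<Longrightarrow> smooth_on V f \<Longrightarrow> smooth_on V g"
  unfolding smooth_on_def using Ck_on_cong by metis

lemma smooth_on_bilinear:
  "open V \<Longrightarrow> bounded_bilinear B \<Longrightarrow> smooth_on V f \<Longrightarrow> smooth_on V g \<Longrightarrow> smooth_on V (\<lambda>x. B (f x) (g x))"
  unfolding smooth_on_def by (simp add: Ck_on_bilinear)

lemma smooth_on_linear: "open V \<Longrightarrow> bounded_linear L \<Longrightarrow> smooth_on V f \<Longrightarrow> smooth_on V (\<lambda>x. L (f x))"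
  unfolding smooth_on_def by (simp add: Ck_on_linear)

lemma dird_cong:
  assumes "open V" "x \<in> V" "smooth_on V f" "\<And>y. y \<in> V \<Longrightarrow> f y = g y"
  shows "dird u f x = dird u g x"
  using dird_eqI[OF has_derivative_transform_within_open[OF smooth_on_has_derivative[OF assms(3,2)] assms(1,2)]] assms(4)
  by metis

lemma dird_bilinear:
  assumes "bounded_bilinear B" "smooth_on V f" "smooth_on V g" "x \<in> V"
  shows "dird u (\<lambda>y. B (f y) (g y)) x = B (f x) (dird u g x) + B (dird u f x) (g x)"
  by (rule dird_eqI[OF bounded_bilinear.FDERIV[OF assms(1)]]) (use assms smooth_on_has_derivative in blast)+

lemma dird_linear:
  assumes "bounded_linear L" "smooth_on V f" "x \<in> V"
  shows "dird u (\<lambda>y. L (f y)) x = L (dird u f x)"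
  by (rule dird_eqI[OF bounded_linear.has_derivative[OF assms(1) smooth_on_has_derivative[OF assms(2,3)]]])

lemma dird_commute:
  assumes "open V" "smooth_on V f" "x \<in> V"
  shows "dird u (dird v f) x = dird v (dird u f) x"
  unfolding dird_def[abs_def] using symmetric_second_derivative[OF assms(1,3)] assms(2)
  unfolding smooth_on_def by blast

lemma dird_sum:
  assumes "\<And>i. i \<in> I \<Longrightarrow> smooth_on V (f i)" "x \<in> V"
  shows "dird u (\<lambda>y. \<Sum>i\<in>I. f i y) x = (\<Sum>i\<in>I. dird u (f i) x)"
  by (rule dird_eqI[OF has_derivative_sum]) (use assms smooth_on_has_derivative in blast)

lemmas dird_mv = dird_bilinear[OF bounded_bilinear_matrix_vector_mult]
lemmas dird_inner = dird_bilinear[OF bounded_bilinear_inner]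
lemmas dird_scaleR = dird_bilinear[OF bounded_bilinear_scaleR]

locale blaschke_chart =
  fixes V :: "(real^'n::finite) set" and F :: "real^'n \<Rightarrow> real^'k::finite"
    and Q :: "real^'n \<Rightarrow> real^'k^'k" and h :: "real^'n \<Rightarrow> real^'n \<Rightarrow> real^'n \<Rightarrow> real"
  assumes V: "open V" and smooth_F: "smooth_on V F" and smooth_Q: "smooth_on V Q"
    and sym: "\<And>x. x \<in> V \<Longrightarrow> transpose (Q x) = Q x"
    and detQ: "\<And>x. x \<in> V \<Longrightarrow> det (Q x) = 1"
    and h_pos: "\<And>x v. x \<in> V \<Longrightarrow> v \<noteq> 0 \<Longrightarrow> h x v v > 0"
    and Q_tangent: "\<And>x v w. x \<in> V \<Longrightarrow> dird v F x \<bullet> (Q x *v dird w F x) = h x v w"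
    and Q_normal: "\<And>x v. x \<in> V \<Longrightarrow> F x \<bullet> (Q x *v dird v F x) = 0"
    and Q_position: "\<And>x. x \<in> V \<Longrightarrow> F x \<bullet> (Q x *v F x) = 1"
    and Q_second: "\<And>x v w. x \<in> V \<Longrightarrow> dird v (dird w F) x \<bullet> (Q x *v F x) = h x v w"
    and spanning: "\<And>x y. x \<in> V \<Longrightarrow> \<exists>v c. y = dird v F x + c *\<^sub>R F x"
begin

lemma smooth:
  "smooth_on V (dird u F)" "smooth_on V (dird u Q)" "smooth_on V (dird u (dird v F))" "smooth_on V (dird u (dird v Q))"
  by (intro smooth_on_dird smooth_F smooth_Q)+

lemma smooth_mv: "smooth_on V A \<Longrightarrow> smooth_on V f \<Longrightarrow> smooth_on V (\<lambda>x. (A x :: real^'k^'k) *v f x)"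
  by (rule smooth_on_bilinear[OF V bounded_bilinear_matrix_vector_mult])

lemma smooth_inner: "smooth_on V f \<Longrightarrow> smooth_on V g \<Longrightarrow> smooth_on V (\<lambda>x. (f x :: real^'k) \<bullet> g x)"
  by (rule smooth_on_bilinear[OF V bounded_bilinear_inner])

lemma eq_zeroI:
  assumes "x \<in> V" "z \<bullet> F x = 0" "\<And>v. z \<bullet> dird v F x = 0"
  shows "z = 0"
proof -
  obtain v c where "z = dird v F x + c *\<^sub>R F x" using spanning[OF assms(1)] by blast
  then have "z \<bullet> z = 0" using assms(2,3) by (metis add_0_right inner_add_right inner_scaleR_right mult_zero_right)
  then show ?thesis by simp
qed

lemma inner_Q: "x \<in> V \<Longrightarrow> (Q x *v y) \<bullet> z = y \<bullet> (Q x *v z)"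
  using inner_matrix_left[of "Q x" y z] sym by simp

lemma transpose_dQ:
  assumes x: "x \<in> V"
  shows "transpose (dird u Q x) = dird u Q x"
proof -
  have "transpose (dird u Q x) = dird u (\<lambda>y. transpose (Q y)) x"
    by (rule dird_linear[OF bounded_linear_transpose smooth_Q x, symmetric])
  also have "\<dots> = dird u Q x"
    by (rule dird_cong[OF V x smooth_on_linear[OF V bounded_linear_transpose smooth_Q]]) (rule sym)
  finally show ?thesis .
qed

lemma inner_dQ: "x \<in> V \<Longrightarrow> (dird u Q x *v y) \<bullet> z = y \<bullet> (dird u Q x *v z)"
  using inner_matrix_left[of "dird u Q x" y z] transpose_dQ by simp

text \<open>This says that \<open>Q F\<close> is the conormal \<open>\<nu>\<close> and \<open>Q \<partial>\<^sub>u F = - \<partial>\<^sub>u \<nu>\<close>; everything below is obtained by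
  differentiating it.\<close>

lemma dQ_F:
  assumes x: "x \<in> V"
  shows "dird u Q x *v F x = - 2 *\<^sub>R (Q x *v dird u F x)"
proof -
  let ?a = "dird u Q x *v F x + 2 *\<^sub>R (Q x *v dird u F x)"
  have "dird u (\<lambda>y. F y \<bullet> (Q y *v F y)) x = 0"
    using dird_cong[OF V x smooth_inner[OF smooth_F smooth_mv[OF smooth_Q smooth_F]] Q_position, of u] by simp
  then have "F x \<bullet> (dird u Q x *v F x) = 0"
    unfolding dird_inner[OF smooth_F smooth_mv[OF smooth_Q smooth_F] x] dird_mv[OF smooth_Q smooth_F x]
    using Q_normal[OF x, of u] inner_Q[OF x, of "F x" "dird u F x"]
    by (simp add: inner_right_distrib inner_commute)
  then have 1: "?a \<bullet> F x = 0"
    using Q_normal[OF x, of u] by (simp add: inner_left_distrib inner_right_distrib inner_commute)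
  have 2: "?a \<bullet> dird w F x = 0" for w
  proof -
    have "dird u (\<lambda>y. F y \<bullet> (Q y *v dird w F y)) x = 0"
      using dird_cong[OF V x smooth_inner[OF smooth_F smooth_mv[OF smooth_Q smooth(1)]] Q_normal, of u w] by simp
    then have "F x \<bullet> (Q x *v dird u (dird w F) x) + F x \<bullet> (dird u Q x *v dird w F x) + h x u w = 0"
      unfolding dird_inner[OF smooth_F smooth_mv[OF smooth_Q smooth(1)] x] dird_mv[OF smooth_Q smooth(1) x]
      using Q_tangent[OF x] by (simp add: inner_right_distrib)
    moreover have "F x \<bullet> (Q x *v dird u (dird w F) x) = h x u w"
      using Q_second[OF x, of u w] inner_Q[OF x, of "F x"] by (simp add: inner_commute)
    moreover have "F x \<bullet> (dird u Q x *v dird w F x) = (dird u Q x *v F x) \<bullet> dird w F x"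
      by (rule inner_dQ[OF x, symmetric])
    moreover have "(Q x *v dird u F x) \<bullet> dird w F x = h x u w"
      using inner_Q[OF x] Q_tangent[OF x] by simp
    ultimately show ?thesis by (simp add: inner_left_distrib)
  qed
  have "?a = 0" by (rule eq_zeroI[OF x 1 2])
  then show ?thesis by (simp add: eq_neg_iff_add_eq_0)
qed

lemma ddQ_F:
  assumes x: "x \<in> V"
  shows "dird w (dird u Q) x *v F x + dird u Q x *v dird w F x
       = - 2 *\<^sub>R (dird w Q x *v dird u F x + Q x *v dird w (dird u F) x)"
proof -
  have "dird w (\<lambda>y. dird u Q y *v F y) x = dird w (\<lambda>y. - 2 *\<^sub>R (Q y *v dird u F y)) x"
    by (rule dird_cong[OF V x smooth_mv[OF smooth(2) smooth_F]]) (rule dQ_F)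
  also have "\<dots> = - 2 *\<^sub>R dird w (\<lambda>y. Q y *v dird u F y) x"
    by (rule dird_linear[OF bounded_linear_scaleR_right smooth_mv[OF smooth_Q smooth(1)] x])
  finally show ?thesis
    unfolding dird_mv[OF smooth(2) smooth_F x] dird_mv[OF smooth_Q smooth(1) x] by (simp add: add_ac)
qed

text \<open>Exchanging the two directions in \<open>ddQ_F\<close> leaves the second derivatives
  unchanged and swaps the two mixed products, which carry the coefficients 1 and - 2.\<close>

lemma dQ_dF_commute:
  assumes x: "x \<in> V"
  shows "dird u Q x *v dird w F x = dird w Q x *v dird u F x"
proof -
  have "dird w (dird u Q) x = dird u (dird w Q) x" "dird w (dird u F) x = dird u (dird w F) x"
    by (rule dird_commute[OF V _ x], rule smooth_Q smooth_F)+
  \<comment> \<open>Subtracting the two relations gives a - b = 2 (a - b).\<close>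
  moreover have "a = b" if "s + a = - 2 *\<^sub>R (b + t)" "s + b = - 2 *\<^sub>R (a + t)" for a b s t :: "real^'k"
  proof -
    have "a - b = (s + a) - (s + b)" by simp
    also have "\<dots> = 2 *\<^sub>R (a - b)" unfolding that by (simp add: algebra_simps)
    finally show ?thesis by (simp add: scaleR_2)
  qed
  ultimately show ?thesis using ddQ_F[OF x, of w u] ddQ_F[OF x, of u w] by metis
qed

text \<open>In \<open>hess_Fd\<close> this exchanges an index of the Hessian with that of the
  tangent vector it is applied to.\<close>

lemma ddQ_dF:
  assumes x: "x \<in> V"
  shows "dird w (dird u Q) x *v dird v F x + dird u Q x *v dird w (dird v F) x
       = dird w (dird v Q) x *v dird u F x + dird v Q x *v dird w (dird u F) x"
proof -
  have "dird w (\<lambda>y. dird u Q y *v dird v F y) x = dird w (\<lambda>y. dird v Q y *v dird u F y) x"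
    by (rule dird_cong[OF V x smooth_mv[OF smooth(2) smooth(1)]]) (rule dQ_dF_commute)
  then show ?thesis
    unfolding dird_mv[OF smooth(2) smooth(1) x] by (simp add: add_ac)
qed

abbreviation Gam :: "real^'n \<Rightarrow> real^'n \<Rightarrow> real^'n \<Rightarrow> real^'n" where
  "Gam x u v \<equiv> christoffel h x u v"

lemma dird_h:
  assumes x: "x \<in> V"
  shows "frechet_derivative (\<lambda>y. h y v w) (at x) u = dird u (dird v F) x \<bullet> (Q x *v dird w F x)
    + dird v F x \<bullet> (dird u Q x *v dird w F x) + dird v F x \<bullet> (Q x *v dird u (dird w F) x)"
proof -
  have "dird u (\<lambda>y. dird v F y \<bullet> (Q y *v dird w F y)) x = dird u (\<lambda>y. h y v w) x"
    by (rule dird_cong[OF V x smooth_inner[OF smooth(1) smooth_mv[OF smooth_Q smooth(1)]]]) (rule Q_tangent)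
  then show ?thesis
    unfolding dird_inner[OF smooth(1) smooth_mv[OF smooth_Q smooth(1)] x] dird_mv[OF smooth_Q smooth(1) x]
    by (simp add: dird_def inner_right_distrib)
qed

lemma Q_inverse:
  assumes "x \<in> V"
  shows "Q x ** matrix_inv (Q x) = mat 1" "matrix_inv (Q x) ** Q x = mat 1"
  using matrix_inv_mult[of "Q x"] detQ[OF assms] by auto

lemma h_eq:
  assumes x: "x \<in> V"
  shows "h x v w = (Q x *v dird v F x) \<bullet> dird w F x"
  using Q_tangent[OF x, of v w] inner_Q[OF x] by simp

text \<open>Subtracting the two sides from \<open>Q\<close> times the second derivative of
  \<open>F\<close> exhibits half the cubic form as the difference between the Levi-Civita and the
  affine connection. The right-hand side is first shown to be \<open>Q\<close> of a tangent vector,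
  which is then identified by the Koszul formula.\<close>

lemma Q_christoffel:
  assumes x: "x \<in> V"
  shows "Q x *v dird (Gam x u v) F x = (1/2) *\<^sub>R (dird u Q x *v dird v F x) + Q x *v dird u (dird v F) x"
proof -
  let ?z = "(1/2) *\<^sub>R (dird u Q x *v dird v F x) + Q x *v dird u (dird v F) x"
  \<comment> \<open>The pairing of \<open>?z\<close> with \<open>F\<close> is - h + h = 0, so the
    component \<open>c\<close> along \<open>F\<close> vanishes.\<close>
  obtain t c where tc: "matrix_inv (Q x) *v ?z = dird t F x + c *\<^sub>R F x" using spanning[OF x] by blast
  have zt: "?z = Q x *v dird t F x + c *\<^sub>R (Q x *v F x)"
  proof -
    have "?z = Q x *v (matrix_inv (Q x) *v ?z)"
      unfolding matrix_vector_mul_assoc Q_inverse[OF x] by simp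
    then show ?thesis unfolding tc by (simp add: matrix_vector_simps)
  qed
  have "(dird u Q x *v dird v F x) \<bullet> F x = - 2 * h x u v"
    using inner_dQ[OF x, of u "dird v F x" "F x"] Q_tangent[OF x, of v u] h_eq[OF x, of u v]
    by (simp add: dQ_F[OF x] inner_commute matrix_vector_simps)
  moreover have "(Q x *v dird u (dird v F) x) \<bullet> F x = h x u v"
    using Q_second[OF x, of u v] inner_Q[OF x] by simp
  ultimately have "?z \<bullet> F x = 0" by (simp add: inner_left_distrib)
  moreover have "(Q x *v dird t F x) \<bullet> F x = 0" "(Q x *v F x) \<bullet> F x = 1"
    using Q_normal[OF x, of t] Q_position[OF x] by (simp_all add: inner_commute)
  ultimately have "c = 0" unfolding zt by (simp add: inner_left_distrib)
  with zt have zt: "?z = Q x *v dird t F x" by simp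
  have koszul: "(frechet_derivative (\<lambda>y. h y v w) (at x) u
              + frechet_derivative (\<lambda>y. h y u w) (at x) v
              - frechet_derivative (\<lambda>y. h y u v) (at x) w) / 2 = h x t w" for w
  proof -
    have s: "dird a (dird b F) x = dird b (dird a F) x" for a b
      by (rule dird_commute[OF V smooth_F x])
    \<comment> \<open>By total symmetry the derivative of \<open>Q\<close> contributes the same
      cubic term to all three Koszul summands; with signs +, +, - and the division by 2, one half of
      it remains.\<close>
    have q: "dird a F x \<bullet> (dird b Q x *v dird c F x) = (dird u Q x *v dird v F x) \<bullet> dird w F x"
      if "(a, b, c) \<in> {(v, u, w), (u, v, w), (u, w, v)}" for a b c
    proof -
      have "dird v F x \<bullet> (dird u Q x *v dird w F x) = (dird u Q x *v dird v F x) \<bullet> dird w F x"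
        by (rule inner_dQ[OF x, symmetric])
      moreover have "dird u F x \<bullet> (dird v Q x *v dird w F x) = (dird v Q x *v dird u F x) \<bullet> dird w F x"
        by (rule inner_dQ[OF x, symmetric])
      moreover have "dird v Q x *v dird u F x = dird u Q x *v dird v F x" by (rule dQ_dF_commute[OF x])
      moreover have "dird w Q x *v dird v F x = dird v Q x *v dird w F x" by (rule dQ_dF_commute[OF x])
      ultimately show ?thesis using that by auto
    qed
    have p: "dird a F x \<bullet> (Q x *v y) = (Q x *v y) \<bullet> dird a F x" for a y by (rule inner_commute)
    have p': "y \<bullet> (Q x *v dird a F x) = (Q x *v y) \<bullet> dird a F x" for a y by (rule inner_Q[OF x, symmetric])
    have "h x t w = (1/2) * ((dird u Q x *v dird v F x) \<bullet> dird w F x) + (Q x *v dird u (dird v F) x) \<bullet> dird w F x"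
      unfolding h_eq[OF x] zt[symmetric] by (simp add: inner_left_distrib)
    moreover have "frechet_derivative (\<lambda>y. h y v w) (at x) u = (Q x *v dird u (dird v F) x) \<bullet> dird w F x
        + (dird u Q x *v dird v F x) \<bullet> dird w F x + (Q x *v dird u (dird w F) x) \<bullet> dird v F x"
      unfolding dird_h[OF x] using q[of v u w] p p' by simp
    moreover have "frechet_derivative (\<lambda>y. h y u w) (at x) v = (Q x *v dird u (dird v F) x) \<bullet> dird w F x
        + (dird u Q x *v dird v F x) \<bullet> dird w F x + (Q x *v dird v (dird w F) x) \<bullet> dird u F x"
      unfolding dird_h[OF x] using q[of u v w] p p' s[of u v] by simp
    moreover have "frechet_derivative (\<lambda>y. h y u v) (at x) w = (Q x *v dird u (dird w F) x) \<bullet> dird v F x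
        + (dird u Q x *v dird v F x) \<bullet> dird w F x + (Q x *v dird v (dird w F) x) \<bullet> dird u F x"
      unfolding dird_h[OF x] using q[of u w v] p p' s[of u w] s[of v w] by simp
    ultimately show ?thesis by (simp add: field_simps)
  qed
  have "Gam x u v = t"
    unfolding christoffel_def koszul
  proof (rule the_equality)
    fix z assume z: "\<forall>w. h x z w = h x t w"
    have "h x (z - t) (z - t) = 0"
    proof -
      have "dird (z - t) F x = dird z F x - dird t F x" by (rule linear_diff[OF linear_dird[OF smooth_F x]])
      then have "h x (z - t) w = h x z w - h x t w" for w
        unfolding h_eq[OF x] by (simp add: matrix_vector_simps inner_diff_left)
      then show ?thesis using z by simp
    qed
    then show "z = t" using h_pos[OF x, of "z - t"] by fastforce
  qed simp
  then show ?thesis using zt by simp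
qed

text \<open>Metric compatibility is read off from \<open>Q_christoffel\<close>: the two halves of
  the cubic form add up to the term coming from the derivative of \<open>Q\<close>.\<close>

lemma h_compatible:
  assumes x: "x \<in> V"
  shows "frechet_derivative (\<lambda>y. h y v w) (at x) u = h x (Gam x u v) w + h x v (Gam x u w)"
proof -
  have "h x (Gam x u v) w = (1/2) * ((dird u Q x *v dird v F x) \<bullet> dird w F x) + (Q x *v dird u (dird v F) x) \<bullet> dird w F x"
    unfolding h_eq[OF x] Q_christoffel[OF x] by (simp add: inner_left_distrib)
  moreover have "h x v (Gam x u w) = (1/2) * ((dird u Q x *v dird w F x) \<bullet> dird v F x) + (Q x *v dird u (dird w F) x) \<bullet> dird v F x"
    unfolding Q_tangent[OF x, symmetric] Q_christoffel[OF x] by (simp add: inner_right_distrib inner_commute)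
  ultimately show ?thesis
    unfolding dird_h[OF x] using inner_dQ[OF x, of u "dird v F x" "dird w F x"] inner_Q[OF x, of "dird u (dird v F) x" "dird w F x"]
    by (simp add: inner_commute)
qed

end

section \<open>Traces with respect to h, and apolarity\<close>

lemma smooth_on_sum: "open V \<Longrightarrow> (\<And>i. i \<in> I \<Longrightarrow> smooth_on V (f i)) \<Longrightarrow> smooth_on V (\<lambda>x. \<Sum>i\<in>I. f i x)"
  unfolding smooth_on_def by (simp add: Ck_on_sum)

lemma linear_axis_sum:
  fixes f :: "real^'n::finite \<Rightarrow> 'b::real_vector"
  assumes "linear f"
  shows "f v = (\<Sum>i\<in>UNIV. (v $ i) *\<^sub>R f (axis i 1))"
proof -
  have "v = (\<Sum>i\<in>UNIV. (v $ i) *\<^sub>R axis i 1)"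
    using basis_expansion[of v] by (simp add: scalar_mult_eq_scaleR)
  then have "f v = f (\<Sum>i\<in>UNIV. (v $ i) *\<^sub>R axis i 1)" by simp
  then show ?thesis by (simp add: linear_sum[OF assms] linear_cmul[OF assms])
qed

definition outer :: "real^'k::finite \<Rightarrow> real^'k \<Rightarrow> real^'k^'k" where
  "outer a b = (\<chi> r c. a $ r * b $ c)"

lemma outer_mult: "outer a b *v z = (b \<bullet> z) *\<^sub>R a"
  by (simp add: outer_def matrix_vector_mult_def vec_eq_iff inner_vec_def sum_distrib_left mult_ac)

lemma trace_outer_mult: "trace (outer a b ** M) = b \<bullet> (M *v a)"
proof -
  have "trace (outer a b ** M) = (\<Sum>r\<in>UNIV. \<Sum>c\<in>UNIV. b $ c * (M $ c $ r * a $ r))"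
    by (simp add: outer_def trace_def matrix_matrix_mult_def mult_ac)
  also have "\<dots> = (\<Sum>c\<in>UNIV. \<Sum>r\<in>UNIV. b $ c * (M $ c $ r * a $ r))"
    by (rule sum.swap)
  also have "\<dots> = b \<bullet> (M *v a)"
    by (simp add: matrix_vector_mult_def inner_vec_def sum_distrib_left)
  finally show ?thesis .
qed

lemma matrix_inverse_unique:
  fixes A :: "real^'n::finite^'n"
  shows "L ** A = mat 1 \<Longrightarrow> A ** B = mat 1 \<Longrightarrow> B = L"
  by (metis matrix_mul_assoc matrix_mul_lid matrix_mul_rid)

lemma transpose_matrix_inv:
  fixes A :: "real^'n::finite^'n"
  assumes "transpose A = A" "det A \<noteq> 0"
  shows "transpose (matrix_inv A) = matrix_inv A"
proof -
  note I = matrix_inv_mult[OF assms(2)]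
  have "transpose (matrix_inv A) ** A = mat 1"
    using arg_cong[OF I(1), of transpose] by (simp only: matrix_transpose_mul assms(1) transpose_mat)
  from matrix_inverse_unique[OF this I(1)] show ?thesis by (rule sym)
qed

context blaschke_chart
begin

lemma linear_h:
  assumes "x \<in> V"
  shows "linear (\<lambda>v. h x v w)" "linear (\<lambda>w. h x v w)"
  unfolding Q_tangent[OF assms, symmetric]
  using linear_dird[OF smooth_F assms]
  by (auto simp: linear_iff matrix_vector_simps inner_left_distrib inner_right_distrib)

lemma h_gram:
  assumes "x \<in> V"
  shows "h x v w = v \<bullet> (gram_matrix (h x) *v w)"
proof -
  have "h x v w = (\<Sum>i\<in>UNIV. v $ i * (\<Sum>j\<in>UNIV. w $ j * h x (axis i 1) (axis j 1)))"
    by (subst linear_axis_sum[OF linear_h(1)[OF assms]], subst linear_axis_sum[OF linear_h(2)[OF assms]]) simp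
  then show ?thesis
    by (simp add: gram_matrix_def inner_vec_def matrix_vector_mult_def mult.commute)
qed

lemma h_gram_axis: "x \<in> V \<Longrightarrow> h x (axis i 1) w = (gram_matrix (h x) *v w) $ i"
  by (simp add: h_gram inner_axis')

lemma det_gram: "x \<in> V \<Longrightarrow> det (gram_matrix (h x)) \<noteq> 0"
  by (rule pos_def_det) (auto simp: pos_def_def h_gram[symmetric] h_pos)

lemma h_commute: "x \<in> V \<Longrightarrow> h x v w = h x w v"
  using h_eq[of x v w] Q_tangent[of x w v] by (simp add: inner_commute)

lemma transpose_gram: "x \<in> V \<Longrightarrow> transpose (gram_matrix (h x)) = gram_matrix (h x)"
  by (simp add: gram_matrix_def transpose_def vec_eq_iff h_commute)

abbreviation hinv :: "real^'n \<Rightarrow> real^'n^'n" where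
  "hinv x \<equiv> matrix_inv (gram_matrix (h x))"

lemma hinv_commute: "x \<in> V \<Longrightarrow> hinv x $ i $ j = hinv x $ j $ i"
proof -
  assume x: "x \<in> V"
  have "transpose (hinv x) $ i $ j = hinv x $ i $ j"
    by (simp only: transpose_matrix_inv[OF transpose_gram det_gram] x)
  then show ?thesis by (simp add: transpose_def)
qed

abbreviation Fd :: "'n \<Rightarrow> real^'n \<Rightarrow> real^'k" where "Fd i \<equiv> dird (axis i 1) F"
abbreviation Qd :: "'n \<Rightarrow> real^'n \<Rightarrow> real^'k^'k" where "Qd i \<equiv> dird (axis i 1) Q"
abbreviation ch :: "real^'n \<Rightarrow> 'n \<Rightarrow> 'n \<Rightarrow> real^'n" where "ch x i j \<equiv> Gam x (axis i 1) (axis j 1)"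

text \<open>The vectors \<open>Fd i x\<close> are \<open>Q\<close>-orthogonal to \<open>F x\<close>,
  which has \<open>Q\<close>-length one, and their Gram matrix is that of \<open>h\<close>. The
  inverse of \<open>Q\<close> is therefore the sum of the two inverse Gram forms.\<close>

lemma matrix_inv_Q_expansion:
  assumes x: "x \<in> V"
  shows "matrix_inv (Q x) = (\<Sum>i\<in>UNIV. \<Sum>j\<in>UNIV. (hinv x $ i $ j) *\<^sub>R outer (Fd i x) (Fd j x)) + outer (F x) (F x)"
    (is "_ = ?L")
proof -
  have L: "?L *v z = (\<Sum>i\<in>UNIV. \<Sum>j\<in>UNIV. (hinv x $ i $ j * (Fd j x \<bullet> z)) *\<^sub>R Fd i x) + (F x \<bullet> z) *\<^sub>R F x" for z
    by (simp add: matrix_vector_simps bounded_bilinear.sum_left[OF bounded_bilinear_matrix_vector_mult] outer_mult)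
  have 1: "?L *v (Q x *v F x) = F x"
  proof -
    have "Fd j x \<bullet> (Q x *v F x) = 0" for j
      using Q_normal[OF x, of "axis j 1"] inner_Q[OF x, of "Fd j x" "F x"] by (simp add: inner_commute)
    then show ?thesis unfolding L using Q_position[OF x] by simp
  qed
  have 2: "?L *v (Q x *v dird w F x) = dird w F x" for w
  proof -
    have "?L *v (Q x *v dird w F x) = (\<Sum>i\<in>UNIV. (\<Sum>j\<in>UNIV. hinv x $ i $ j * (gram_matrix (h x) *v w) $ j) *\<^sub>R Fd i x)"
      unfolding L using Q_normal[OF x, of w] Q_tangent[OF x, of _ w] by (simp add: h_gram_axis[OF x] scaleR_sum_left)
    also have "\<dots> = (\<Sum>i\<in>UNIV. (hinv x *v (gram_matrix (h x) *v w)) $ i *\<^sub>R Fd i x)"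
      by (simp add: matrix_vector_mult_def[of "hinv x"])
    also have "hinv x *v (gram_matrix (h x) *v w) = w"
      by (simp add: matrix_vector_mul_assoc matrix_inv_mult det_gram[OF x])
    finally show ?thesis using linear_axis_sum[OF linear_dird[OF smooth_F x], of w] by simp
  qed
  have "(?L ** Q x) *v y = mat 1 *v y" for y
  proof -
    obtain v c where "y = dird v F x + c *\<^sub>R F x" using spanning[OF x] by blast
    then show ?thesis
      unfolding matrix_vector_mul_assoc[symmetric] using 1 2[of v] by (simp add: matrix_vector_simps)
  qed
  then have "?L ** Q x = mat 1" by (simp add: matrix_eq)
  then show ?thesis by (rule matrix_inverse_unique[OF _ Q_inverse(1)[OF x]])
qed

lemma trace_Q_inverse:
  assumes x: "x \<in> V"
  shows "trace (matrix_inv (Q x) ** M) =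
    (\<Sum>i\<in>UNIV. \<Sum>j\<in>UNIV. hinv x $ i $ j * (Fd j x \<bullet> (M *v Fd i x))) + F x \<bullet> (M *v F x)"
  unfolding matrix_inv_Q_expansion[OF x]
  by (simp add: matrix_mult_simps bounded_bilinear.sum_left[OF bounded_bilinear_matrix_mult] trace_add
      linear_sum[OF bounded_linear.linear[OF bounded_linear_trace]] trace_scaleR trace_outer_mult)

text \<open>Jacobi's formula applied to the constant determinant of \<open>Q\<close>.\<close>

lemma trace_dQ:
  assumes x: "x \<in> V"
  shows "trace (matrix_inv (Q x) ** dird u Q x) = 0"
proof -
  have "((\<lambda>y. det (Q y)) has_derivative (\<lambda>u. det (Q x) * trace (matrix_inv (Q x) ** dird u Q x))) (at x)"
    using has_derivative_compose[OF smooth_on_has_derivative[OF smooth_Q x] has_derivative_det] detQ[OF x] by simp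
  moreover have "((\<lambda>y. det (Q y)) has_derivative (\<lambda>u. 0)) (at x)"
    by (rule has_derivative_transform_within_open[OF has_derivative_const[of 1] V x]) (simp add: detQ)
  ultimately have "(\<lambda>u. det (Q x) * trace (matrix_inv (Q x) ** dird u Q x)) = (\<lambda>u. 0)"
    by (rule has_derivative_unique)
  then show ?thesis using detQ[OF x] by (simp add: fun_eq_iff)
qed

text \<open>The apolarity condition: the cubic form is totally symmetric by \<open>dQ_dF_commute\<close>, so
  \<open>det Q = 1\<close> makes all its traces vanish.\<close>

lemma trace_dQ_dF:
  assumes x: "x \<in> V"
  shows "(\<Sum>i\<in>UNIV. \<Sum>j\<in>UNIV. hinv x $ i $ j *\<^sub>R (Qd i x *v Fd j x)) = (- 2 * real CARD('n)) *\<^sub>R (Q x *v F x)"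
proof -
  let ?s = "\<Sum>i\<in>UNIV. \<Sum>j\<in>UNIV. hinv x $ i $ j *\<^sub>R (Qd i x *v Fd j x)"
  let ?a = "?s + (2 * real CARD('n)) *\<^sub>R (Q x *v F x)"
  have "?a \<bullet> F x = 0"
  proof -
    \<comment> \<open>The constant in the statement arises here: each term is - 2 times an entry of
      \<open>h\<close>, and contracting \<open>h\<close> with its inverse gives the
      dimension.\<close>
    have "(Qd i x *v Fd j x) \<bullet> F x = - 2 * gram_matrix (h x) $ j $ i" for i j
      using inner_dQ[OF x, of "axis i 1" "Fd j x" "F x"] Q_tangent[OF x, of "axis j 1" "axis i 1"]
      by (simp add: dQ_F[OF x] gram_matrix_def matrix_vector_simps)
    then have "?s \<bullet> F x = (\<Sum>i\<in>UNIV. \<Sum>j\<in>UNIV. hinv x $ i $ j * (- 2 * gram_matrix (h x) $ j $ i))"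
      by (simp add: inner_sum_left)
    also have "\<dots> = - 2 * trace (hinv x ** gram_matrix (h x))"
      by (simp add: trace_def matrix_matrix_mult_def sum_distrib_left mult_ac sum_negf)
    also have "\<dots> = - 2 * real CARD('n)"
      by (simp add: matrix_inv_mult det_gram[OF x] trace_I)
    finally show ?thesis using Q_position[OF x] by (simp add: inner_left_distrib inner_right_distrib inner_commute)
  qed
  moreover have "?a \<bullet> dird w F x = 0" for w
  proof -
    \<comment> \<open>Total symmetry moves the direction \<open>w\<close> onto \<open>Q\<close>. The
      sum then is the \<open>h\<close>-part of the trace in \<open>trace_dQ\<close>, up to the term
      at \<open>F\<close>, which is zero as well.\<close>
    have "(Qd i x *v Fd j x) \<bullet> dird w F x = Fd j x \<bullet> (dird w Q x *v Fd i x)" for i j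
      using inner_dQ[OF x, of "axis i 1" "Fd j x" "dird w F x"] dQ_dF_commute[OF x, of "axis i 1" w] by simp
    then have "?s \<bullet> dird w F x = (\<Sum>i\<in>UNIV. \<Sum>j\<in>UNIV. hinv x $ i $ j * (Fd j x \<bullet> (dird w Q x *v Fd i x)))"
      by (simp add: inner_sum_left)
    also have "\<dots> = - (F x \<bullet> (dird w Q x *v F x))"
      using trace_Q_inverse[OF x, of "dird w Q x"] trace_dQ[OF x, of w] by simp
    also have "\<dots> = 0" using Q_normal[OF x, of w] by (simp add: dQ_F[OF x] matrix_vector_simps)
    finally show ?thesis
      using Q_normal[OF x, of w] inner_Q[OF x, of "F x"] by (simp add: inner_left_distrib)
  qed
  ultimately have "?a = 0" by (rule eq_zeroI[OF x])
  then show ?thesis by (simp add: eq_neg_iff_add_eq_0)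
qed

lemma smooth_h: "smooth_on V (\<lambda>x. h x v w)"
  by (rule smooth_on_cong[OF V _ smooth_inner[OF smooth(1) smooth_mv[OF smooth_Q smooth(1)]]]) (rule Q_tangent)

lemma smooth_gram: "smooth_on V (\<lambda>x. gram_matrix (h x))"
  unfolding smooth_on_def gram_matrix_def
  using smooth_h by (auto intro!: Ck_on_vec[OF V] simp: smooth_on_def)

lemma smooth_hinv: "smooth_on V hinv"
  using smooth_gram det_gram unfolding smooth_on_def by (auto intro!: Ck_on_matrix_inv[OF V])

text \<open>The inverse metric is parallel for the Levi-Civita connection, written in
  coordinates.\<close>

lemma dird_hinv:
  assumes x: "x \<in> V"
  shows "dird (axis k 1) hinv x $ i $ j = - (\<Sum>l\<in>UNIV. hinv x $ i $ l * ch x k l $ j) - (\<Sum>l\<in>UNIV. ch x k l $ i * hinv x $ l $ j)"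
proof -
  let ?H = "gram_matrix (h x)" and ?I = "hinv x"
  let ?dH = "dird (axis k 1) (\<lambda>y. gram_matrix (h y)) x"
  \<comment> \<open>Column \<open>i\<close> of \<open>C\<close> is the Christoffel vector
    \<open>ch x k i\<close>; compatibility then reads dH = C^T H + H C.\<close>
  define C where "C = (\<chi> l i. ch x k i $ l)"
  have I: "?I ** ?H = mat 1" "?H ** ?I = mat 1" using matrix_inv_mult det_gram[OF x] by auto
  have "?dH $ i $ j = (transpose C ** ?H + ?H ** C) $ i $ j" for i j
  proof -
    have "?dH $ i $ j = dird (axis k 1) (\<lambda>y. gram_matrix (h y) $ i $ j) x"
      using dird_linear[OF bounded_linear_compose[OF bounded_linear_vec_nth[of j] bounded_linear_vec_nth[of i]] smooth_gram x]
      by simp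
    also have "\<dots> = h x (ch x k i) (axis j 1) + h x (axis i 1) (ch x k j)"
      unfolding gram_matrix_def dird_def by (simp add: h_compatible[OF x])
    also have "h x (axis i 1) (ch x k j) = (?H ** C) $ i $ j"
      unfolding h_gram_axis[OF x] by (simp add: matrix_vector_mult_def matrix_matrix_mult_def C_def)
    also have "h x (ch x k i) (axis j 1) = (transpose C ** ?H) $ i $ j"
    proof -
      have "h x (ch x k i) (axis j 1) = ch x k i \<bullet> (?H *v axis j 1)" by (rule h_gram[OF x])
      also have "?H *v axis j 1 = column j ?H" by (rule matrix_vector_mult_basis)
      also have "ch x k i \<bullet> column j ?H = (transpose C ** ?H) $ i $ j"
        by (simp add: inner_vec_def matrix_matrix_mult_def transpose_def C_def column_def)
      finally show ?thesis .
    qed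
    finally show ?thesis by simp
  qed
  then have dH: "?dH = transpose C ** ?H + ?H ** C" by (simp add: vec_eq_iff)
  have "((\<lambda>y. matrix_inv (gram_matrix (h y))) has_derivative
      (\<lambda>u. - (?I ** dird u (\<lambda>y. gram_matrix (h y)) x ** ?I))) (at x)"
    by (rule has_derivative_compose[OF smooth_on_has_derivative[OF smooth_gram x] has_derivative_matrix_inv[OF det_gram[OF x]]])
  then have "dird (axis k 1) hinv x = - (?I ** ?dH ** ?I)" by (rule dird_eqI)
  also have "\<dots> = - (?I ** transpose C) - C ** ?I"
  proof -
    have "?I ** (?H ** C) = C" "(?I ** (transpose C ** ?H)) ** ?I = ?I ** transpose C"
      by (metis I matrix_mul_assoc matrix_mul_lid matrix_mul_rid)+
    then show ?thesis unfolding dH by (simp add: matrix_mult_simps del: transpose_matrix_vector)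
  qed
  finally show ?thesis by (simp add: matrix_matrix_mult_def C_def transpose_def)
qed

lemma dird_trace_dQ_dF:
  assumes x: "x \<in> V"
  shows "(\<Sum>i\<in>UNIV. \<Sum>j\<in>UNIV. hinv x $ i $ j *\<^sub>R (dird (axis k 1) (Qd i) x *v Fd j x + Qd i x *v dird (axis k 1) (Fd j) x))
    = (2 * real CARD('n)) *\<^sub>R (Q x *v Fd k x)
      - (\<Sum>i\<in>UNIV. \<Sum>j\<in>UNIV. dird (axis k 1) hinv x $ i $ j *\<^sub>R (Qd i x *v Fd j x))"
proof -
  let ?k = "axis k 1 :: real^'n"
  have sij: "smooth_on V (\<lambda>y. hinv y $ i $ j)" for i j
    using smooth_on_linear[OF V bounded_linear_compose[OF bounded_linear_vec_nth[of j] bounded_linear_vec_nth[of i]] smooth_hinv] .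
  have dij: "dird ?k (\<lambda>y. hinv y $ i $ j) x = dird ?k hinv x $ i $ j" for i j
    using dird_linear[OF bounded_linear_compose[OF bounded_linear_vec_nth[of j] bounded_linear_vec_nth[of i]] smooth_hinv x] .
  have st: "smooth_on V (\<lambda>y. hinv y $ i $ j *\<^sub>R (Qd i y *v Fd j y))" for i j
    by (rule smooth_on_bilinear[OF V bounded_bilinear_scaleR sij smooth_mv[OF smooth(2) smooth(1)]])
  have ss: "smooth_on V (\<lambda>y. \<Sum>j\<in>UNIV. hinv y $ i $ j *\<^sub>R (Qd i y *v Fd j y))" for i
    by (intro smooth_on_sum[OF V] st)
  have sss: "smooth_on V (\<lambda>y. \<Sum>i\<in>UNIV. \<Sum>j\<in>UNIV. hinv y $ i $ j *\<^sub>R (Qd i y *v Fd j y))"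
    by (intro smooth_on_sum[OF V] ss)
  have "dird ?k (\<lambda>y. \<Sum>i\<in>UNIV. \<Sum>j\<in>UNIV. hinv y $ i $ j *\<^sub>R (Qd i y *v Fd j y)) x
      = dird ?k (\<lambda>y. (- 2 * real CARD('n)) *\<^sub>R (Q y *v F y)) x"
    by (rule dird_cong[OF V x sss]) (rule trace_dQ_dF)
  also have "\<dots> = (- 2 * real CARD('n)) *\<^sub>R (Q x *v Fd k x + Qd k x *v F x)"
    unfolding dird_linear[OF bounded_linear_scaleR_right smooth_mv[OF smooth_Q smooth_F] x] dird_mv[OF smooth_Q smooth_F x] ..
  \<comment> \<open>By \<open>dQ_F\<close> the bracket is \<open>Q\<close> times F_k minus twice
    itself, which reverses the sign of the constant.\<close>
  also have "\<dots> = (2 * real CARD('n)) *\<^sub>R (Q x *v Fd k x)"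
    unfolding dQ_F[OF x] by (simp add: vec_eq_iff algebra_simps)
  also have "dird ?k (\<lambda>y. \<Sum>i\<in>UNIV. \<Sum>j\<in>UNIV. hinv y $ i $ j *\<^sub>R (Qd i y *v Fd j y)) x
     = (\<Sum>i\<in>UNIV. \<Sum>j\<in>UNIV. hinv x $ i $ j *\<^sub>R (Qd i x *v dird ?k (Fd j) x + dird ?k (Qd i) x *v Fd j x)
          + dird ?k hinv x $ i $ j *\<^sub>R (Qd i x *v Fd j x))"
    by (simp only: dird_sum[OF ss x] dird_sum[OF st x] dird_scaleR[OF sij smooth_mv[OF smooth(2) smooth(1)] x]
        dij dird_mv[OF smooth(2) smooth(1) x])
  finally show ?thesis by (simp add: sum.distrib add_ac eq_diff_eq)
qed

section \<open>Vanishing of the traced second fundamental form\<close>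

lemma Gam_commute_F: "x \<in> V \<Longrightarrow> dird (Gam x u v) F x = dird (Gam x v u) F x"
proof -
  assume x: "x \<in> V"
  have "Q x *v dird (Gam x u v) F x = Q x *v dird (Gam x v u) F x"
    unfolding Q_christoffel[OF x] dQ_dF_commute[OF x, of u v] dird_commute[OF V smooth_F x, of u v] ..
  then have "matrix_inv (Q x) *v (Q x *v dird (Gam x u v) F x) = matrix_inv (Q x) *v (Q x *v dird (Gam x v u) F x)" by simp
  then show ?thesis by (simp add: matrix_vector_mul_assoc Q_inverse[OF x])
qed

text \<open>The second fundamental form of \<open>Q\<close> as a map into the graph chart, where the Christoffel
  symbols at symmetric matrices are those of \<open>christoffel_killing_metric\<close>.\<close>

definition hess :: "real^'n \<Rightarrow> 'n \<Rightarrow> 'n \<Rightarrow> real^'k^'k" where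
  "hess x i j = dird (axis i 1) (Qd j) x - dird (ch x i j) Q x
     - (1/2) *\<^sub>R (Qd i x ** matrix_inv (Q x) ** Qd j x + Qd j x ** matrix_inv (Q x) ** Qd i x)"

lemma Q_inverse_mult:
  "x \<in> V \<Longrightarrow> matrix_inv (Q x) *v (Q x *v z) = z"
  "x \<in> V \<Longrightarrow> Q x *v (matrix_inv (Q x) *v z) = z"
  by (simp_all add: matrix_vector_mul_assoc Q_inverse)

lemma dQ_inverse_dQ_F: "x \<in> V \<Longrightarrow> dird u Q x *v (matrix_inv (Q x) *v (dird v Q x *v F x)) = - 2 *\<^sub>R (dird u Q x *v dird v F x)"
  by (simp add: dQ_F matrix_vector_simps Q_inverse_mult)

text \<open>No trace is required here: after \<open>dQ_F\<close> and \<open>Q_christoffel\<close>,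
  every term is a multiple of the second derivative of \<open>F\<close> or of a cubic product, and
  \<open>ddQ_F\<close> relates them.\<close>

lemma hess_F:
  assumes x: "x \<in> V"
  shows "hess x i j *v F x = 0"
proof -
  have "hess x i j *v F x = dird (axis i 1) (Qd j) x *v F x - dird (ch x i j) Q x *v F x
     - (1/2) *\<^sub>R (Qd i x *v (matrix_inv (Q x) *v (Qd j x *v F x)) + Qd j x *v (matrix_inv (Q x) *v (Qd i x *v F x)))"
    by (simp add: hess_def matrix_vector_simps matrix_vector_mul_assoc matrix_mul_assoc)
  also have "\<dots> = 0"
  proof -
    have "a - (- 2 *\<^sub>R ((1/2) *\<^sub>R q + g)) - (1/2) *\<^sub>R (- 2 *\<^sub>R q + - 2 *\<^sub>R q') = 0"
      if "a + q' = - 2 *\<^sub>R (q + g)" "q' = q" for a q q' g :: "real^'k"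
    proof -
      have a: "a = - 2 *\<^sub>R (q + g) - q" using that by (simp only: eq_diff_eq)
      show ?thesis unfolding that(2) a by (simp add: vec_eq_iff)
    qed
    then show ?thesis
      unfolding dQ_inverse_dQ_F[OF x] dQ_F[OF x, of "ch x i j"] Q_christoffel[OF x]
      using ddQ_F[OF x, of "axis i 1" "axis j 1"] dQ_dF_commute[OF x, of "axis j 1" "axis i 1"] by blast
  qed
  finally show ?thesis .
qed

text \<open>The right-hand side is the covariant derivative in direction \<open>k\<close> of the
  tensor \<open>Qd i x *v Fd j x\<close>, minus half of \<open>Qd k x\<close> times the inverse of
  \<open>Q\<close> applied to it. In this form \<open>i\<close> and \<open>j\<close> can be
  contracted by apolarity; the last Christoffel term acts on the index \<open>i\<close> by total
  symmetry.\<close>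

lemma hess_Fd:
  assumes x: "x \<in> V"
  shows "hess x i j *v Fd k x = dird (axis k 1) (Qd i) x *v Fd j x + Qd i x *v dird (axis k 1) (Fd j) x
    - (1/2) *\<^sub>R (Qd k x *v (matrix_inv (Q x) *v (Qd i x *v Fd j x)))
    - Qd i x *v dird (ch x k j) F x - Qd j x *v dird (ch x k i) F x"
proof -
  let ?T = "matrix_inv (Q x)"
  have s1: "dird (axis i 1) (Qd j) x *v Fd k x = dird (axis k 1) (Qd i) x *v Fd j x
      + Qd k x *v dird (axis i 1) (Fd j) x - Qd j x *v dird (axis i 1) (Fd k) x"
    using ddQ_dF[OF x, of "axis i 1" "axis j 1" "axis k 1"] dird_commute[OF V smooth_Q x, of "axis i 1" "axis k 1"]
    by (simp add: eq_diff_eq)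
  have s2: "dird (ch x i j) Q x *v Fd k x = Qd k x *v dird (ch x i j) F x"
    by (rule dQ_dF_commute[OF x])
  have c: "Qd p x *v Fd q x = 2 *\<^sub>R (Q x *v dird (ch x p q) F x) - 2 *\<^sub>R (Q x *v dird (axis p 1) (Fd q) x)" for p q
    unfolding Q_christoffel[OF x] by (simp add: scaleR_add_right)
  have s3: "A *v (?T *v (Qd p x *v Fd q x)) = 2 *\<^sub>R (A *v dird (ch x p q) F x) - 2 *\<^sub>R (A *v dird (axis p 1) (Fd q) x)" for A :: "real^'k^'k" and p q
    unfolding c[of p q] by (simp add: matrix_vector_simps Q_inverse_mult[OF x])
  have "hess x i j *v Fd k x = dird (axis i 1) (Qd j) x *v Fd k x - dird (ch x i j) Q x *v Fd k x
     - (1/2) *\<^sub>R (Qd i x *v (?T *v (Qd j x *v Fd k x)) + Qd j x *v (?T *v (Qd i x *v Fd k x)))"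
    by (simp add: hess_def matrix_vector_simps matrix_vector_mul_assoc matrix_mul_assoc)
  also have "\<dots> = dird (axis k 1) (Qd i) x *v Fd j x
      + Qd k x *v dird (axis i 1) (Fd j) x - Qd j x *v dird (axis i 1) (Fd k) x - Qd k x *v dird (ch x i j) F x
      - (Qd i x *v dird (ch x j k) F x - Qd i x *v dird (axis j 1) (Fd k) x)
      - (Qd j x *v dird (ch x i k) F x - Qd j x *v dird (axis i 1) (Fd k) x)"
    unfolding s1 s2 s3[of _ j k] s3[of _ i k] by (simp add: algebra_simps)
  also have "\<dots> = dird (axis k 1) (Qd i) x *v Fd j x + Qd i x *v dird (axis k 1) (Fd j) x
    - (1/2) *\<^sub>R (Qd k x *v (?T *v (Qd i x *v Fd j x)))
    - Qd i x *v dird (ch x k j) F x - Qd j x *v dird (ch x k i) F x"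
    unfolding s3[of _ i j] Gam_commute_F[OF x, of "axis k 1"] dird_commute[OF V smooth_F x, of "axis k 1" "axis j 1"]
    by (simp add: algebra_simps)
  finally show ?thesis .
qed

text \<open>Contraction commutes with covariant differentiation. Apolarity turns the differentiated
  part into \<open>2 * real CARD('n)\<close> times \<open>Q x *v Fd k x\<close>, and half the
  quadratic part gives the same multiple, so they cancel.\<close>

lemma trace_hess_Fd:
  assumes x: "x \<in> V"
  shows "(\<Sum>i\<in>UNIV. \<Sum>j\<in>UNIV. hinv x $ i $ j *\<^sub>R (hess x i j *v Fd k x)) = 0"
proof -
  let ?I = "hinv x" and ?T = "matrix_inv (Q x)"
  let ?S = "\<lambda>g :: 'n \<Rightarrow> 'n \<Rightarrow> real^'k. \<Sum>i\<in>UNIV. \<Sum>j\<in>UNIV. ?I $ i $ j *\<^sub>R g i j"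
  let ?W = "?S (\<lambda>i j. Qd i x *v dird (ch x k j) F x)"
  have swap: "?S (\<lambda>i j. g j i) = ?S g" for g
    by (subst sum.swap) (simp add: hinv_commute[OF x])
  have "?S (\<lambda>i j. hess x i j *v Fd k x) =
      ?S (\<lambda>i j. dird (axis k 1) (Qd i) x *v Fd j x + Qd i x *v dird (axis k 1) (Fd j) x)
    - (1/2) *\<^sub>R ?S (\<lambda>i j. Qd k x *v (?T *v (Qd i x *v Fd j x)))
    - ?W - ?S (\<lambda>i j. Qd j x *v dird (ch x k i) F x)"
    unfolding hess_Fd[OF x] by (simp add: scaleR_diff_right sum_subtractf scaleR_sum_right mult.commute)
  also have "?S (\<lambda>i j. Qd j x *v dird (ch x k i) F x) = ?W" by (rule swap)
  also have "?S (\<lambda>i j. Qd k x *v (?T *v (Qd i x *v Fd j x))) = Qd k x *v (?T *v ?S (\<lambda>i j. Qd i x *v Fd j x))"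
    by (simp add: bounded_bilinear.sum_right[OF bounded_bilinear_matrix_vector_mult] matrix_vector_simps)
  also have "\<dots> = (4 * real CARD('n)) *\<^sub>R (Q x *v Fd k x)"
    unfolding trace_dQ_dF[OF x] by (simp add: matrix_vector_simps Q_inverse_mult[OF x] dQ_F[OF x])
  also have "?S (\<lambda>i j. dird (axis k 1) (Qd i) x *v Fd j x + Qd i x *v dird (axis k 1) (Fd j) x)
      = (2 * real CARD('n)) *\<^sub>R (Q x *v Fd k x)
      - (\<Sum>i\<in>UNIV. \<Sum>j\<in>UNIV. dird (axis k 1) hinv x $ i $ j *\<^sub>R (Qd i x *v Fd j x))"
    by (rule dird_trace_dQ_dF[OF x])
  \<comment> \<open>Both Christoffel sums from the derivative of the inverse metric equal
    \<open>?W\<close> by symmetry in \<open>i\<close> and \<open>j\<close>; they cancel the two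
    copies of \<open>?W\<close> coming from \<open>hess_Fd\<close>.\<close>
  also have "(\<Sum>i\<in>UNIV. \<Sum>j\<in>UNIV. dird (axis k 1) hinv x $ i $ j *\<^sub>R (Qd i x *v Fd j x)) = - (2 *\<^sub>R ?W)"
  proof -
    have lin: "A *v dird t F x = (\<Sum>l\<in>UNIV. t $ l *\<^sub>R (A *v Fd l x))" for A :: "real^'k^'k" and t
      by (subst linear_axis_sum[OF linear_dird[OF smooth_F x], of t])
        (simp add: bounded_bilinear.sum_right[OF bounded_bilinear_matrix_vector_mult] matrix_vector_simps)
    have 1: "(\<Sum>i\<in>UNIV. \<Sum>j\<in>UNIV. (\<Sum>l\<in>UNIV. ?I $ i $ l * ch x k l $ j) *\<^sub>R (Qd i x *v Fd j x)) = ?W"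
    proof (rule sum.cong[OF refl])
      fix i
      have "(\<Sum>j\<in>UNIV. (\<Sum>l\<in>UNIV. ?I $ i $ l * ch x k l $ j) *\<^sub>R (Qd i x *v Fd j x))
          = (\<Sum>l\<in>UNIV. \<Sum>j\<in>UNIV. ?I $ i $ l *\<^sub>R (ch x k l $ j *\<^sub>R (Qd i x *v Fd j x)))"
        by (subst sum.swap) (simp add: scaleR_sum_left)
      moreover have "Qd i x *v dird (ch x k l) F x = (\<Sum>j\<in>UNIV. ch x k l $ j *\<^sub>R (Qd i x *v Fd j x))" for l
        by (rule lin)
      ultimately show "(\<Sum>j\<in>UNIV. (\<Sum>l\<in>UNIV. ?I $ i $ l * ch x k l $ j) *\<^sub>R (Qd i x *v Fd j x))
          = (\<Sum>j\<in>UNIV. ?I $ i $ j *\<^sub>R (Qd i x *v dird (ch x k j) F x))"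
        by (simp add: scaleR_sum_right)
    qed
    have "(\<Sum>i\<in>UNIV. \<Sum>j\<in>UNIV. (\<Sum>l\<in>UNIV. ch x k l $ i * ?I $ l $ j) *\<^sub>R (Qd i x *v Fd j x))
       = (\<Sum>j\<in>UNIV. \<Sum>i\<in>UNIV. (\<Sum>l\<in>UNIV. ?I $ j $ l * ch x k l $ i) *\<^sub>R (Qd j x *v Fd i x))"
      by (subst sum.swap) (simp add: dQ_dF_commute[OF x, of "axis _ 1" "axis _ 1"] hinv_commute[OF x] mult.commute)
    then have 2: "(\<Sum>i\<in>UNIV. \<Sum>j\<in>UNIV. (\<Sum>l\<in>UNIV. ch x k l $ i * ?I $ l $ j) *\<^sub>R (Qd i x *v Fd j x)) = ?W"
      using 1 by simp
    show ?thesis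
      unfolding dird_hinv[OF x] scaleR_diff_left scaleR_minus_left sum_subtractf sum_negf 1 2 by (simp add: scaleR_2)
  qed
  finally show ?thesis by (simp add: algebra_simps scaleR_2)
qed

theorem trace_hess:
  assumes x: "x \<in> V"
  shows "(\<Sum>i\<in>UNIV. \<Sum>j\<in>UNIV. hinv x $ i $ j *\<^sub>R hess x i j) = 0" (is "?R = 0")
proof -
  have R: "?R *v z = (\<Sum>i\<in>UNIV. \<Sum>j\<in>UNIV. hinv x $ i $ j *\<^sub>R (hess x i j *v z))" for z
    by (simp add: bounded_bilinear.sum_left[OF bounded_bilinear_matrix_vector_mult] matrix_vector_simps)
  have "?R *v y = 0 *v y" for y
  proof -
    obtain v c where y: "y = dird v F x + c *\<^sub>R F x" using spanning[OF x] by blast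
    have "?R *v dird v F x = 0"
      by (subst linear_axis_sum[OF linear_dird[OF smooth_F x], of v])
        (simp only: bounded_bilinear.sum_right[OF bounded_bilinear_matrix_vector_mult] matrix_vector_simps R trace_hess_Fd[OF x] scaleR_zero_right sum.neutral_const)
    moreover have "?R *v F x = 0" unfolding R by (simp add: hess_F[OF x])
    ultimately show ?thesis unfolding y by (simp add: matrix_vector_simps)
  qed
  then show ?thesis by (simp add: matrix_eq)
qed

end

section \<open>Bordered matrices\<close>

lemma sum_option:
  fixes g :: "'n::finite option \<Rightarrow> 'b::comm_monoid_add"
  shows "(\<Sum>a\<in>UNIV. g a) = g None + (\<Sum>i\<in>UNIV. g (Some i))"
  unfolding UNIV_option_conv by (subst sum.insert) (auto simp: sum.reindex)

lemma prod_option: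
  fixes g :: "'n::finite option \<Rightarrow> 'b::comm_monoid_mult"
  shows "(\<Prod>a\<in>UNIV. g a) = g None * (\<Prod>i\<in>UNIV. g (Some i))"
  unfolding UNIV_option_conv by (subst prod.insert) (auto simp: prod.reindex)

text \<open>Gram matrix of a frame whose \<open>None\<close> slot is the position vector, orthogonal
  to the tangential slots; \<open>l\<close> is the squared length of that vector.\<close>

definition bordered :: "real \<Rightarrow> real^'n::finite^'n \<Rightarrow> real^('n option)^('n option)" where
  "bordered l H = (\<chi> a b. case a of
     None \<Rightarrow> (case b of None \<Rightarrow> l | Some j \<Rightarrow> 0)
   | Some i \<Rightarrow> (case b of None \<Rightarrow> 0 | Some j \<Rightarrow> H $ i $ j))"

lemma bordered_nth [simp]:
  "bordered l H $ None $ None = l" "bordered l H $ None $ Some j = 0"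
  "bordered l H $ Some i $ None = 0" "bordered l H $ Some i $ Some j = H $ i $ j"
  by (simp_all add: bordered_def)

lemma map_permutation_Some:
  assumes "\<pi> permutes (UNIV :: 'n::finite set)"
  shows "map_permutation UNIV Some \<pi> = map_option \<pi>"
proof
  fix a
  show "map_permutation UNIV Some \<pi> a = map_option \<pi> a"
    by (cases a) (auto simp: map_permutation_def restrict_id_def)
qed

lemma permutes_map_option:
  assumes "\<pi> permutes (UNIV :: 'n::finite set)"
  shows "map_option \<pi> permutes UNIV" "sign (map_option \<pi>) = sign \<pi>"
proof -
  have "map_permutation UNIV Some \<pi> permutes range Some"
    by (rule map_permutation_permutes) (use assms in \<open>auto simp: bij_betw_def\<close>)
  then show "map_option \<pi> permutes UNIV"
    unfolding map_permutation_Some[OF assms] by (rule permutes_subset) simp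
  show "sign (map_option \<pi>) = sign \<pi>"
    unfolding map_permutation_Some[OF assms, symmetric]
    by (rule sign_map_permutation) (use assms in auto)
qed

text \<open>Only permutations fixing \<open>None\<close> contribute, and these are exactly the
  images under \<open>map_option\<close> of permutations of the smaller index type.\<close>

lemma det_bordered: "det (bordered l H) = l * det (H :: real^'n::finite^'n)"
proof -
  let ?B = "bordered l H"
  let ?P = "{p. p permutes (UNIV :: 'n option set)}"
  let ?t = "\<lambda>p. of_int (sign p) * (\<Prod>a\<in>UNIV. ?B $ a $ p a)"
  have "det ?B = (\<Sum>p\<in>{p \<in> ?P. p None = None}. ?t p)"
    unfolding det_def
  proof (rule sum.mono_neutral_right)
    show "finite ?P" by (rule finite_permutations) simp
    show "\<forall>p\<in>?P - {p \<in> ?P. p None = None}. ?t p = 0"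
      by (auto simp: prod_option)
  qed auto
  also have "\<dots> = (\<Sum>\<pi>\<in>{\<pi>. \<pi> permutes (UNIV :: 'n set)}. l * (of_int (sign \<pi>) * (\<Prod>i\<in>UNIV. H $ i $ \<pi> i)))"
  proof (rule sum.reindex_bij_witness[where i = map_option and j = "\<lambda>p i. the (p (Some i))"])
    fix p assume p: "p \<in> {p \<in> ?P. p None = None}"
    then have inj: "p a = p b \<Longrightarrow> a = b" for a b by (metis (mono_tags) mem_Collect_eq permutes_def)
    have Some: "\<exists>j. p (Some i) = Some j" for i
      using p inj[of "Some i" None] by (cases "p (Some i)") auto
    have e: "map_option (\<lambda>i. the (p (Some i))) a = p a" for a
    proof (cases a)
      case None
      then show ?thesis using p by simp
    next
      case (Some i)
      then show ?thesis using \<open>\<And>i. \<exists>j. p (Some i) = Some j\<close>[of i] by auto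
    qed
    then show eq: "map_option (\<lambda>i. the (p (Some i))) = p" by auto
    have "inj (\<lambda>i. the (p (Some i)))"
      by (rule injI) (metis Some inj option.inject option.sel)
    then show \<pi>: "(\<lambda>i. the (p (Some i))) \<in> {\<pi>. \<pi> permutes UNIV}"
      by (simp add: finite_UNIV_inj_surj permutes_def bij_def bij_iff[symmetric] inj_imp_permutes)
    have "sign p = sign (\<lambda>i. the (p (Some i)))"
      using permutes_map_option(2)[of "\<lambda>i. the (p (Some i))"] \<pi> by (simp add: eq)
    moreover have "?B $ Some i $ p (Some i) = H $ i $ the (p (Some i))" for i
      using Some[of i] by auto
    ultimately show "l * (of_int (sign (\<lambda>i. the (p (Some i)))) * (\<Prod>i\<in>UNIV. H $ i $ the (p (Some i)))) = ?t p"
      using p by (simp add: prod_option)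
  next
    fix \<pi> assume "\<pi> \<in> {\<pi>. \<pi> permutes (UNIV :: 'n set)}"
    then show "(\<lambda>i. the (map_option \<pi> (Some i))) = \<pi>" "map_option \<pi> \<in> {p \<in> ?P. p None = None}"
      using permutes_map_option(1) by auto
  qed
  also have "\<dots> = l * det H" by (simp add: det_def sum_distrib_left)
  finally show ?thesis .
qed

text \<open>On the segment from the identity to \<open>H\<close> all matrices are positive definite,
  so the determinant cannot vanish on it and keeps the sign it has at the identity.\<close>

lemma pos_def_det_pos:
  fixes H :: "real^'n::finite^'n"
  assumes "pos_def H"
  shows "det H > 0"
proof (rule ccontr)
  let ?g = "\<lambda>t. det ((1 - t) *\<^sub>R mat 1 + t *\<^sub>R H)"
  assume "\<not> det H > 0"
  moreover have "continuous_on {0..1} ?g"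
    unfolding det_def by (intro continuous_intros)
  ultimately have "\<exists>t\<ge>0. t \<le> 1 \<and> ?g t = 0"
    by (intro IVT2') auto
  then obtain t where t: "0 \<le> t" "t \<le> 1" "?g t = 0" by blast
  have "pos_def ((1 - t) *\<^sub>R mat 1 + t *\<^sub>R H)"
    unfolding pos_def_def
  proof (intro allI impI)
    fix x :: "real^'n" assume x: "x \<noteq> 0"
    then have "x \<bullet> x > 0" "x \<bullet> (H *v x) > 0" using assms by (auto simp: pos_def_def)
    then have "(1 - t) * (x \<bullet> x) + t * (x \<bullet> (H *v x)) > 0"
      using t(1,2) by (cases "t = 0") (auto intro: add_nonneg_pos)
    then show "x \<bullet> (((1 - t) *\<^sub>R mat 1 + t *\<^sub>R H) *v x) > 0"
      by (simp add: matrix_vector_simps inner_right_distrib)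
  qed
  then show False using pos_def_det t(3) by blast
qed

definition extend_zero :: "real^'n::finite \<Rightarrow> real^('n option)" where
  "extend_zero v = (\<chi> a. case a of None \<Rightarrow> 0 | Some i \<Rightarrow> v $ i)"

definition restrict_some :: "real^('n::finite option) \<Rightarrow> real^'n" where
  "restrict_some z = (\<chi> i. z $ Some i)"

lemma inner_bordered:
  "z \<bullet> (bordered l H *v w) = restrict_some z \<bullet> (H *v restrict_some w) + l * (z $ None * w $ None)"
  by (simp add: inner_vec_def matrix_vector_mult_def sum_option restrict_some_def)

lemma restrict_some_simps:
  "restrict_some (extend_zero v) = v" "extend_zero v $ None = 0" "restrict_some (axis None 1) = 0"
  by (simp_all add: restrict_some_def extend_zero_def axis_def vec_eq_iff)

section \<open>Charts of an affine sphere\<close>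

locale affine_sphere_atlas =
  fixes M :: "'m topology" and A :: "('m, real^'n::finite) chart set"
    and f :: "'m \<Rightarrow> real^('n option)" and h :: "('m, real^'n) form2"
  assumes manifold: "smooth_manifold M A" and sphere: "hyperbolic_affine_sphere M A f h"
begin

lemma chart:
  assumes "c \<in> A"
  shows "openin M (fst c)" "open (chart_image c)"
    "homeomorphic_map (subtopology M (fst c)) (top_of_set (chart_image c)) (snd c)"
  using manifold assms unfolding smooth_manifold_def by blast+

lemma chart_inv:
  assumes "c \<in> A"
  shows "p \<in> fst c \<Longrightarrow> chart_inv c (snd c p) = p" "p \<in> fst c \<Longrightarrow> snd c p \<in> chart_image c"
    "y \<in> chart_image c \<Longrightarrow> chart_inv c y \<in> fst c" "y \<in> chart_image c \<Longrightarrow> snd c (chart_inv c y) = y"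
proof -
  have "inj_on (snd c) (fst c)"
    using homeomorphic_imp_injective_map[OF chart(3)[OF assms]] openin_subset[OF chart(1)[OF assms]]
    by (simp add: Int_absorb1)
  then show "p \<in> fst c \<Longrightarrow> chart_inv c (snd c p) = p" by (simp add: chart_inv_def)
  show "p \<in> fst c \<Longrightarrow> snd c p \<in> chart_image c" by (simp add: chart_image_def)
  show "y \<in> chart_image c \<Longrightarrow> chart_inv c y \<in> fst c" "y \<in> chart_image c \<Longrightarrow> snd c (chart_inv c y) = y"
    unfolding chart_image_def chart_inv_def by (auto intro: inv_into_into f_inv_into_f)
qed

lemma smooth_coord_rep: "c \<in> A \<Longrightarrow> smooth_on (chart_image c) (coord_rep c f)"
  using sphere unfolding hyperbolic_affine_sphere_def smooth_map_def coord_rep_def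
  by (auto simp: chart_image_def o_def)

lemma differential_dird:
  "c \<in> A \<Longrightarrow> y \<in> chart_image c \<Longrightarrow> dird v (coord_rep c f) y = differential c f (chart_inv c y) v"
  by (simp add: dird_def differential_def chart_inv)

lemma linear_differential: "c \<in> A \<Longrightarrow> p \<in> fst c \<Longrightarrow> linear (differential c f p)"
  using linear_dird[OF smooth_coord_rep, of c "snd c p"] chart_inv
  unfolding differential_def dird_def by simp

lemma metric:
  assumes "c \<in> A" "p \<in> fst c"
  shows "bilinear (h c p)" "h c p v w = h c p w v" "v \<noteq> 0 \<Longrightarrow> h c p v v > 0"
  using sphere assms unfolding hyperbolic_affine_sphere_def riemannian_metric_def by blast+

lemma h_gram_matrix:
  assumes "c \<in> A" "p \<in> fst c"
  shows "h c p v w = v \<bullet> (gram_matrix (h c p) *v w)"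
proof -
  have "h c p v w = (\<Sum>i\<in>UNIV. v $ i * (\<Sum>j\<in>UNIV. w $ j * h c p (axis i 1) (axis j 1)))"
    using metric(1)[OF assms] unfolding bilinear_def
    by (subst linear_axis_sum[of "\<lambda>v. h c p v w"], simp, subst linear_axis_sum[of "\<lambda>w. h c p _ w"]) auto
  then show ?thesis
    by (simp add: gram_matrix_def inner_vec_def matrix_vector_mult_def mult.commute)
qed

lemma pos_def_gram: "c \<in> A \<Longrightarrow> p \<in> fst c \<Longrightarrow> pos_def (gram_matrix (h c p))"
  by (simp add: pos_def_def h_gram_matrix[symmetric] metric(3))

section \<open>The Blaschke lift as an explicit matrix\<close>

definition frame :: "('m, real^'n) chart \<Rightarrow> 'm \<Rightarrow> real^('n option)^('n option)" where
  "frame c p = (\<chi> r k. case k of None \<Rightarrow> f p $ r | Some i \<Rightarrow> differential c f p (axis i 1) $ r)"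

lemma frame_mult:
  assumes "c \<in> A" "p \<in> fst c"
  shows "frame c p *v z = differential c f p (restrict_some z) + z $ None *\<^sub>R f p"
proof -
  have "differential c f p (restrict_some z) = (\<Sum>i\<in>UNIV. z $ Some i *\<^sub>R differential c f p (axis i 1))"
    by (subst linear_axis_sum[OF linear_differential[OF assms]]) (simp add: restrict_some_def)
  then show ?thesis
    by (simp add: vec_eq_iff frame_def matrix_vector_mult_def sum_option mult.commute)
qed

lemma frame_simps:
  assumes "c \<in> A" "p \<in> fst c"
  shows "frame c p *v extend_zero v = differential c f p v" "frame c p *v axis None 1 = f p"
  unfolding frame_mult[OF assms] using linear_0[OF linear_differential[OF assms]]
  by (simp_all add: restrict_some_simps)

lemma frame_surj:
  assumes "c \<in> A" "p \<in> fst c"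
  shows "\<exists>v r. y = differential c f p v + r *\<^sub>R f p"
proof -
  have "{u + w | u w. u \<in> range (differential c f p) \<and> w \<in> span {f p}} = UNIV"
    using sphere assms unfolding hyperbolic_affine_sphere_def by blast
  then have "y \<in> {u + w | u w. u \<in> range (differential c f p) \<and> w \<in> span {f p}}" by blast
  then show ?thesis by (auto simp: span_singleton)
qed

text \<open>The volume condition is evaluated on the standard basis. Squaring removes both the
  square root and the orientation sign.\<close>

lemma det_frame:
  assumes "c \<in> A" "p \<in> fst c"
  shows "det (frame c p) \<noteq> 0" "(det (frame c p))\<^sup>2 = det (gram_matrix (h c p))"
proof -
  have "\<exists>z. frame c p *v z = y" for y
  proof -
    obtain v r where "y = differential c f p v + r *\<^sub>R f p" using frame_surj[OF assms] by blast
    then have "frame c p *v (extend_zero v + r *\<^sub>R axis None 1) = y"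
      by (simp add: matrix_vector_simps frame_simps[OF assms])
    then show ?thesis by blast
  qed
  then have "surj ((*v) (frame c p))" by (metis surjI surj_def)
  then show "det (frame c p) \<noteq> 0"
    by (metis invertible_det_nz invertible_right_inverse matrix_right_invertible_surjective)
  have "(\<forall>X. det_extend (\<lambda>i. differential c f p (X i)) (f p) = volume_form h c p X) \<or>
      (\<forall>X. det_extend (\<lambda>i. differential c f p (X i)) (f p) = - volume_form h c p X)"
    using sphere assms unfolding hyperbolic_affine_sphere_def by blast
  then have "det_extend (\<lambda>i. differential c f p (axis i 1)) (f p) = volume_form h c p (\<lambda>i. axis i 1) \<or>
      det_extend (\<lambda>i. differential c f p (axis i 1)) (f p) = - volume_form h c p (\<lambda>i. axis i 1)"
    by (elim disjE) (drule spec[where x = "\<lambda>i. axis i 1"], simp)+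
  moreover have "det_extend (\<lambda>i. differential c f p (axis i 1)) (f p) = det (frame c p)"
    by (simp add: det_extend_def frame_def)
  moreover have "volume_form h c p (\<lambda>i. axis i 1) = sqrt (det (gram_matrix (h c p)))"
  proof -
    have "(\<chi> r i. axis i (1::real) $ r) = (mat 1 :: real^'n^'n)"
      by (simp add: vec_eq_iff mat_def axis_def)
    then show ?thesis by (simp add: volume_form_def)
  qed
  ultimately show "(det (frame c p))\<^sup>2 = det (gram_matrix (h c p))"
    using pos_def_det_pos[OF pos_def_gram[OF assms]] by auto
qed

definition adapted :: "('m, real^'n) chart \<Rightarrow> 'm \<Rightarrow> real^('n option)^('n option) \<Rightarrow> bool" where
  "adapted c p N \<longleftrightarrow> (\<forall>v w. differential c f p v \<bullet> (N *v differential c f p w) = h c p v w) \<and>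
     (\<forall>v. f p \<bullet> (N *v differential c f p v) = 0)"

text \<open>The form whose Gram matrix in the frame is \<open>bordered 1\<close> of the Gram matrix
  of \<open>h\<close>. The entry 1 is the one compatible with determinant 1, by
  \<open>det_frame\<close>.\<close>

definition lift :: "('m, real^'n) chart \<Rightarrow> 'm \<Rightarrow> real^('n option)^('n option)" where
  "lift c p = transpose (matrix_inv (frame c p)) ** bordered 1 (gram_matrix (h c p)) ** matrix_inv (frame c p)"

lemma frame_inverse:
  assumes "c \<in> A" "p \<in> fst c"
  shows "matrix_inv (frame c p) *v (frame c p *v z) = z" "frame c p *v (matrix_inv (frame c p) *v z) = z"
  by (simp_all add: matrix_vector_mul_assoc matrix_inv_mult det_frame[OF assms])

lemma inner_lift: "y \<bullet> (lift c p *v z)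
    = (matrix_inv (frame c p) *v y) \<bullet> (bordered 1 (gram_matrix (h c p)) *v (matrix_inv (frame c p) *v z))"
  unfolding lift_def matrix_vector_mul_assoc[symmetric] inner_matrix_left[of "matrix_inv (frame c p)"] ..

lemma lift_frame:
  assumes "c \<in> A" "p \<in> fst c"
  shows "adapted c p (lift c p)" "f p \<bullet> (lift c p *v f p) = 1"
  unfolding adapted_def inner_lift frame_simps[OF assms, symmetric] frame_inverse[OF assms]
  by (simp_all add: inner_bordered restrict_some_simps h_gram_matrix[OF assms])

lemma lift_scalar_product:
  assumes "c \<in> A" "p \<in> fst c"
  shows "lift c p \<in> scalar_products"
proof -
  let ?H = "gram_matrix (h c p)" and ?E = "matrix_inv (frame c p)"
  have "transpose (bordered 1 ?H) = bordered 1 ?H"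
  proof -
    have "bordered 1 ?H $ a $ b = bordered 1 ?H $ b $ a" for a b
      by (cases a; cases b) (auto simp: gram_matrix_def metric(2)[OF assms])
    then show ?thesis by (simp add: transpose_def vec_eq_iff)
  qed
  then have sym: "transpose (lift c p) = lift c p"
    by (simp add: lift_def matrix_transpose_mul matrix_mul_assoc)
  have pos: "x \<bullet> (lift c p *v x) > 0" if x: "x \<noteq> 0" for x
  proof -
    let ?z = "?E *v x"
    have "?z \<noteq> 0" using frame_inverse(2)[OF assms, of x] x by auto
    then have z: "restrict_some ?z \<noteq> 0 \<or> ?z $ None \<noteq> 0"
      by (auto simp: restrict_some_def vec_eq_iff) (metis not_None_eq)
    have "?z \<bullet> (bordered 1 ?H *v ?z) = h c p (restrict_some ?z) (restrict_some ?z) + (?z $ None)\<^sup>2"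
      by (simp add: inner_bordered h_gram_matrix[OF assms] power2_eq_square)
    also have "\<dots> > 0"
    proof (cases "restrict_some ?z = 0")
      case True
      then show ?thesis using z bilinear_lzero[OF metric(1)[OF assms]] by simp
    next
      case False
      then show ?thesis using metric(3)[OF assms False] by (intro add_pos_nonneg) auto
    qed
    finally show ?thesis unfolding inner_lift .
  qed
  have "det ?E * det (frame c p) = 1"
    using arg_cong[OF matrix_inv_mult(2)[OF det_frame(1)[OF assms]], of det] by (simp add: det_mul)
  then have "(det ?E)\<^sup>2 * (det (frame c p))\<^sup>2 = 1" by (metis power_mult_distrib power_one)
  then have "det (lift c p) = 1"
    unfolding lift_def det_mul det_transpose det_bordered det_frame(2)[OF assms] by (simp add: power2_eq_square mult_ac)
  with sym pos show ?thesis by (simp add: scalar_products_def)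
qed

text \<open>Adaptedness fixes the Gram matrix of \<open>N\<close> in the frame up to the entry
  \<open>l\<close>. Comparing determinants, with \<open>det N = 1\<close> and the value from
  \<open>det_frame\<close>, gives \<open>l = 1\<close>.\<close>

lemma adapted_unique:
  assumes c: "c \<in> A" "p \<in> fst c" and N: "N \<in> scalar_products" "adapted c p N"
  shows "N = lift c p"
proof -
  let ?E = "frame c p" and ?H = "gram_matrix (h c p)"
  define l where "l = f p \<bullet> (N *v f p)"
  have tN: "transpose N = N" and dN: "det N = 1" using N(1) by (auto simp: scalar_products_def)
  have nf: "differential c f p v \<bullet> (N *v f p) = 0" for v
    using N(2) inner_matrix_left[of N "f p" "differential c f p v"] tN
    by (simp add: adapted_def inner_commute)
  have bil: "(?E *v z) \<bullet> (N *v (?E *v w)) = z \<bullet> (bordered l ?H *v w)" for z w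
    using N(2) nf unfolding frame_mult[OF c] adapted_def
    by (simp add: matrix_vector_simps inner_left_distrib inner_right_distrib inner_bordered h_gram_matrix[OF c] l_def algebra_simps)
  have E: "transpose ?E ** N ** ?E = bordered l ?H"
  proof -
    have "z \<bullet> ((transpose ?E ** N ** ?E) *v w) = z \<bullet> (bordered l ?H *v w)" for z w
      unfolding bil[symmetric] by (simp add: matrix_vector_mul_assoc[symmetric] inner_matrix_left del: transpose_matrix_vector)
    then show ?thesis unfolding matrix_eq using vector_eq_ldot by blast
  qed
  have "(det ?E)\<^sup>2 = l * (det ?E)\<^sup>2"
    using arg_cong[OF E, of det] unfolding det_mul det_transpose det_bordered dN det_frame(2)[OF c, symmetric]
    by (simp add: power2_eq_square)
  then have "l = 1" using det_frame(1)[OF c] by simp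
  then have "y \<bullet> (N *v z) = y \<bullet> (lift c p *v z)" for y z
    unfolding inner_lift using bil[of "matrix_inv ?E *v y" "matrix_inv ?E *v z"] frame_inverse(2)[OF c] by simp
  then show ?thesis unfolding matrix_eq using vector_eq_ldot by blast
qed

text \<open>The differential of \<open>f\<close> and the metric transform by the same Jacobian. This
  is needed since \<open>blaschke_lift\<close> imposes its conditions in every chart at the point,
  whereas \<open>lift\<close> uses one.\<close>

lemma adapted_change_chart:
  assumes c: "c \<in> A" "p \<in> fst c" and d: "d \<in> A" "p \<in> fst d" and N: "adapted c p N"
  shows "adapted d p N"
proof -
  let ?W = "snd d ` (fst d \<inter> fst c)"
  let ?D = "frechet_derivative (transition d c) (at (snd d p))"
  have W: "open ?W"
  proof -
    have "openin (subtopology M (fst d)) (fst d \<inter> fst c)"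
      using chart(1)[OF c(1)] by (simp add: openin_subtopology_Int2)
    then have "openin (top_of_set (chart_image d)) ?W"
      using homeomorphic_imp_open_map[OF chart(3)[OF d(1)]] unfolding open_map_def by blast
    then show ?thesis using openin_open_eq[OF chart(2)[OF d(1)]] by blast
  qed
  have pW: "snd d p \<in> ?W" using c d by blast
  have "smooth_on ?W (transition d c)"
    using manifold c(1) d(1) unfolding smooth_manifold_def by blast
  then have t: "(transition d c has_derivative ?D) (at (snd d p))"
    using pW unfolding smooth_on_def by (metis Ck_on_SucE)
  have tp: "transition d c (snd d p) = snd c p"
    by (simp add: transition_def chart_inv(1)[OF d])
  have "smooth_on (chart_image c) (coord_rep c f)" by (rule smooth_coord_rep[OF c(1)])
  then have "(coord_rep c f has_derivative differential c f p) (at (transition d c (snd d p)))"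
    unfolding tp differential_def smooth_on_def using chart_inv(2)[OF c] by (metis Ck_on_SucE)
  from has_derivative_compose[OF t this]
  have "((\<lambda>y. coord_rep c f (transition d c y)) has_derivative (\<lambda>v. differential c f p (?D v))) (at (snd d p))" .
  then have "(coord_rep d f has_derivative (\<lambda>v. differential c f p (?D v))) (at (snd d p))"
  proof (rule has_derivative_transform_within_open[OF _ W pW])
    fix y assume "y \<in> ?W"
    then obtain q where q: "q \<in> fst d" "q \<in> fst c" "y = snd d q" by blast
    then show "coord_rep c f (transition d c y) = coord_rep d f y"
      by (simp add: coord_rep_def transition_def chart_inv(1)[OF d(1)] chart_inv(1)[OF c(1)])
  qed
  then have df: "differential d f p v = differential c f p (?D v)" for v
    using frechet_derivative_at unfolding differential_def by metis
  have "h d p v w = h c p (?D v) (?D w)" for v w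
    using sphere c d unfolding hyperbolic_affine_sphere_def riemannian_metric_def by blast
  then show ?thesis using N unfolding adapted_def df by simp
qed

lemma blaschke_lift_eq:
  assumes c: "c \<in> A" "p \<in> fst c"
  shows "blaschke_lift A f h p = lift c p"
  unfolding blaschke_lift_def
proof (rule the_equality)
  show "lift c p \<in> scalar_products \<and> (\<forall>d\<in>A. p \<in> fst d \<longrightarrow>
        (\<forall>v w. differential d f p v \<bullet> (lift c p *v differential d f p w) = h d p v w) \<and>
        (\<forall>v. f p \<bullet> (lift c p *v differential d f p v) = 0))"
    using lift_scalar_product[OF c] adapted_change_chart[OF c _ _ lift_frame(1)[OF c]] unfolding adapted_def by blast
qed (use adapted_unique[OF c] c in \<open>auto simp: adapted_def\<close>)

definition local_lift :: "('m, real^'n) chart \<Rightarrow> real^'n \<Rightarrow> real^('n option)^('n option)" where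
  "local_lift c y = blaschke_lift A f h (chart_inv c y)"

lemma smooth_local_lift:
  assumes c: "c \<in> A"
  shows "smooth_on (chart_image c) (local_lift c)"
proof -
  let ?V = "chart_image c"
  have V: "open ?V" by (rule chart(2)[OF c])
  have F: "Ck_on k ?V (coord_rep c f)" "Ck_on k ?V (dird v (coord_rep c f))" for k v
    using smooth_coord_rep[OF c] smooth_on_dird[OF smooth_coord_rep[OF c]] unfolding smooth_on_def by auto
  have h: "Ck_on k ?V (\<lambda>y. h c (chart_inv c y) v w)" for k v w
    using sphere c unfolding hyperbolic_affine_sphere_def riemannian_metric_def smooth_on_def local_form_def by blast
  have E: "Ck_on k ?V (\<lambda>y. frame c (chart_inv c y))" for k
  proof (intro Ck_on_vec[OF V])
    fix r a
    show "Ck_on k ?V (\<lambda>y. frame c (chart_inv c y) $ r $ a)"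
    proof (cases a)
      case None
      then show ?thesis using Ck_on_vec_nth[OF V F(1)] by (simp add: frame_def coord_rep_def)
    next
      case (Some i)
      have "Ck_on k ?V (\<lambda>y. dird (axis i 1) (coord_rep c f) y $ r)" by (rule Ck_on_vec_nth[OF V F(2)])
      then show ?thesis
        by (rule Ck_on_cong[OF V, rotated]) (simp add: frame_def Some differential_dird[OF c])
    qed
  qed
  have B: "Ck_on k ?V (\<lambda>y. bordered 1 (gram_matrix (h c (chart_inv c y))))" for k
  proof (intro Ck_on_vec[OF V])
    fix a b
    show "Ck_on k ?V (\<lambda>y. bordered 1 (gram_matrix (h c (chart_inv c y))) $ a $ b)"
      by (cases a; cases b) (auto simp: gram_matrix_def intro: Ck_on_const h)
  qed
  have I: "Ck_on k ?V (\<lambda>y. matrix_inv (frame c (chart_inv c y)))" for k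
    by (rule Ck_on_matrix_inv[OF V E]) (simp add: det_frame[OF c] chart_inv[OF c])
  have "Ck_on k ?V (\<lambda>y. lift c (chart_inv c y))" for k
    unfolding lift_def
    by (intro Ck_on_bilinear[OF V bounded_bilinear_matrix_mult] Ck_on_linear[OF V bounded_linear_transpose] I B)
  then have "Ck_on k ?V (local_lift c)" for k
    by (rule Ck_on_cong[OF V, rotated]) (simp add: local_lift_def blaschke_lift_eq[OF c] chart_inv[OF c])
  then show ?thesis by (simp add: smooth_on_def)
qed

lemma blaschke_chart_local:
  assumes c: "c \<in> A"
  shows "blaschke_chart (chart_image c) (coord_rep c f) (local_lift c) (local_form h c)"
proof
  let ?V = "chart_image c"
  show "open ?V" by (rule chart(2)[OF c])
  show "smooth_on ?V (coord_rep c f)" by (rule smooth_coord_rep[OF c])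
  show "smooth_on ?V (local_lift c)" by (rule smooth_local_lift[OF c])
  fix x assume x: "x \<in> ?V"
  let ?p = "chart_inv c x"
  have p: "?p \<in> fst c" by (rule chart_inv(3)[OF c x])
  have Q: "local_lift c x = lift c ?p" by (simp add: local_lift_def blaschke_lift_eq[OF c p])
  have f: "coord_rep c f x = f ?p" by (simp add: coord_rep_def)
  note D = differential_dird[OF c x]
  show "transpose (local_lift c x) = local_lift c x" "det (local_lift c x) = 1"
    using lift_scalar_product[OF c p] unfolding Q scalar_products_def by auto
  show "v \<noteq> 0 \<Longrightarrow> local_form h c x v v > 0" for v
    by (simp add: local_form_def metric(3)[OF c p])
  show "dird v (coord_rep c f) x \<bullet> (local_lift c x *v dird w (coord_rep c f) x) = local_form h c x v w" for v w
    using lift_frame(1)[OF c p] unfolding D Q adapted_def local_form_def by blast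
  show n: "coord_rep c f x \<bullet> (local_lift c x *v dird v (coord_rep c f) x) = 0" for v
    using lift_frame(1)[OF c p] unfolding D Q f adapted_def by blast
  show one: "coord_rep c f x \<bullet> (local_lift c x *v coord_rep c f x) = 1"
    using lift_frame(2)[OF c p] unfolding Q f .
  show "\<exists>v r. y = dird v (coord_rep c f) x + r *\<^sub>R coord_rep c f x" for y
    using frame_surj[OF c p] unfolding D f .
  show "dird v (dird w (coord_rep c f)) x \<bullet> (local_lift c x *v coord_rep c f x) = local_form h c x v w" for v w
  proof -
    obtain \<Gamma> where \<Gamma>: "structure_equation A f \<Gamma> h"
      using sphere unfolding hyperbolic_affine_sphere_def by blast
    \<comment> \<open>A constant field \<open>Y\<close> suffices: the Christoffel part of the
      structure equation is tangential, hence annihilated by \<open>Q F\<close>.\<close>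
    have s: "smooth_on ?V (\<lambda>y. w)" by (simp add: smooth_on_def Ck_on_const)
    have "dird v (dird w (coord_rep c f)) x = dird (cov_deriv (\<Gamma> c) (\<lambda>y. w) x v) (coord_rep c f) x
          + local_form h c x v w *\<^sub>R coord_rep c f x"
      unfolding dird_def[abs_def]
      by (rule \<Gamma>[unfolded structure_equation_def, THEN bspec, OF c, THEN bspec, OF x, THEN spec, THEN spec, THEN mp, OF s])
    moreover have "dird u (coord_rep c f) x \<bullet> (local_lift c x *v coord_rep c f x) = 0" for u
      using n[of u] inner_matrix_left[of "local_lift c x" "coord_rep c f x" "dird u (coord_rep c f) x"]
        \<open>transpose (local_lift c x) = local_lift c x\<close> by (simp add: inner_commute)
    ultimately show ?thesis using one by (simp add: inner_left_distrib)
  qed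
qed

section \<open>Smoothness and harmonicity of the lift\<close>

lemma pos_def_local_lift:
  assumes "c \<in> A" "x \<in> chart_image c"
  shows "pos_def (local_lift c x)"
  using lift_scalar_product[OF assms(1) chart_inv(3)[OF assms]] blaschke_lift_eq[OF assms(1) chart_inv(3)[OF assms]]
  by (simp add: local_lift_def scalar_products_def pos_def_def)

lemma cover: "p \<in> topspace M \<Longrightarrow> \<exists>c\<in>A. p \<in> fst c"
  using manifold unfolding smooth_manifold_def by auto

lemma lift_positive_subspace:
  assumes "p \<in> topspace M"
  shows "(Phi \<circ> blaschke_lift A f h) p \<in> positive_subspaces"
proof -
  obtain c where c: "c \<in> A" "p \<in> fst c" using cover[OF assms] by blast
  then show ?thesis
    using lift_scalar_product[OF c]
    by (simp add: Phi_def graph_in_positive_subspaces blaschke_lift_eq scalar_products_def pos_def_def)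
qed

text \<open>The target carries the topology pulled back along its single chart, so this amounts to
  continuity of the matrix-valued lift, glued from the charts of \<open>M\<close>.\<close>

lemma continuous_lift: "continuous_map M Y_topology (Phi \<circ> blaschke_lift A f h)"
  unfolding Y_topology_def
proof (rule continuous_map_pullback')
  show "topspace M \<subseteq> (Phi \<circ> blaschke_lift A f h) -` positive_subspaces"
    using lift_positive_subspace by auto
  have e: "snd graph_chart \<circ> (Phi \<circ> blaschke_lift A f h) = blaschke_lift A f h"
    by (simp add: fun_eq_iff Phi_def snd_graph_chart)
  show "continuous_map M euclidean (snd graph_chart \<circ> (Phi \<circ> blaschke_lift A f h))"
    unfolding e
  proof (rule pasting_lemma[where I = A and T = fst and f = "\<lambda>_. blaschke_lift A f h"])
    fix c assume c: "c \<in> A"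
    show "openin M (fst c)" by (rule chart(1)[OF c])
    have "continuous_on (chart_image c) (local_lift c)"
      using smooth_local_lift[OF c] Ck_on_continuous_on unfolding smooth_on_def by blast
    then have "continuous_map (top_of_set (chart_image c)) euclidean (local_lift c)" by simp
    then have "continuous_map (subtopology M (fst c)) euclidean (local_lift c \<circ> snd c)"
      using continuous_map_compose[OF homeomorphic_imp_continuous_map[OF chart(3)[OF c]]] by blast
    then show "continuous_map (subtopology M (fst c)) euclidean (blaschke_lift A f h)"
      by (rule continuous_map_eq) (simp add: local_lift_def chart_inv[OF c])
  next
    fix p assume "p \<in> topspace M"
    then show "\<exists>c. c \<in> A \<and> p \<in> fst c \<and> blaschke_lift A f h p = blaschke_lift A f h p"
      using cover by blast
  qed simp
qed

lemma tension_field_lift: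
  assumes c: "c \<in> A" and x: "x \<in> chart_image c"
  shows "tension_field h killing_metric c graph_chart (Phi \<circ> blaschke_lift A f h) x = 0"
proof -
  interpret B: blaschke_chart "chart_image c" "coord_rep c f" "local_lift c" "local_form h c"
    by (rule blaschke_chart_local[OF c])
  have u: "snd graph_chart \<circ> (Phi \<circ> blaschke_lift A f h) \<circ> chart_inv c = local_lift c"
    by (simp add: fun_eq_iff Phi_def snd_graph_chart local_lift_def)
  \<comment> \<open>This is where n at least 1 enters: index types are nonempty, so the ambient
    dimension is at least 2 and the Killing form is nonzero.\<close>
  have card: "CARD('n option) \<ge> 2" by (simp add: Suc_le_eq)
  have "B.hess x i j = dird (axis i 1) (dird (axis j 1) (local_lift c)) x
      - dird (christoffel (local_form h c) x (axis i 1) (axis j 1)) (local_lift c) x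
      + christoffel (local_form killing_metric graph_chart) (local_lift c x)
          (dird (axis i 1) (local_lift c) x) (dird (axis j 1) (local_lift c) x)" for i j
    unfolding B.hess_def
    by (simp add: christoffel_killing_metric[OF pos_def_local_lift[OF c x] B.sym[OF x] card B.transpose_dQ[OF x] B.transpose_dQ[OF x]])
  then show ?thesis
    unfolding tension_field_def u Let_def using B.trace_hess[OF x] by (simp add: dird_def[abs_def])
qed

theorem harmonic_lift: "harmonic_map M A h Y_topology Y_atlas killing_metric (Phi \<circ> blaschke_lift A f h)"
proof -
  have dom: "snd c ` (fst c \<inter> (Phi \<circ> blaschke_lift A f h) -` fst graph_chart) = chart_image c" if c: "c \<in> A" for c
  proof -
    have "fst c \<subseteq> (Phi \<circ> blaschke_lift A f h) -` fst graph_chart"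
    proof
      fix p assume "p \<in> fst c"
      then have "p \<in> topspace M" using openin_subset[OF chart(1)[OF c]] by blast
      from lift_positive_subspace[OF this] show "p \<in> (Phi \<circ> blaschke_lift A f h) -` fst graph_chart"
        by (simp add: graph_chart_def)
    qed
    then show ?thesis unfolding chart_image_def by (simp only: Int_absorb2)
  qed
  have u: "snd graph_chart \<circ> (Phi \<circ> blaschke_lift A f h) \<circ> chart_inv c = local_lift c" for c
    by (simp add: fun_eq_iff Phi_def snd_graph_chart local_lift_def)
  show ?thesis
    unfolding harmonic_map_def smooth_map_def Y_atlas_def
  proof (intro conjI ballI)
    show "continuous_map M Y_topology (Phi \<circ> blaschke_lift A f h)" by (rule continuous_lift)
    fix c d assume c: "c \<in> A" and "d \<in> {graph_chart :: ((((real, 'n option) vec \<times> (real, 'n option) vec) set), (real, 'n option) vec ^ 'n option) chart}"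
    then have d: "d = graph_chart" by simp
    show "smooth_on (snd c ` (fst c \<inter> (Phi \<circ> blaschke_lift A f h) -` fst d))
        (snd d \<circ> (Phi \<circ> blaschke_lift A f h) \<circ> chart_inv c)"
      unfolding d dom[OF c] u by (rule smooth_local_lift[OF c])
    fix x assume "x \<in> snd c ` (fst c \<inter> (Phi \<circ> blaschke_lift A f h) -` fst d)"
    then show "tension_field h killing_metric c d (Phi \<circ> blaschke_lift A f h) x = 0"
      unfolding d dom[OF c] by (rule tension_field_lift[OF c])
  qed
qed

end

theorem theorem4p14:
  fixes M :: "'m topology"
    and A :: "('m, real^'n::finite) chart set"
    and f :: "'m \<Rightarrow> real^('n option)"
    and h :: "('m, real^'n) form2"
  assumes "smooth_manifold M A" and "oriented_atlas A"
    and "hyperbolic_affine_sphere M A f h"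
  shows "harmonic_map M A h Y_topology Y_atlas killing_metric (Phi \<circ> blaschke_lift A f h)"
  using assms by (intro affine_sphere_atlas.harmonic_lift affine_sphere_atlas.intro)

end
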